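(* Let $n\ge 1$ and suppose $h$ is finite. If $h$ is odd, then the Hecke-Clifford superalgebra $\mathcal H_n(q)$ is semisimple if and only if $h>n$. If $h$ is even, then $\mathcal H_n(q)$ is semisimple if and only if $h>2n$.
   Context: Standing assumptions: $\mathbb F$ is an algebraically closed field with $\operatorname{char}\mathbb F\neq 2$; $q\in\mathbb F^*$, $q\neq\pm1$; $\varepsilon=q-q^{-1}$. Either $q$ is a primitive $k$-th root of unity with $k$ odd, and then $h=k$ (odd), or $q$ is a primitive $k$-th root of unity with $k=4\ell$, and then $h=k/2=2\ell$ (even); in both cases $q^2$ is a primitive $h$-th root of unity. Moreover $h\ge 3$. The finite Hecke-Clifford superalgebra $\mathcal H_n(q)$ is the $\mathbb F$-superalgebra generated by even elements $T_1,\dots,T_{n-1}$ and odd elements $C_1,\dots,C_n$ subject to: $T_i^2=\varepsilon T_i+1$; $T_iT_j=T_jT_i$ for $|i-j|>1$; $T_iT_{i+1}T_i=T_{i+1}T_iT_{i+1}$; $C_i^2=1$; $C_iC_j=-C_jC_i$ for $i\ne j$; $T_iC_i=C_{i+1}T_i$; $T_iC_{i+1}=C_iT_i-\varepsilon(C_i-C_{i+1})$; $T_iC_j=C_jT_i$ for $j\neq i,i+1$. It has dimension $2^n n!$. A superalgebra is called semisimple if it is semisimple as an ordinary (ungraded) algebra. *)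

theory Defs
  imports
    "HOL-Computational_Algebra.Polynomial"
    "HOL-Library.Poly_Mapping"
    "HOL-Algebra.QuotRing"
begin

section \<open>Free associative algebras\<close>

text \<open>
  Words are wrapped in a datatype of their own, so that concatenation can serve as the
  (additively written) monoid operation: finitely supported functions on words then carry the
  convolution product of \<^theory>\<open>HOL-Library.Poly_Mapping\<close>.
\<close>

datatype 'a free_monoid = Word (letters: "'a list")

instantiation free_monoid :: (type) monoid_add
begin

definition zero_free_monoid :: "'a free_monoid"
  where "0 = Word []"

definition plus_free_monoid :: "'a free_monoid \<Rightarrow> 'a free_monoid \<Rightarrow> 'a free_monoid"
  where "u + v = Word (letters u @ letters v)"

instance
  by standard (simp_all add: zero_free_monoid_def plus_free_monoid_def)

end

definition free_algebra :: "'g set \<Rightarrow> ('g free_monoid \<Rightarrow>\<^sub>0 'a::field) ring"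
  where "free_algebra X =
    \<lparr>carrier = {p. \<forall>w\<in>Poly_Mapping.keys p. set (letters w) \<subseteq> X},
      mult = (*), one = 1, zero = 0, add = (+)\<rparr>"

definition gen :: "'g \<Rightarrow> ('g free_monoid \<Rightarrow>\<^sub>0 'a::field)"
  where "gen x = Poly_Mapping.single (Word [x]) 1"

definition scalar :: "'a::field \<Rightarrow> ('g free_monoid \<Rightarrow>\<^sub>0 'a)"
  where "scalar c = Poly_Mapping.single 0 c"

lemma ring_free_algebra: "ring (free_algebra X :: ('g free_monoid \<Rightarrow>\<^sub>0 'a::field) ring)"
proof -
  let ?A = "free_algebra X :: ('g free_monoid \<Rightarrow>\<^sub>0 'a::field) ring"
  have add: "p + r \<in> carrier ?A" if "p \<in> carrier ?A" "r \<in> carrier ?A" for p r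
    using that keys_add[of p r] by (fastforce simp: free_algebra_def)
  have neg: "- p \<in> carrier ?A" if "p \<in> carrier ?A" for p
    using that by (auto simp: free_algebra_def in_keys_iff)
  have mult: "p * r \<in> carrier ?A" if "p \<in> carrier ?A" "r \<in> carrier ?A" for p r
    using that keys_mult[of p r] by (fastforce simp: free_algebra_def plus_free_monoid_def)
  have one: "1 \<in> carrier ?A" and zero: "0 \<in> carrier ?A"
    by (auto simp: free_algebra_def zero_free_monoid_def)
  have ops: "x \<oplus>\<^bsub>?A\<^esub> y = x + y" "x \<otimes>\<^bsub>?A\<^esub> y = x * y" "\<one>\<^bsub>?A\<^esub> = 1" "\<zero>\<^bsub>?A\<^esub> = 0" for x y
    by (simp_all add: free_algebra_def)
  show ?thesis
  proof (rule ringI)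
    show "abelian_group ?A"
      by (rule abelian_groupI)
        (auto simp: ops add zero algebra_simps intro: bexI[OF _ neg])
    show "Group.monoid ?A"
      by (rule monoidI) (auto simp: ops mult one algebra_simps)
  qed (auto simp: ops algebra_simps)
qed


section \<open>The finite Hecke-Clifford superalgebra\<close>

datatype hc_generator = T_gen nat | C_gen nat

definition hc_generators :: "nat \<Rightarrow> hc_generator set"
  where "hc_generators n = T_gen ` {1..<n} \<union> C_gen ` {1..n}"

abbreviation hc_T :: "nat \<Rightarrow> (hc_generator free_monoid \<Rightarrow>\<^sub>0 'a::field)"
  where "hc_T i \<equiv> gen (T_gen i)"

abbreviation hc_C :: "nat \<Rightarrow> (hc_generator free_monoid \<Rightarrow>\<^sub>0 'a::field)"
  where "hc_C i \<equiv> gen (C_gen i)"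

text \<open>Each relation \<open>l = r\<close> is recorded as the element \<open>l - r\<close> of the free algebra.\<close>

definition hc_relators :: "nat \<Rightarrow> 'a::field \<Rightarrow> (hc_generator free_monoid \<Rightarrow>\<^sub>0 'a) set"
  where "hc_relators n q = (let \<epsilon> = scalar (q - inverse q) in
      {hc_T i * hc_T i - (\<epsilon> * hc_T i + 1) | i. i \<in> {1..<n}}
    \<union> {hc_T i * hc_T j - hc_T j * hc_T i | i j.
         i \<in> {1..<n} \<and> j \<in> {1..<n} \<and> (i + 1 < j \<or> j + 1 < i)}
    \<union> {hc_T i * hc_T (i + 1) * hc_T i - hc_T (i + 1) * hc_T i * hc_T (i + 1) | i.
         i \<in> {1..<n} \<and> i + 1 \<in> {1..<n}}
    \<union> {hc_C i * hc_C i - 1 | i. i \<in> {1..n}}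
    \<union> {hc_C i * hc_C j - (- (hc_C j * hc_C i)) | i j. i \<in> {1..n} \<and> j \<in> {1..n} \<and> i \<noteq> j}
    \<union> {hc_T i * hc_C i - hc_C (i + 1) * hc_T i | i. i \<in> {1..<n}}
    \<union> {hc_T i * hc_C (i + 1) - (hc_C i * hc_T i - \<epsilon> * (hc_C i - hc_C (i + 1))) | i. i \<in> {1..<n}}
    \<union> {hc_T i * hc_C j - hc_C j * hc_T i | i j.
         i \<in> {1..<n} \<and> j \<in> {1..n} \<and> j \<noteq> i \<and> j \<noteq> i + 1})"

text \<open>
  All relators are homogeneous for the parity in which the \<open>T\<^sub>i\<close> are even and the \<open>C\<^sub>i\<close> are odd, so
  the superalgebra with this presentation has the following algebra as its underlying ungraded
  algebra. The grading itself is not recorded, since semisimplicity refers to the ungraded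
  algebra. The scalars form a subring of the free algebra, so ring ideals are algebra ideals.
\<close>

definition hecke_clifford :: "nat \<Rightarrow> 'a::field \<Rightarrow> (hc_generator free_monoid \<Rightarrow>\<^sub>0 'a) set ring"
  where "hecke_clifford n q =
    free_algebra (hc_generators n) Quot
      genideal (free_algebra (hc_generators n)) (hc_relators n q)"

lemma hc_relators_closed: "hc_relators n q \<subseteq> carrier (free_algebra (hc_generators n))"
proof -
  let ?A = "free_algebra (hc_generators n) :: (hc_generator free_monoid \<Rightarrow>\<^sub>0 'a) ring"
  interpret ring ?A by (rule ring_free_algebra)
  have diff: "x - y \<in> carrier ?A" if "x \<in> carrier ?A" "y \<in> carrier ?A" for x y
    using that keys_diff[of x y] by (fastforce simp: free_algebra_def)
  have neg: "- x \<in> carrier ?A" if "x \<in> carrier ?A" for x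
    using that by (auto simp: free_algebra_def in_keys_iff)
  have add: "x + y \<in> carrier ?A" if "x \<in> carrier ?A" "y \<in> carrier ?A" for x y
    using a_closed[OF that] by (simp add: free_algebra_def)
  have mult: "x * y \<in> carrier ?A" if "x \<in> carrier ?A" "y \<in> carrier ?A" for x y
    using m_closed[OF that] by (simp add: free_algebra_def)
  have one: "1 \<in> carrier ?A"
    using one_closed by (simp add: free_algebra_def)
  have sc: "scalar c \<in> carrier ?A" for c
    by (simp add: free_algebra_def scalar_def zero_free_monoid_def)
  have T: "hc_T i \<in> carrier ?A" if "i \<in> {1..<n}" for i
    using that by (simp add: free_algebra_def gen_def hc_generators_def)
  have C: "hc_C i \<in> carrier ?A" if "i \<in> {1..n}" for i
    using that by (simp add: free_algebra_def gen_def hc_generators_def)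
  show ?thesis
    unfolding hc_relators_def Let_def by (auto intro!: diff neg add mult one sc T C)
qed

lemma ring_hecke_clifford: "ring (hecke_clifford n q)"
  unfolding hecke_clifford_def
  by (intro ideal.quotient_is_ring ring.genideal_ideal ring_free_algebra hc_relators_closed)


section \<open>Semisimplicity and roots of unity\<close>

definition left_ideal :: "'b set \<Rightarrow> ('b, 'm) ring_scheme \<Rightarrow> bool"
  where "left_ideal I R \<longleftrightarrow>
    additive_subgroup I R \<and> (\<forall>a\<in>carrier R. \<forall>x\<in>I. a \<otimes>\<^bsub>R\<^esub> x \<in> I)"

text \<open>
  The left regular module is semisimple: every submodule is a direct summand. For a unital algebra
  the left ideals are automatically subspaces, so this is also semisimplicity as an algebra.
\<close>

definition semisimple_ring :: "('b, 'm) ring_scheme \<Rightarrow> bool"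
  where "semisimple_ring R \<longleftrightarrow> ring R \<and>
    (\<forall>I. left_ideal I R \<longrightarrow>
      (\<exists>J. left_ideal J R \<and> I \<inter> J = {\<zero>\<^bsub>R\<^esub>} \<and> I <+>\<^bsub>R\<^esub> J = carrier R))"

definition primitive_root_of_unity :: "nat \<Rightarrow> 'a::field \<Rightarrow> bool"
  where "primitive_root_of_unity k q \<longleftrightarrow> 0 < k \<and> q ^ k = 1 \<and> (\<forall>j. 0 < j \<and> j < k \<longrightarrow> q ^ j \<noteq> 1)"

end

theory Submission
  imports Defs
begin

text \<open>
  For \<open>h\<close> as in the theorem, both conditions say that \<open>q ^ (4 * j) \<noteq> 1\<close> for \<open>1 \<le> j \<le> n\<close>.

  Under this condition the algebra behaves as for generic \<open>q\<close>. Conjugating \<open>C 1\<close> by the \<open>T i\<close> gives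
  elements \<open>D k\<close> such that the anticommutators \<open>z k\<close> of \<open>C k\<close> and \<open>D k\<close> commute with one another and
  with all \<open>C j\<close> and \<open>D j\<close>, which thus span a Clifford algebra over them. The \<open>z k\<close> act
  diagonalisably, and their joint eigenvalues are the content sequences of shifted standard
  tableaux; intertwiners \<open>Phi k\<close> connect the tableaux of the same shape. Choosing one tableau per
  shape, a left ideal is complemented by complementing its parts in the corresponding weight
  spaces, where only the Clifford algebra acts.

  If \<open>q ^ (4 * m) = 1\<close> with \<open>m \<le> n\<close>, take the module induced to Clifford coefficients from the Hecke
  algebra acting on words in two letters. It has an odd endomorphism \<open>theta\<close> which, on the vector \<open>v\<close>
  of the word with \<open>m\<close> leading letters of one kind, agrees with an element \<open>Theta\<close> of the algebra whose
  square acts on \<open>v\<close> by \<open>1 + q ^ 4 + \<dots> + q ^ (4 * (m - 1)) = 0\<close>. If the annihilator of \<open>theta v\<close>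
  were generated by an idempotent \<open>l\<close>, then \<open>u = l v\<close> would satisfy \<open>T i u = q u\<close> for \<open>i < m\<close>,
  \<open>Theta u = Theta v\<close> and \<open>theta u = 0\<close>, and comparing coefficients shows that this is impossible.
\<close>

section \<open>The Hecke-Clifford relations\<close>

text \<open>Neither direction uses a basis or a dimension. The first works with left multiplication
  in the algebra and uses only the relations: it bounds the spectrum of each \<open>z k\<close> from
  above, and weight spaces or idempotents may turn out to be zero. The obstacle is that the
  eigenvalues of contents \<open>c\<close> and \<open>d\<close> differ for sure only when
  \<open>c + d < n\<close>, since they agree exactly if \<open>q ^ (2 * (c - d)) = 1\<close> or
  \<open>q ^ (2 * (c + d + 1)) = 1\<close>. Contents addable to one shape of fewer than
  \<open>n\<close> boxes meet this bound, but the two neighbours \<open>c - 1\<close> and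
  \<open>c + 1\<close> of a box of content \<open>c\<close> need not. If
  \<open>q ^ (2 * (2 * c + 1)) = 1\<close>, which happens for \<open>q\<close> of odd order, they
  share an eigenvalue, and the square of an intertwiner has a double root. Excluding a Jordan block
  there, and excluding weights that do not come from shifted tableaux, such as
  \<open>c, c + 1, c\<close> where the shape forbids it, takes the braid relation on three
  consecutive boxes. Content 0 needs a separate argument, because there \<open>C k\<close> and
  \<open>D k\<close> generate a degenerate Clifford algebra.\<close>

text \<open>The ring type need not be unital: \<open>e\<close> is the unit of the algebra, an idempotent of the ring.\<close>

locale assoc_algebra = vector_space scale
  for scale :: "'a::field \<Rightarrow> 'r::ring \<Rightarrow> 'r" (infixr "*s" 75) +
  assumes scale_mult: "(a *s x) * y = a *s (x * y)"
    and mult_scale: "x * (a *s y) = a *s (x * y)"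

locale hecke_clifford_gens = assoc_algebra scale
  for scale :: "'a::field \<Rightarrow> 'r::ring \<Rightarrow> 'r" (infixr "*s" 75) +
  fixes n :: nat and q :: 'a and e :: 'r and T C :: "nat \<Rightarrow> 'r"
  assumes q0: "q \<noteq> 0"
    and ee: "e * e = e"
    and eT: "1 \<le> i \<Longrightarrow> i < n \<Longrightarrow> e * T i = T i"
    and Te: "1 \<le> i \<Longrightarrow> i < n \<Longrightarrow> T i * e = T i"
    and eC: "1 \<le> j \<Longrightarrow> j \<le> n \<Longrightarrow> e * C j = C j"
    and Ce: "1 \<le> j \<Longrightarrow> j \<le> n \<Longrightarrow> C j * e = C j"
    and TT: "1 \<le> i \<Longrightarrow> i < n \<Longrightarrow> T i * T i = (q - inverse q) *s T i + e"
    and T_far: "1 \<le> i \<Longrightarrow> i < n \<Longrightarrow> 1 \<le> j \<Longrightarrow> j < n \<Longrightarrow> i + 1 < j \<or> j + 1 < i \<Longrightarrow> T i * T j = T j * T i"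
    and braid: "1 \<le> i \<Longrightarrow> i + 1 < n \<Longrightarrow> T i * T (i + 1) * T i = T (i + 1) * T i * T (i + 1)"
    and CC: "1 \<le> j \<Longrightarrow> j \<le> n \<Longrightarrow> C j * C j = e"
    and C_anti: "1 \<le> i \<Longrightarrow> i \<le> n \<Longrightarrow> 1 \<le> j \<Longrightarrow> j \<le> n \<Longrightarrow> i \<noteq> j \<Longrightarrow> C i * C j = - (C j * C i)"
    and TC: "1 \<le> i \<Longrightarrow> i < n \<Longrightarrow> T i * C i = C (i + 1) * T i"
    and TC': "1 \<le> i \<Longrightarrow> i < n \<Longrightarrow>
        T i * C (i + 1) = C i * T i - (q - inverse q) *s (C i - C (i + 1))"
    and TC_far: "1 \<le> i \<Longrightarrow> i < n \<Longrightarrow> 1 \<le> j \<Longrightarrow> j \<le> n \<Longrightarrow> j \<noteq> i \<Longrightarrow> j \<noteq> Suc i \<Longrightarrow> T i * C j = C j * T i"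
begin

definition eps :: 'a where "eps = q - inverse q"

text \<open>The inverse of \<open>T i\<close>, by the quadratic relation.\<close>

definition Ti :: "nat \<Rightarrow> 'r" where "Ti i = T i - eps *s e"

text \<open>\<open>C k * D k\<close> is the Jucys-Murphy element X(k) given by X(1) = 1 and X(k+1) =
  (T(k) + eps C(k) C(k+1)) X(k) T(k). The odd elements \<open>D k\<close> are easier to handle,
  since they obey nearly the rules of the \<open>C k\<close>: they have square \<open>e\<close>,
  anticommute with one another, and are moved by conjugation with \<open>T k\<close>.\<close>

fun D :: "nat \<Rightarrow> 'r" where
  "D 0 = 0"
| "D (Suc 0) = C 1"
| "D (Suc (Suc k)) = Ti (Suc k) * D (Suc k) * T (Suc k)"

lemmas scale_rules = scale_mult mult_scale scale_right_distrib scale_left_distrib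
  scale_right_diff_distrib scale_left_diff_distrib scale_scale

lemma e_left: "e * a = a \<Longrightarrow> e * (a * y) = a * y"
  by (simp add: mult.assoc[symmetric])

lemma D_rec: "1 \<le> k \<Longrightarrow> D (k + 1) = Ti k * D k * T k"
  by (cases k) auto

lemma T_Ti: "1 \<le> i \<Longrightarrow> i < n \<Longrightarrow> T i * Ti i = e"
  by (simp add: Ti_def right_diff_distrib mult_scale Te TT eps_def)

lemma Ti_T: "1 \<le> i \<Longrightarrow> i < n \<Longrightarrow> Ti i * T i = e"
  by (simp add: Ti_def left_diff_distrib scale_mult eT TT eps_def)

lemma eTi: "1 \<le> i \<Longrightarrow> i < n \<Longrightarrow> e * Ti i = Ti i"
  and Tie: "1 \<le> i \<Longrightarrow> i < n \<Longrightarrow> Ti i * e = Ti i"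
  by (simp_all add: Ti_def algebra_simps scale_rules eT Te ee)

lemma Ti_comm: assumes "T i * x = x * T i" "e * x = x" "x * e = x" shows "Ti i * x = x * Ti i"
  using assms by (simp add: Ti_def algebra_simps scale_rules)

lemma e_D: "1 \<le> k \<Longrightarrow> k \<le> n \<Longrightarrow> e * D k = D k"
proof (induction k rule: D.induct)
  case (3 k)
  have "e * (Ti (Suc k) * D (Suc k) * T (Suc k)) = (e * Ti (Suc k)) * D (Suc k) * T (Suc k)"
    by (simp only: mult.assoc)
  then show ?case using eTi[of "Suc k"] 3 by simp
qed (use eC in auto)

lemma D_e: "1 \<le> k \<Longrightarrow> k \<le> n \<Longrightarrow> D k * e = D k"
proof (induction k rule: D.induct)
  case (3 k)
  have "(Ti (Suc k) * D (Suc k) * T (Suc k)) * e = Ti (Suc k) * D (Suc k) * (T (Suc k) * e)"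
    by (simp only: mult.assoc)
  then show ?case using Te[of "Suc k"] 3 by simp
qed (use Ce in auto)

text \<open>The long relation \<open>TC'\<close> becomes a plain exchange once \<open>T i\<close> is
  replaced by its inverse; this is why \<open>D\<close> is built with \<open>Ti\<close> on the
  left.\<close>

lemma C_Ti: assumes "1 \<le> i" "i < n" shows "C i * Ti i = Ti i * C (i + 1)"
  using TC'[OF assms] assms eC[of i] Ce[of i] eC[of "i+1"] Ce[of "i+1"]
  by (simp add: Ti_def algebra_simps scale_rules eps_def)

lemma T_comm_T:
  assumes "1 \<le> i" "i < n" "1 \<le> k" "k < n" "i \<noteq> k" "i \<noteq> k+1" "k \<noteq> i+1"
  shows "T i * T k = T k * T i"
  using T_far[of i k] assms by linarith

text \<open>The form of the braid relation that carries \<open>T i\<close> through the left half of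
  \<open>D (i + 2)\<close> in \<open>T_D\<close>.\<close>

lemma braid_Ti:
  assumes "1 \<le> i" "i + 1 < n"
  shows "T i * (Ti (i+1) * Ti i) = Ti (i+1) * (Ti i * T (i+1))"
proof -
  have i: "i < n" using assms by simp
  have j: "1 \<le> i+1" by simp
  have "T (i+1) * T i * (T (i+1) * Ti (i+1)) * Ti i = T (i+1) * (T i * (e * Ti i))"
    by (simp only: T_Ti[OF j assms(2)] mult.assoc)
  then have L: "T (i+1) * T i * (T (i+1) * Ti (i+1)) * Ti i = T (i+1)"
    by (simp only: eTi[OF assms(1) i] T_Ti[OF assms(1) i] Te[OF j assms(2)])
  have "T (i+1) * T i * T (i+1) * (Ti (i+1) * Ti i) = T (i+1)" using L by (simp add: mult.assoc)
  then have "T i * T (i+1) * T i * (Ti (i+1) * Ti i) = T (i+1)" using braid[OF assms] by simp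
  then have "Ti i * (T i * T (i+1) * T i * (Ti (i+1) * Ti i)) = Ti i * T (i+1)" by simp
  then have "e * T (i+1) * T i * (Ti (i+1) * Ti i) = Ti i * T (i+1)"
    using Ti_T[OF assms(1) i] by (simp add: mult.assoc[symmetric])
  then have "T (i+1) * (T i * (Ti (i+1) * Ti i)) = Ti i * T (i+1)"
    by (simp only: mult.assoc e_left[OF eT[OF j assms(2)]])
  then have "Ti (i+1) * (T (i+1) * (T i * (Ti (i+1) * Ti i))) = Ti (i+1) * (Ti i * T (i+1))" by simp
  then have "e * (T i * (Ti (i+1) * Ti i)) = Ti (i+1) * (Ti i * T (i+1))"
    using Ti_T[OF j assms(2)] by (simp add: mult.assoc[symmetric])
  then show ?thesis by (simp only: e_left[OF eT[OF assms(1) i]])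
qed

lemma T_D:
  "1 \<le> i \<Longrightarrow> i < n \<Longrightarrow> 1 \<le> k \<Longrightarrow> k \<le> n \<Longrightarrow> k \<noteq> i \<Longrightarrow> k \<noteq> Suc i \<Longrightarrow> T i * D k = D k * T i"
proof (induction k arbitrary: i rule: less_induct)
  case (less k)
  show ?case
  proof (cases "k = 1")
    case True
    then show ?thesis using less TC_far[of i 1] by simp
  next
    case False
    have "k = (k - 1) + 1" "1 \<le> k - 1" using less.prems False by auto
    then obtain l where l: "k = l + 1" "1 \<le> l" by blast
    have ln: "l < n" "i \<noteq> l" "i \<noteq> l + 1" using less.prems l by auto
    show ?thesis
    proof (cases "l = i + 1")
      case False
      have a: "T i * T l = T l * T i" using T_comm_T[of i l] less.prems ln l False by auto
      have b: "T i * D l = D l * T i" using less.IH[of l i] less.prems ln l False by auto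
      have c: "T i * Ti l = Ti l * T i"
        using Ti_comm[of l "T i"] a eT Te less.prems by simp
      show ?thesis unfolding l(1) D_rec[OF l(2)]
        by (simp only: mult.assoc[symmetric] c) (simp only: mult.assoc a b)
    next
      \<comment> \<open>Here \<open>k = i + 2\<close>, and \<open>D k\<close> is \<open>D i\<close>
        conjugated by \<open>T i * T (i + 1)\<close>. Passing the left half turns \<open>T i\<close>
        into \<open>T (i + 1)\<close>, which commutes with \<open>D i\<close>, and the right half
        turns it back.\<close>
      case True
      then have i2: "i + 1 < n" using ln by simp
      have D: "D k = Ti (i+1) * Ti i * D i * T i * T (i+1)"
        unfolding l(1) D_rec[OF l(2)] True
        by (simp add: D_rec[OF less.prems(1), simplified] mult.assoc)
      have b: "T (i+1) * D i = D i * T (i+1)"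
        using less.IH[of i "i+1"] less.prems i2 l True by auto
      have "T i * D k = T i * (Ti (i+1) * Ti i) * D i * T i * T (i+1)"
        unfolding D by (simp add: mult.assoc)
      also have "\<dots> = Ti (i+1) * (Ti i * T (i+1)) * D i * T i * T (i+1)"
        by (simp only: braid_Ti[OF less.prems(1) i2])
      also have "\<dots> = Ti (i+1) * Ti i * (T (i+1) * D i) * T i * T (i+1)" by (simp add: mult.assoc)
      also have "\<dots> = Ti (i+1) * Ti i * D i * (T (i+1) * T i * T (i+1))" by (simp only: b mult.assoc)
      also have "\<dots> = Ti (i+1) * Ti i * D i * (T i * T (i+1) * T i)" by (simp only: braid[OF less.prems(1) i2])
      also have "\<dots> = D k * T i" unfolding D by (simp add: mult.assoc)
      finally show ?thesis .
    qed
  qed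
qed

lemma D_D_eq: assumes "1 \<le> k" "k \<le> n" shows "D k * D k = e"
  using assms
proof (induction k rule: nat_induct_at_least)
  case base then show ?case using CC[of 1] by simp
next
  case (Suc k)
  then have k: "1 \<le> k" "k < n" by auto
  have "D (Suc k) * D (Suc k) = Ti k * D k * (T k * Ti k) * D k * T k"
    using D_rec[OF k(1)] by (simp add: mult.assoc)
  also have "\<dots> = Ti k * ((D k * e) * D k) * T k" by (simp only: T_Ti[OF k] mult.assoc)
  also have "\<dots> = Ti k * (D k * D k) * T k" using D_e[of k] k by simp
  also have "\<dots> = e" using Suc.IH k Tie[OF k] Ti_T[OF k] by simp
  finally show ?case .
qed

text \<open>Induction on \<open>k\<close> by unwinding \<open>D k\<close>. A generator
  \<open>C j\<close> with \<open>j \<noteq> k - 1\<close> commutes with \<open>T (k - 1)\<close>,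
  and \<open>C (k - 1)\<close> becomes \<open>C k\<close> on its way through
  \<open>Ti (k - 1)\<close>.\<close>

lemma C_D: "1 \<le> j \<Longrightarrow> j \<le> n \<Longrightarrow> 1 \<le> k \<Longrightarrow> k \<le> n \<Longrightarrow> j \<noteq> k \<Longrightarrow> C j * D k = - (D k * C j)"
proof (induction k arbitrary: j rule: less_induct)
  case (less k)
  show ?case
  proof (cases "k = 1")
    case True
    then show ?thesis using less C_anti[of j 1] by simp
  next
    case False
    have "k = (k - 1) + 1" "1 \<le> k - 1" using less.prems False by auto
    then obtain l where l: "k = l + 1" "1 \<le> l" by blast
    have ln: "l < n" "j \<noteq> l + 1" using less.prems l by auto
    show ?thesis
    proof (cases "j = l")
      case False
      have a: "T l * C j = C j * T l" using TC_far[of l j] less.prems ln l False by auto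
      have c: "Ti l * C j = C j * Ti l" using Ti_comm[OF a] eC Ce less.prems by simp
      have b: "C j * D l = - (D l * C j)" using less.IH[of l j] less.prems ln l False by auto
      have "C j * D k = C j * Ti l * D l * T l" unfolding l(1) D_rec[OF l(2)] by (simp add: mult.assoc)
      also have "\<dots> = Ti l * (C j * D l) * T l" by (simp add: c[symmetric] mult.assoc)
      also have "\<dots> = - (Ti l * D l * (C j * T l))" unfolding b by (simp add: mult.assoc)
      also have "\<dots> = - (D k * C j)" unfolding l(1) D_rec[OF l(2)] a[symmetric] by (simp add: mult.assoc)
      finally show ?thesis .
    next
      case True
      have b: "C (l+1) * D l = - (D l * C (l+1))" using less.IH[of l "l+1"] less.prems ln l by auto
      have "C j * D k = C l * Ti l * D l * T l" unfolding l(1) D_rec[OF l(2)] True by (simp add: mult.assoc)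
      also have "\<dots> = Ti l * (C (l+1) * D l) * T l" by (simp only: C_Ti[OF l(2) ln(1)] mult.assoc)
      also have "\<dots> = - (Ti l * D l * (C (l+1) * T l))" unfolding b by (simp add: mult.assoc)
      also have "\<dots> = - (Ti l * D l * (T l * C l))" by (simp only: TC[OF l(2) ln(1)])
      also have "\<dots> = - (D k * C j)" unfolding l(1) D_rec[OF l(2)] True by (simp add: mult.assoc)
      finally show ?thesis .
    qed
  qed
qed

text \<open>If \<open>k > j + 1\<close>, unwinding \<open>D k\<close> lowers \<open>k\<close>; if
  \<open>k = j + 1\<close>, unwinding \<open>D j\<close> lowers \<open>j\<close>, since
  \<open>T (j - 1)\<close> commutes with \<open>D k\<close>. What remains is
  \<open>D 1 * D 2\<close>, where \<open>D 1 = C 1\<close>.\<close>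

lemma D_D_less: "1 \<le> j \<Longrightarrow> j < k \<Longrightarrow> k \<le> n \<Longrightarrow> D j * D k = - (D k * D j)"
proof (induction "j + k" arbitrary: j k rule: less_induct)
  case less
  show ?case
  proof (cases "k = j + 1")
    case False
    have "k = (k - 1) + 1" "1 \<le> k - 1" "j < k - 1" "k - 1 < n" using less.prems False by auto
    then obtain l where l: "k = l + 1" "1 \<le> l" "j < l" "l < n" by blast
    have b: "D j * D l = - (D l * D j)" using less.hyps[of j l] less.prems l by auto
    have a: "T l * D j = D j * T l" using T_D[of l j] less.prems l by auto
    have c: "Ti l * D j = D j * Ti l" using Ti_comm[OF a] e_D D_e less.prems by simp
    have "D j * D k = D j * Ti l * D l * T l" unfolding l(1) D_rec[OF l(2)] by (simp add: mult.assoc)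
    also have "\<dots> = Ti l * (D j * D l) * T l" by (simp add: c[symmetric] mult.assoc)
    also have "\<dots> = - (Ti l * D l * (D j * T l))" unfolding b by (simp add: mult.assoc)
    also have "\<dots> = - (D k * D j)" unfolding l(1) D_rec[OF l(2)] a[symmetric] by (simp add: mult.assoc)
    finally show ?thesis .
  next
    case k: True
    show ?thesis
    proof (cases "j = 1")
      case True
      have 1: "(1::nat) \<le> 1" "1 < n" using less.prems k True by auto
      have D2: "D k = Ti 1 * C 1 * T 1" using D_rec[of 1] k True by simp
      have "D j * D k = C 1 * Ti 1 * C 1 * T 1" unfolding D2 True by (simp add: mult.assoc)
      also have "\<dots> = Ti 1 * (C (1+1) * C 1) * T 1" by (simp only: C_Ti[OF 1] mult.assoc)
      also have "\<dots> = - (Ti 1 * C 1 * (C (1+1) * T 1))"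
        using C_anti[of "1+1" 1] 1 by (simp add: mult.assoc)
      also have "\<dots> = - (Ti 1 * C 1 * (T 1 * C 1))" by (simp only: TC[OF 1])
      also have "\<dots> = - (D k * D j)" unfolding D2 True by (simp add: mult.assoc)
      finally show ?thesis .
    next
      case False
      have "j = (j - 1) + 1" "1 \<le> j - 1" using less.prems False by auto
      then obtain l where l: "j = l + 1" "1 \<le> l" by blast
      have ln: "l < n" using less.prems l by auto
      have b: "D l * D k = - (D k * D l)" using less.hyps[of l k] less.prems l k by auto
      have a: "T l * D k = D k * T l" using T_D[of l k] less.prems l k by auto
      have c: "Ti l * D k = D k * Ti l" using Ti_comm[OF a] e_D[of k] D_e[of k] less.prems by simp
      have "D j * D k = Ti l * D l * (T l * D k)" unfolding l(1) D_rec[OF l(2)] by (simp add: mult.assoc)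
      also have "\<dots> = Ti l * (D l * D k) * T l" unfolding a by (simp add: mult.assoc)
      also have "\<dots> = - (Ti l * D k * D l * T l)" unfolding b by (simp add: mult.assoc)
      also have "\<dots> = - (D k * D j)" unfolding l(1) D_rec[OF l(2)] c by (simp add: mult.assoc)
      finally show ?thesis .
    qed
  qed
qed

lemma D_anti: "1 \<le> j \<Longrightarrow> j \<le> n \<Longrightarrow> 1 \<le> k \<Longrightarrow> k \<le> n \<Longrightarrow> j \<noteq> k \<Longrightarrow> D j * D k = - (D k * D j)"
  using D_D_less[of j k] D_D_less[of k j] by (cases "j < k") auto

text \<open>This and \<open>TD\<close> are the mirror images of \<open>TC\<close> and
  \<open>TC'\<close>, with the two letters exchanged.\<close>

lemma TD': assumes "1 \<le> k" "k < n" shows "T k * D (k+1) = D k * T k"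
proof -
  have "T k * D (k+1) = T k * Ti k * D k * T k" using D_rec[OF assms(1)] by (simp add: mult.assoc)
  then show ?thesis using T_Ti[OF assms] e_D[of k] assms by simp
qed

lemma TD: assumes "1 \<le> k" "k < n" shows "T k * D k = D (k+1) * T k + eps *s (D k - D (k+1))"
proof -
  have "D (k+1) * Ti k = Ti k * D k * (T k * Ti k)" using D_rec[OF assms(1)] by (simp add: mult.assoc)
  then have "D (k+1) * Ti k = Ti k * D k" using T_Ti[OF assms] D_e[of k] assms by (simp add: mult.assoc)
  then show ?thesis using e_D[of k] D_e[of "k+1"] assms
    by (simp add: Ti_def algebra_simps scale_rules)
qed

section \<open>The elements \<open>z k\<close>: commutation with the Clifford generators and with
  the \<open>T i\<close>\<close>

definition z :: "nat \<Rightarrow> 'r" where "z k = C k * D k + D k * C k"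

text \<open>The Clifford part of the correction term in \<open>T_z\<close>. It is a product of two
  elements of square \<open>2 *s e\<close>, commutes with \<open>T k\<close> and with every
  \<open>z j\<close>, and satisfies the quadratic equation \<open>g_g\<close>.\<close>

definition g :: "nat \<Rightarrow> 'r" where "g k = (C k - C (Suc k)) * (D k - D (Suc k))"

declare D.simps(3) [simp del]

lemma assoc_rule: "a * b = (c :: 'r) \<Longrightarrow> a * (b * y) = c * y"
  by (simp add: mult.assoc[symmetric])

lemma scale2: "2 *s x = x + x"
  using scale_left_distrib[of 1 1 x] by simp

lemma e_z: "1 \<le> k \<Longrightarrow> k \<le> n \<Longrightarrow> e * z k = z k"
  by (simp add: z_def distrib_left e_left eC e_D)

lemma z_e: "1 \<le> k \<Longrightarrow> k \<le> n \<Longrightarrow> z k * e = z k"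
  by (simp add: z_def distrib_right mult.assoc Ce D_e)

lemma C_z:
  assumes "1 \<le> j" "j \<le> n" "1 \<le> k" "k \<le> n"
  shows "C j * z k = z k * C j"
proof (cases "j = k")
  case True
  then show ?thesis using assms
    by (simp add: z_def distrib_left distrib_right mult.assoc CC assoc_rule[OF CC] e_D D_e)
next
  case False
  have 1: "C j * C k = - (C k * C j)" "C j * D k = - (D k * C j)"
    using C_anti[of j k] C_D[of j k] assms False by auto
  show ?thesis
    by (simp add: z_def distrib_left distrib_right mult.assoc 1 assoc_rule[OF 1(1)] assoc_rule[OF 1(2)])
qed

lemma D_z:
  assumes "1 \<le> j" "j \<le> n" "1 \<le> k" "k \<le> n"
  shows "D j * z k = z k * D j"
proof (cases "j = k")
  case True
  then show ?thesis using assms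
    by (simp add: z_def distrib_left distrib_right mult.assoc D_D_eq assoc_rule[OF D_D_eq] eC Ce)
next
  case False
  have 1: "D j * C k = - (C k * D j)" "D j * D k = - (D k * D j)"
    using C_D[of k j] D_anti[of j k] assms False by auto
  show ?thesis
    by (simp add: z_def distrib_left distrib_right mult.assoc 1 assoc_rule[OF 1(1)] assoc_rule[OF 1(2)])
qed

lemma z_z:
  assumes "1 \<le> j" "j \<le> n" "1 \<le> k" "k \<le> n"
  shows "z j * z k = z k * z j"
proof -
  note 1 = C_z[OF assms] D_z[OF assms]
  have "z j * z k = C j * (D j * z k) + D j * (C j * z k)"
    by (simp only: z_def[of j] distrib_right mult.assoc)
  also have "\<dots> = z k * (C j * D j) + z k * (D j * C j)"
    by (simp only: 1 assoc_rule[OF 1(1)] assoc_rule[OF 1(2)] mult.assoc)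
  also have "\<dots> = z k * z j" by (simp only: z_def[of j] distrib_left)
  finally show ?thesis .
qed

lemma T_z_far:
  assumes "1 \<le> i" "i < n" "1 \<le> k" "k \<le> n" "k \<noteq> i" "k \<noteq> Suc i"
  shows "T i * z k = z k * T i"
proof -
  note 1 = TC_far[OF assms] T_D[OF assms]
  have "T i * z k = (T i * C k) * D k + (T i * D k) * C k"
    by (simp only: z_def distrib_left mult.assoc)
  also have "\<dots> = C k * (T i * D k) + D k * (T i * C k)" by (simp only: 1 mult.assoc)
  also have "\<dots> = z k * T i" by (simp only: 1 z_def distrib_right mult.assoc)
  finally show ?thesis .
qed

context
  fixes k :: nat
  assumes k: "1 \<le> k" "k < n"
begin

lemma TD2: "T k * D (Suc k) = D k * T k" "T k * D k = D (Suc k) * T k + eps *s (D k - D (Suc k))"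
  using TD'[OF k] TD[OF k] by simp_all

lemma TC2: "T k * C k = C (Suc k) * T k" "T k * C (Suc k) = C k * T k - eps *s (C k - C (Suc k))"
  using TC[OF k] TC'[OF k] by (simp_all add: eps_def)

lemma anti_k: "C (Suc k) * C k = - (C k * C (Suc k))" "D (Suc k) * D k = - (D k * D (Suc k))"
    "D k * C (Suc k) = - (C (Suc k) * D k)" "D (Suc k) * C k = - (C k * D (Suc k))"
  using C_anti[of k "Suc k"] D_anti[of k "Suc k"] C_D[of "Suc k" k] C_D[of k "Suc k"] k by auto

lemma CC_k: "C k * C k = e" "C (Suc k) * C (Suc k) = e" "D k * D k = e" "D (Suc k) * D (Suc k) = e"
  using CC[of k] CC[of "Suc k"] D_D_eq[of k] D_D_eq[of "Suc k"] k by auto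

lemma c_c: "(C k - C (Suc k)) * (C k - C (Suc k)) = 2 *s e"
  using anti_k CC_k by (simp add: algebra_simps scale2)

lemma d_d: "(D k - D (Suc k)) * (D k - D (Suc k)) = 2 *s e"
  using anti_k CC_k by (simp add: algebra_simps scale2)

lemma d_c: "(D k - D (Suc k)) * (C k - C (Suc k)) = z k + z (Suc k) - g k"
  using anti_k by (simp add: algebra_simps z_def g_def)

lemma T_c: "T k * (C k - C (Suc k)) = - ((C k - C (Suc k)) * T k) + eps *s (C k - C (Suc k))"
  using TC2 by (simp add: algebra_simps)

lemma T_d: "T k * (D k - D (Suc k)) = - ((D k - D (Suc k)) * T k) + eps *s (D k - D (Suc k))"
  using TD2 by (simp add: algebra_simps)

text \<open>\<open>T k\<close> anticommutes with either factor of \<open>g k\<close> up to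
  \<open>eps\<close> times that factor; in the product the signs and the two \<open>eps\<close>
  terms cancel.\<close>

lemma T_g: "T k * g k = g k * T k"
proof -
  have "T k * g k = (T k * (C k - C (Suc k))) * (D k - D (Suc k))" by (simp only: g_def mult.assoc)
  also have "\<dots> = - ((C k - C (Suc k)) * (T k * (D k - D (Suc k)))) + eps *s g k"
    by (simp only: T_c distrib_right mult_minus_left scale_mult mult.assoc g_def)
  also have "\<dots> = g k * T k"
    by (simp only: T_d distrib_left mult_minus_right mult_scale mult.assoc[symmetric] g_def) simp
  finally show ?thesis .
qed

lemma z_minus_g: "z k - g k = D k * C k + C k * D (Suc k) + C (Suc k) * D k - C (Suc k) * D (Suc k)"
  by (simp add: z_def g_def algebra_simps)

lemma T_z: "T k * z k = z (Suc k) * T k + eps *s (z k - g k)"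
proof -
  have "T k * z k = (T k * C k) * D k + (T k * D k) * C k"
    by (simp only: z_def distrib_left mult.assoc)
  also have "\<dots> = C (Suc k) * (T k * D k) + D (Suc k) * (T k * C k) + eps *s ((D k - D (Suc k)) * C k)"
    by (simp only: TC2 TD2 distrib_right scale_mult mult.assoc add.assoc)
  also have "\<dots> = z (Suc k) * T k + eps *s (C (Suc k) * (D k - D (Suc k)) + (D k - D (Suc k)) * C k)"
    by (simp only: TC2 TD2) (simp add: z_def algebra_simps mult_scale scale_right_distrib scale_right_diff_distrib)
  also have "C (Suc k) * (D k - D (Suc k)) + (D k - D (Suc k)) * C k = z k - g k"
    using anti_k by (simp add: z_minus_g algebra_simps)
  finally show ?thesis .
qed

lemma z_g: assumes "1 \<le> j" "j \<le> n" shows "z j * g k = g k * z j"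
proof -
  have 1: "C k * z j = z j * C k" "C (Suc k) * z j = z j * C (Suc k)" "D k * z j = z j * D k"
     "D (Suc k) * z j = z j * D (Suc k)"
    using C_z[of k j] C_z[of "Suc k" j] D_z[of k j] D_z[of "Suc k" j] k assms by auto
  show ?thesis
    by (simp only: g_def 1[symmetric] assoc_rule[OF 1(1)[symmetric]] assoc_rule[OF 1(2)[symmetric]]  right_diff_distrib left_diff_distrib mult.assoc)
qed

lemma e_g: "e * g k = g k"
  using eC[of k] eC[of "Suc k"] k by (simp add: g_def mult.assoc[symmetric] right_diff_distrib)

lemma g_e: "g k * e = g k"
  using D_e[of k] D_e[of "Suc k"] k by (simp add: g_def mult.assoc left_diff_distrib)

lemma z_c: assumes "1 \<le> j" "j \<le> n" shows "(C k - C (Suc k)) * z j = z j * (C k - C (Suc k))"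
  using C_z[of k j] C_z[of "Suc k" j] k assms by (simp add: algebra_simps)

text \<open>With \<open>g k = c * d\<close> the square is \<open>c * (d * c) * d\<close>, and
  \<open>d * c\<close> is known from \<open>d_c\<close>; the squares of \<open>c\<close> and
  \<open>d\<close> contribute the constant 4.\<close>

lemma g_g: "g k * g k = (z k + z (Suc k)) * g k - 4 *s e"
proof -
  define c d where "c = C k - C (Suc k)" and "d = D k - D (Suc k)"
  have gk: "g k = c * d" by (simp add: g_def c_def d_def)
  have "g k * g k = c * (d * c) * d" by (simp add: gk mult.assoc)
  also have "d * c = z k + z (Suc k) - g k" using d_c by (simp add: c_def d_def)
  also have "c * (z k + z (Suc k) - g k) * d = (z k + z (Suc k)) * (c * d) - (c * c) * (d * d)"
  proof -
    have cz: "c * z k = z k * c" "c * z (Suc k) = z (Suc k) * c"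
      using z_c[of k] z_c[of "Suc k"] k by (simp_all add: c_def)
    show ?thesis
      by (simp add: gk algebra_simps assoc_rule[OF cz(1)] assoc_rule[OF cz(2)])
  qed
  also have "(c * c) * (d * d) = 4 *s e"
    using c_c d_d by (simp add: c_def[symmetric] d_def[symmetric] scale_mult mult_scale ee)
  finally show ?thesis by (simp add: gk)
qed

text \<open>Obtained from \<open>T_z\<close> by multiplying with \<open>T k\<close> on the left,
  using the quadratic relation, and cancelling a factor \<open>T k\<close> on the right with
  \<open>Ti k\<close>.\<close>

lemma T_z': "T k * z (Suc k) = z k * T k - eps *s (z k - g k)"
proof -
  have TT: "T k * T k = eps *s T k + e" using TT[OF k] by (simp add: eps_def)
  have "T k * (T k * z k) = T k * (z (Suc k) * T k) + eps *s (T k * z k - T k * g k)"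
    by (simp only: T_z distrib_left mult_scale right_diff_distrib)
  moreover have "T k * (T k * z k) = eps *s (T k * z k) + z k"
    using assoc_rule[OF TT, of "z k"] e_z[of k] k by (simp add: distrib_right scale_mult)
  ultimately have "(T k * z (Suc k)) * T k = z k + eps *s (g k * T k)"
    by (simp add: T_g mult.assoc scale_right_diff_distrib algebra_simps)
  then have "(T k * z (Suc k)) * (T k * Ti k) = z k * Ti k + eps *s (g k * (T k * Ti k))"
    by (simp add: mult.assoc[symmetric] distrib_right scale_mult)
  then have "T k * (z (Suc k) * e) = z k * Ti k + eps *s (g k * e)" using T_Ti[OF k] by (simp add: mult.assoc)
  then show ?thesis using z_e[of k] z_e[of "Suc k"] g_e k
    by (simp add: Ti_def right_diff_distrib mult_scale scale_right_diff_distrib)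
qed

end

text \<open>On the joint eigenspaces of the \<open>z j\<close>, this swaps the eigenvalues of \<open>z k\<close> and \<open>z (Suc k)\<close>.\<close>
definition Phi :: "nat \<Rightarrow> 'r"
  where "Phi k = T k * (z k - z (Suc k)) - eps *s (z k - g k)"

context
  fixes k :: nat
  assumes k: "1 \<le> k" "k < n"
begin

lemma z_Phi: "z k * Phi k = Phi k * z (Suc k)" "z (Suc k) * Phi k = Phi k * z k"
proof -
  have zz: "z (Suc k) * z k = z k * z (Suc k)" using z_z[of k "Suc k"] k by simp
  have a: "z k * T k = T k * z (Suc k) + eps *s (z k - g k)"
    and b: "z (Suc k) * T k = T k * z k - eps *s (z k - g k)"
    using T_z[OF k] T_z'[OF k] by auto
  have gz: "z k * g k = g k * z k" "z (Suc k) * g k = g k * z (Suc k)"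
    using z_g[OF k, of k] z_g[OF k, of "Suc k"] k by auto
  note r = mult_scale scale_mult scale_right_diff_distrib scale_right_distrib
  have "z k * Phi k = (z k * T k) * (z k - z (Suc k)) - eps *s (z k * (z k - g k))"
    by (simp only: Phi_def right_diff_distrib mult_scale mult.assoc)
  also have "\<dots> = Phi k * z (Suc k)"
    by (simp only: a) (simp add: Phi_def algebra_simps r gz zz assoc_rule[OF zz])
  finally show "z k * Phi k = Phi k * z (Suc k)" .
  have "z (Suc k) * Phi k = (z (Suc k) * T k) * (z k - z (Suc k)) - eps *s (z (Suc k) * (z k - g k))"
    by (simp only: Phi_def right_diff_distrib mult_scale mult.assoc)
  also have "\<dots> = Phi k * z k"
    by (simp only: b) (simp add: Phi_def algebra_simps r gz zz assoc_rule[OF zz])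
  finally show "z (Suc k) * Phi k = Phi k * z k" .
qed

lemma z_Phi_far:
  assumes "1 \<le> j" "j \<le> n" "j \<noteq> k" "j \<noteq> Suc k"
  shows "z j * Phi k = Phi k * z j"
proof -
  have 1: "z j * T k = T k * z j" using T_z_far[of k j] k assms by simp
  have 2: "z j * z k = z k * z j" "z j * z (Suc k) = z (Suc k) * z j"
    using z_z[of j k] z_z[of j "Suc k"] k assms by auto
  have 3: "z j * g k = g k * z j" using z_g[OF k] assms by auto
  have "z j * Phi k = (z j * T k) * (z k - z (Suc k)) - eps *s (z j * (z k - g k))"
    by (simp only: Phi_def right_diff_distrib mult_scale mult.assoc)
  also have "\<dots> = T k * (z j * (z k - z (Suc k))) - eps *s (z j * (z k - g k))"
    by (simp only: 1 mult.assoc)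
  also have "\<dots> = Phi k * z j"
    by (simp only: right_diff_distrib 2 3) (simp add: Phi_def algebra_simps mult_scale scale_mult scale_right_diff_distrib)
  finally show ?thesis .
qed

text \<open>Together with \<open>D_Phi\<close>, this carries the identity of \<open>D\<close> and
  \<open>C\<close> from letter \<open>k\<close> to letter \<open>Suc k\<close> in
  \<open>unip_step\<close>.\<close>

lemma C_Phi: "C k * Phi k = Phi k * C (Suc k)"
proof -
  define c d where "c = C k - C (Suc k)" and "d = D k - D (Suc k)"
  have gk: "g k = c * d" by (simp add: g_def c_def d_def)
  have a: "C k * T k = T k * C (Suc k) + eps *s c"
    using TC2[OF k] by (simp add: c_def)
  have b: "C k * c = - (c * C (Suc k))"
    using anti_k[OF k] CC_k[OF k] by (simp add: c_def algebra_simps)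
  have dC: "C (Suc k) * d = - (d * C (Suc k)) - z (Suc k)"
    using anti_k[OF k] by (simp add: d_def z_def algebra_simps)
  have cz: "z j * c = c * z j" "C (Suc k) * z j = z j * C (Suc k)" "C k * z j = z j * C k"
    if "j = k \<or> j = Suc k" for j
    using z_c[OF k, of j] C_z[of "Suc k" j] C_z[of k j] that k by (auto simp: c_def)
  have Cg: "C k * g k = g k * C (Suc k) + z (Suc k) * c"
  proof -
    have "C k * g k = - (c * (C (Suc k) * d))"
      by (simp add: gk assoc_rule[OF b] mult.assoc)
    also have "\<dots> = c * d * C (Suc k) + c * z (Suc k)" by (simp add: dC algebra_simps)
    finally show ?thesis by (simp add: gk cz)
  qed
  have "C k * Phi k = (C k * T k) * (z k - z (Suc k)) - eps *s (z k * C k - C k * g k)"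
    by (simp only: Phi_def right_diff_distrib mult_scale mult.assoc cz simp_thms)
  also have "\<dots> = T k * (C (Suc k) * (z k - z (Suc k))) + eps *s (c * (z k - z (Suc k)))
      - eps *s (z k * C k - g k * C (Suc k) - z (Suc k) * c)"
    by (simp only: a Cg) (simp add: algebra_simps scale_mult mult_scale)
  also have "c * (z k - z (Suc k)) = z k * C k - z k * C (Suc k) - z (Suc k) * c"
    using cz by (simp add: right_diff_distrib flip: cz(1)) (simp add: c_def algebra_simps)
  also have "C (Suc k) * (z k - z (Suc k)) = (z k - z (Suc k)) * C (Suc k)"
    using cz by (simp add: algebra_simps)
  also have "T k * ((z k - z (Suc k)) * C (Suc k)) + eps *s (z k * C k - z k * C (Suc k) - z (Suc k) * c)
      - eps *s (z k * C k - g k * C (Suc k) - z (Suc k) * c) = Phi k * C (Suc k)"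
    by (simp add: Phi_def algebra_simps scale_mult mult_scale scale_right_diff_distrib scale_right_distrib)
  finally show ?thesis .
qed

lemma D_Phi: "D k * Phi k = Phi k * D (Suc k)"
proof -
  define c d where "c = C k - C (Suc k)" and "d = D k - D (Suc k)"
  have gk: "g k = c * d" by (simp add: g_def c_def d_def)
  have a: "D k * T k = T k * D (Suc k)"
    using TD2[OF k] by simp
  have b: "D k * d = - (d * D (Suc k))"
    using anti_k[OF k] CC_k[OF k] by (simp add: d_def algebra_simps)
  have dC: "D k * c = - (c * D k) + z k"
    using anti_k[OF k] by (simp add: c_def z_def algebra_simps)
  have dz: "z j * d = d * z j" "D (Suc k) * z j = z j * D (Suc k)" "D k * z j = z j * D k"
    if "j = k \<or> j = Suc k" for j
    using D_z[of "Suc k" j] D_z[of k j] that k by (auto simp: d_def algebra_simps)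
  have Dg: "D k * g k = g k * D (Suc k) + z k * d"
  proof -
    have "D k * g k = - (c * (D k * d)) + z k * d"
      by (simp add: gk assoc_rule[OF dC] algebra_simps)
    then show ?thesis by (simp add: b gk mult.assoc)
  qed
  have "D k * Phi k = (D k * T k) * (z k - z (Suc k)) - eps *s (z k * D k - D k * g k)"
    by (simp only: Phi_def right_diff_distrib mult_scale mult.assoc dz simp_thms)
  also have "\<dots> = T k * (D (Suc k) * (z k - z (Suc k)))
      - eps *s (z k * D k - g k * D (Suc k) - z k * d)"
    by (simp only: a Dg) (simp add: algebra_simps scale_mult mult_scale)
  also have "D (Suc k) * (z k - z (Suc k)) = (z k - z (Suc k)) * D (Suc k)"
    using dz by (simp add: algebra_simps)
  also have "T k * ((z k - z (Suc k)) * D (Suc k))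
      - eps *s (z k * D k - g k * D (Suc k) - z k * d) = Phi k * D (Suc k)"
    by (simp add: Phi_def d_def algebra_simps scale_mult mult_scale scale_right_diff_distrib scale_right_distrib)
  finally show ?thesis .
qed

lemma CD_g_far:
  assumes "1 \<le> j" "j \<le> n" "j \<noteq> k" "j \<noteq> Suc k"
  shows "C j * g k = g k * C j" "D j * g k = g k * D j"
proof -
  have 1: "C j * C k = - (C k * C j)" "C j * C (Suc k) = - (C (Suc k) * C j)"
      "C j * D k = - (D k * C j)" "C j * D (Suc k) = - (D (Suc k) * C j)"
    using C_anti[of j k] C_anti[of j "Suc k"] C_D[of j k] C_D[of j "Suc k"] k assms by auto
  show "C j * g k = g k * C j"
    by (simp add: g_def algebra_simps 1 assoc_rule[OF 1(1)] assoc_rule[OF 1(2)])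
  have 1: "D j * C k = - (C k * D j)" "D j * C (Suc k) = - (C (Suc k) * D j)"
      "D j * D k = - (D k * D j)" "D j * D (Suc k) = - (D (Suc k) * D j)"
    using C_D[of k j] C_D[of "Suc k" j] D_anti[of j k] D_anti[of j "Suc k"] k assms by auto
  show "D j * g k = g k * D j"
    by (simp add: g_def algebra_simps 1 assoc_rule[OF 1(1)] assoc_rule[OF 1(2)])
qed

lemma CD_Phi_far:
  assumes "1 \<le> j" "j \<le> n" "j \<noteq> k" "j \<noteq> Suc k"
  shows "C j * Phi k = Phi k * C j" "D j * Phi k = Phi k * D j"
proof -
  have 1: "C j * T k = T k * C j" "C j * z k = z k * C j" "C j * z (Suc k) = z (Suc k) * C j"
     "C j * g k = g k * C j"
    using TC_far[of k j] C_z[of j k] C_z[of j "Suc k"] CD_g_far k assms by auto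
  show "C j * Phi k = Phi k * C j"
    by (simp add: Phi_def algebra_simps 1 assoc_rule[OF 1(1)] scale_mult mult_scale)
  have 1: "D j * T k = T k * D j" "D j * z k = z k * D j" "D j * z (Suc k) = z (Suc k) * D j"
     "D j * g k = g k * D j"
    using T_D[of k j] D_z[of j k] D_z[of j "Suc k"] CD_g_far k assms by auto
  show "D j * Phi k = Phi k * D j"
    by (simp add: Phi_def algebra_simps 1 assoc_rule[OF 1(1)] scale_mult mult_scale)
qed

text \<open>The square is minus the polynomial \<open>neighbours\<close>, defined below, in
  \<open>z k\<close> and \<open>z (Suc k)\<close>. The terms with \<open>T k\<close> cancel, and
  \<open>g k\<close> enters only through \<open>(u - G) * (v - G)\<close>, from which
  \<open>g_g\<close> removes it.\<close>

lemma Phi_Phi: "Phi k * Phi k = (eps * eps) *s (z k * z (Suc k) - 4 *s e)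
    - (z k - z (Suc k)) * (z k - z (Suc k))"
proof -
  define u v G where "u = z k" and "v = z (Suc k)" and "G = g k"
  have vu: "v * u = u * v" using z_z[of k "Suc k"] k by (simp add: u_def v_def)
  have gz: "G * u = u * G" "G * v = v * G"
    using z_g[OF k, of k] z_g[OF k, of "Suc k"] k by (auto simp: u_def v_def G_def)
  have TG: "T k * G = G * T k" using T_g[OF k] by (simp add: G_def)
  have GG: "G * G = (u + v) * G - 4 *s e" using g_g[OF k] by (simp add: u_def v_def G_def)
  have P: "Phi k = T k * (u - v) - eps *s (u - G)" by (simp add: Phi_def u_def v_def G_def)
  have zP: "u * Phi k = Phi k * v" "v * Phi k = Phi k * u"
    using z_Phi by (simp_all add: u_def v_def)
  have TT: "T k * T k = eps *s T k + e" using TT[OF k] by (simp add: eps_def)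
  have eu: "e * u = u" "e * v = v" using e_z[of k] e_z[of "Suc k"] k by (auto simp: u_def v_def)
  have GP: "G * Phi k = Phi k * G"
    by (simp add: P algebra_simps gz[symmetric] TG assoc_rule[OF TG] scale_mult mult_scale)
  have "Phi k * Phi k = T k * ((u - v) * Phi k) - eps *s ((u - G) * Phi k)"
    by (subst (1) P) (simp add: left_diff_distrib scale_mult mult.assoc)
  also have "\<dots> = T k * (Phi k * (v - u)) - eps *s (Phi k * (v - G))"
    by (simp add: left_diff_distrib right_diff_distrib zP GP)
  also have "T k * (Phi k * (v - u)) = (eps *s T k + e) * ((u - v) * (v - u)) - eps *s (T k * ((u - G) * (v - u)))"
    by (simp only: P left_diff_distrib right_diff_distrib scale_mult mult_scale mult.assoc[symmetric] TT)
      (simp add: scale_right_diff_distrib)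
  also have "eps *s (Phi k * (v - G)) = eps *s (T k * ((u - v) * (v - G))) - (eps * eps) *s ((u - G) * (v - G))"
    by (simp only: P left_diff_distrib scale_mult mult.assoc scale_right_diff_distrib scale_scale)
  also have "(u - G) * (v - G) = u * v - 4 *s e"
    by (simp add: algebra_simps GG gz)
  finally show ?thesis
    by (simp add: u_def[symmetric] v_def[symmetric] algebra_simps gz vu eu e_left[OF eu(1)] e_left[OF eu(2)] assoc_rule[OF vu]
       scale_mult scale_right_diff_distrib scale_right_distrib)
qed

end
end

section \<open>Shifted standard tableaux\<close>

text \<open>
  A strict partition is encoded as the set of its parts. A box of content \<open>c\<close> is added by lengthening
  a row from \<open>c\<close> to \<open>c + 1\<close>, where the row of length 0 is always available. Standard tableaux are the
  lists of the contents of their boxes, the last box coming first.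
\<close>

definition addable :: "nat set \<Rightarrow> nat set"
  where "addable L = {c. (c = 0 \<or> c \<in> L) \<and> Suc c \<notin> L}"

definition add_box :: "nat \<Rightarrow> nat set \<Rightarrow> nat set"
  where "add_box c L = insert (Suc c) (L - {c})"

fun shape :: "nat list \<Rightarrow> nat set" where
  "shape [] = {}"
| "shape (c # cs) = add_box c (shape cs)"

fun std :: "nat list \<Rightarrow> bool" where
  "std [] \<longleftrightarrow> True"
| "std (c # cs) \<longleftrightarrow> std cs \<and> c \<in> addable (shape cs)"

lemma finite_shape: "finite (shape cs)"
  by (induction cs) (auto simp: add_box_def)

lemma zero_notin_shape: "0 \<notin> shape cs"
  by (induction cs) (auto simp: add_box_def)

lemma sum_shape: "std cs \<Longrightarrow> \<Sum>(shape cs) = length cs"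
proof (induction cs)
  case (Cons c cs)
  have *: "Suc c \<notin> shape cs - {c}" using Cons by (auto simp: addable_def)
  have "\<Sum>(shape (c # cs)) = Suc c + \<Sum>(shape cs - {c})"
    using * finite_shape[of cs] by (simp add: add_box_def)
  also have "\<dots> = Suc (\<Sum>(shape cs))"
  proof (cases "c \<in> shape cs")
    case True
    then show ?thesis using sum.remove[OF finite_shape True, of "\<lambda>x. x"] by simp
  next
    case False
    then show ?thesis using Cons by (auto simp: addable_def)
  qed
  finally show ?case using Cons by simp
qed simp

lemma finite_addable: "finite L \<Longrightarrow> finite (addable L)"
  by (rule finite_subset[of _ "insert 0 L"]) (auto simp: addable_def)

lemma addable_le_sum: "finite L \<Longrightarrow> c \<in> addable L \<Longrightarrow> c \<le> \<Sum>L"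
  by (cases "c = 0") (auto simp: addable_def intro!: member_le_sum[of _ _ "\<lambda>x. x", simplified])

lemma sum_two_le:
  assumes "finite (L :: nat set)" "x = 0 \<or> x \<in> L" "y = 0 \<or> y \<in> L" "x \<noteq> y"
  shows "x + y \<le> \<Sum>L"
proof -
  have "\<Sum>({x, y} - {0}) \<le> \<Sum>L" by (rule sum_mono2) (use assms in auto)
  moreover have "\<Sum>({x, y} - {0}) = x + y"
    using assms(4) by (cases "x = 0"; cases "y = 0") (auto simp: insert_Diff_if)
  ultimately show ?thesis by simp
qed

lemma addable_two: "finite L \<Longrightarrow> c \<in> addable L \<Longrightarrow> d \<in> addable L \<Longrightarrow> c \<noteq> d \<Longrightarrow> c + d \<le> \<Sum>L"
  by (rule sum_two_le) (auto simp: addable_def)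

lemma addable_not_Suc: "c \<in> addable L \<Longrightarrow> d \<in> addable L \<Longrightarrow> d \<noteq> Suc c"
  by (auto simp: addable_def)

lemma addable_add_box: "d \<in> addable L \<Longrightarrow> d \<noteq> c \<Longrightarrow> d \<in> addable (add_box c L)"
  by (auto simp: addable_def add_box_def)

lemma addable_add_boxD:
  "d \<in> addable (add_box c L) \<Longrightarrow> d \<noteq> Suc c \<Longrightarrow> Suc d \<noteq> c \<Longrightarrow> d \<in> addable L \<and> d \<noteq> c"
  by (auto simp: addable_def add_box_def)

lemma not_addable_same: "c \<notin> addable (add_box c L)"
  by (auto simp: addable_def add_box_def)

lemma addable_up: "Suc (Suc c) \<notin> L \<Longrightarrow> Suc c \<in> addable (add_box c L)"
  by (auto simp: addable_def add_box_def)

lemma addable_down: "Suc b \<in> addable L \<Longrightarrow> b = 0 \<or> b \<in> L \<Longrightarrow> b \<in> addable (add_box (Suc b) L)"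
  by (auto simp: addable_def add_box_def)

lemma add_box_commute:
  "c \<in> addable L \<Longrightarrow> d \<in> addable L \<Longrightarrow> add_box d (add_box c L) = add_box c (add_box d L)"
  by (auto simp: addable_def add_box_def)

text \<open>As 0 is never a part, \<open>c\<close> was a part before exactly if
  \<open>c \<noteq> 0\<close>, so adding the box can be undone.\<close>

lemma add_box_inject:
  assumes "c \<in> addable L" "c \<in> addable L'" "add_box c L = add_box c L'" "0 \<notin> L" "0 \<notin> L'"
  shows "L = L'"
proof -
  have 1: "c \<in> L \<longleftrightarrow> c \<noteq> 0" "c \<in> L' \<longleftrightarrow> c \<noteq> 0"
    using assms(1,2,4,5) unfolding addable_def by (metis (mono_tags, lifting) mem_Collect_eq)+
  have "L = (add_box c L - {Suc c}) \<union> ({c} - {0})" using assms(1,4) 1 by (auto simp: addable_def add_box_def)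
  moreover have "L' = (add_box c L' - {Suc c}) \<union> ({c} - {0})" using assms(2,5) 1 by (auto simp: addable_def add_box_def)
  ultimately show ?thesis using assms(3) by simp
qed

lemma remove_box:
  assumes "finite L" "0 \<notin> L" "Suc c \<in> L" "c \<notin> L"
  obtains M where "finite M" "0 \<notin> M" "c \<in> addable M" "add_box c M = L"
proof
  let ?M = "(L - {Suc c}) \<union> ({c} - {0})"
  show "finite ?M" "0 \<notin> ?M" using assms by auto
  show "c \<in> addable ?M" "add_box c ?M = L" using assms by (auto simp: addable_def add_box_def)
qed

lemma ex_std: "finite L \<Longrightarrow> 0 \<notin> L \<Longrightarrow> \<exists>cs. std cs \<and> shape cs = L"
proof (induction "\<Sum>L" arbitrary: L rule: less_induct)
  case less
  show ?case
  proof (cases "L = {}")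
    case True then show ?thesis by (intro exI[of _ "[]"]) simp
  next
    case False
    \<comment> \<open>The shortest row can always be shortened: no row of the resulting length
      exists.\<close>
    define m where "m = Min L"
    have "m \<in> L" using less.prems False by (simp add: m_def)
    with less.prems have m: "m \<in> L" "m \<noteq> 0" by metis+
    then obtain c where c: "m = Suc c" by (cases m) auto
    have "c \<notin> L" using less.prems(1) False Min_le[of L c] by (auto simp: m_def[symmetric] c)
    then obtain M where M: "finite M" "0 \<notin> M" "c \<in> addable M" "add_box c M = L"
      using remove_box[OF less.prems, of c] m c by auto
    have "\<Sum>M < \<Sum>L"
    proof -
      have *: "Suc c \<notin> M - {c}" using M by (auto simp: addable_def)
      have "\<Sum>L = Suc c + \<Sum>(M - {c})" using * M by (simp add: add_box_def flip: M(4))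
      moreover have "\<Sum>M \<le> c + \<Sum>(M - {c})"
        using M sum.remove[of M c "\<lambda>x. x"] by (cases "c \<in> M") auto
      ultimately show ?thesis by simp
    qed
    then obtain cs where "std cs" "shape cs = M" using less.hyps M by blast
    then show ?thesis using M by (intro exI[of _ "c # cs"]) simp
  qed
qed

text \<open>Two different last boxes end different rows, so they can be removed in either order.
  This is the diamond on which \<open>transport\<close> rests.\<close>

lemma two_removable:
  assumes "std (c # cs)" "std (d # ds)" "shape (c # cs) = shape (d # ds)" "c \<noteq> d"
  obtains ts where "std ts" "c \<in> addable (shape ts)" "d \<in> addable (shape ts)"
    "shape cs = add_box d (shape ts)" "shape ds = add_box c (shape ts)"
proof -
  define L where "L = shape (c # cs)"
  have L: "L = add_box c (shape cs)" "L = add_box d (shape ds)" using assms by (auto simp: L_def)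
  have a: "c \<in> addable (shape cs)" "d \<in> addable (shape ds)" using assms by auto
  have 1: "Suc c \<in> L" "c \<notin> L" unfolding L(1) by (auto simp: add_box_def)
  have 2: "Suc d \<in> L" "d \<notin> L" unfolding L(2) by (auto simp: add_box_def)
  have nc: "Suc c \<noteq> d" "Suc d \<noteq> c" using 1 2 by auto
  have "Suc d \<in> shape cs" using 2(1) assms(4) unfolding L(1) by (auto simp: add_box_def)
  moreover have "d \<notin> shape cs"
  proof
    assume "d \<in> shape cs"
    then have "d \<in> L" unfolding L(1) using assms(4) by (auto simp: add_box_def)
    then show False using 2 by simp
  qed
  ultimately obtain M where M: "finite M" "0 \<notin> M" "d \<in> addable M" "add_box d M = shape cs"
    by (rule remove_box[OF finite_shape zero_notin_shape])
  obtain ts where ts: "std ts" "shape ts = M" using ex_std M by metis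
  have cM: "c \<in> addable M" using a(1) M nc addable_add_boxD by metis
  have "add_box d (shape ds) = add_box d (add_box c M)"
    using L M(4) add_box_commute[OF cM M(3)] by simp
  then have "shape ds = add_box c M"
    using add_box_inject[OF a(2), of "add_box c M"] addable_add_box[OF M(3)] assms(4) zero_notin_shape[of ds] M(2)
    by (auto simp: add_box_def)
  then show thesis using that ts M cM by auto
qed

text \<open>Serves to bring a chosen removable box directly before the box under study, so that
  three consecutive boxes form a pattern that the braid relation controls.\<close>

lemma rearrange_last:
  assumes "Suc b \<in> shape cs" "b \<notin> shape cs" "std cs"
  obtains ts where "std (b # ts)" "shape (b # ts) = shape cs"
proof -
  obtain M where "finite M" "0 \<notin> M" "b \<in> addable M" "add_box b M = shape cs"
    using remove_box[OF finite_shape zero_notin_shape assms(1,2)] by metis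
  then show ?thesis using ex_std[of M] that by fastforce
qed

section \<open>The eigenvalues\<close>

locale generic_parameter =
  fixes q :: "'a::field" and n :: nat
  assumes q0: "q \<noteq> 0" and two: "(2::'a) \<noteq> 0" and n1: "1 \<le> n"
    and generic: "\<And>j. 1 \<le> j \<Longrightarrow> j \<le> n \<Longrightarrow> q ^ (4 * j) \<noteq> 1"
begin

text \<open>The element \<open>z k\<close> acts by \<open>zc c\<close> on a box of content \<open>c\<close>; \<open>Phi_neighbour\<close> below shows that the
  roots of \<open>neighbours (zc c)\<close> are the eigenvalues at which the intertwiner degenerates.\<close>
definition zq :: "'a \<Rightarrow> 'a" where "zq p = 2 * (p + inverse p) / (q + inverse q)"

definition zc :: "nat \<Rightarrow> 'a" where "zc c = zq (q ^ (2 * c + 1))"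

definition neighbours :: "'a \<Rightarrow> 'a \<Rightarrow> 'a"
  where "neighbours a b = (a - b)\<^sup>2 - (q - inverse q)\<^sup>2 * (a * b - 4)"

lemma q4: "q ^ 4 \<noteq> 1" using generic[of 1] n1 by simp

lemma qq: "q + inverse q \<noteq> 0"
proof
  assume "q + inverse q = 0"
  then have "q * q + 1 = 0" using q0 by (metis add.commute distrib_left mult_zero_right right_inverse)
  then have "q ^ 2 = -1" by (simp add: power2_eq_square eq_neg_iff_add_eq_0)
  then have "(q ^ 2) ^ 2 = (-1) ^ 2" by simp
  then have "q ^ 4 = 1" by (simp flip: power_mult)
  then show False using q4 by simp
qed

lemma eps0: "q - inverse q \<noteq> 0"
proof
  assume "q - inverse q = 0"
  then have "q * q = 1" using q0 by (metis right_inverse right_minus_eq)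
  then have "(q ^ 2) ^ 2 = 1 ^ 2" by (simp add: power2_eq_square)
  then have "q ^ 4 = 1" by (simp flip: power_mult)
  then show False using q4 by simp
qed

lemma zq_eq_iff:
  assumes "p \<noteq> 0" "r \<noteq> 0"
  shows "zq p = zq r \<longleftrightarrow> p = r \<or> p * r = 1"
proof -
  have "zq p = zq r \<longleftrightarrow> 2 * (p + inverse p) = 2 * (r + inverse r)"
    using qq by (auto simp only: zq_def divide_cancel_right)
  also have "\<dots> \<longleftrightarrow> p + inverse p = r + inverse r"
    using two by (simp only: mult_cancel_left simp_thms)
  also have "\<dots> \<longleftrightarrow> (p - r) * (p * r - 1) = 0"
    using assms by (auto simp add: field_simps)
  finally show ?thesis by auto
qed

lemma q_power_eq: assumes "q ^ j = 1" "4 * i = j * k" shows "q ^ (4 * i) = 1"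
  using assms by (simp add: power_mult)

lemma zc_eqD:
  assumes "zc c = zc d" "c < d"
  shows "q ^ (2 * (d - c)) = 1 \<or> q ^ (2 * (c + d + 1)) = 1"
proof -
  have "q ^ (2 * c + 1) = q ^ (2 * d + 1) \<or> q ^ (2 * c + 1) * q ^ (2 * d + 1) = 1"
    using assms zq_eq_iff[of "q ^ (2 * c + 1)" "q ^ (2 * d + 1)"] q0 by (simp add: zc_def)
  moreover have "q ^ (2 * d + 1) = q ^ (2 * c + 1) * q ^ (2 * (d - c))"
  proof -
    have "2 * d + 1 = (2 * c + 1) + 2 * (d - c)" using assms(2) by simp
    then show ?thesis by (metis power_add)
  qed
  moreover have "q ^ (2 * c + 1) * q ^ (2 * d + 1) = q ^ (2 * (c + d + 1))"
    by (simp flip: power_add)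
  moreover have "q ^ (2 * c + 1) \<noteq> 0" using q0 by simp
  ultimately show ?thesis by (metis mult_cancel_left2)
qed

lemma generic2: "1 \<le> j \<Longrightarrow> j \<le> n \<Longrightarrow> q ^ (2 * j) \<noteq> 1"
  using generic[of j] q_power_eq[of "2 * j" j 2] by auto

text \<open>The bound is what \<open>addable_two\<close> yields for two contents addable to a shape
  of fewer than \<open>n\<close> boxes.\<close>

lemma zc_inj: assumes "c \<noteq> d" "c + d + 1 \<le> n" shows "zc c \<noteq> zc d"
proof -
  have *: "zc c \<noteq> zc d" if "c < d" "c + d + 1 \<le> n" for c d
    using zc_eqD[of c d] generic2[of "d - c"] generic2[of "c + d + 1"] that by auto
  show ?thesis using *[of c d] *[of d c] assms by (cases "c < d") (auto simp: add.commute)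
qed

text \<open>Not an instance of \<open>zc_inj\<close>, which would ask for
  \<open>2 * c + 2 \<le> n\<close>: the critical exponent \<open>2 * (c + Suc c + 1)\<close> is a
  multiple of 4, so \<open>generic\<close> applies up to \<open>Suc c = n\<close>. This is one
  source of the exponents \<open>4 * j\<close> in \<open>generic\<close>.\<close>

lemma zc_Suc: assumes "Suc c \<le> n" shows "zc c \<noteq> zc (Suc c)"
proof
  assume "zc c = zc (Suc c)"
  then have "q ^ (2 * (Suc c - c)) = 1 \<or> q ^ (2 * (c + Suc c + 1)) = 1" by (rule zc_eqD) simp
  moreover have "2 * (Suc c - c) = 2" "2 * (c + Suc c + 1) = 4 * Suc c" by simp_all
  ultimately have "q ^ 2 = 1 \<or> q ^ (4 * Suc c) = 1" by metis
  then show False using generic2[of 1] generic[of "Suc c"] n1 assms by auto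
qed

lemma zc_0: "zc 0 = 2"
  using qq by (simp add: zc_def zq_def field_simps flip: distrib_left)

text \<open>Since \<open>-2\<close> is \<open>zq (- q)\<close>, equality would make
  \<open>q ^ (2 * c)\<close> or \<open>q ^ (2 * (c + 1))\<close> equal to -1, and the square of that
  power is excluded by \<open>generic\<close>.\<close>

lemma zc_not_minus_two: assumes "c + 1 \<le> n" shows "zc c \<noteq> -2"
proof
  assume "zc c = -2"
  also have "-2 = zq (- q)" using qq by (simp add: zq_def field_simps)
  finally have "q ^ (2 * c + 1) = - q \<or> q ^ (2 * c + 1) * (- q) = 1"
    using zq_eq_iff[of "q ^ (2 * c + 1)" "-q"] q0 by (simp add: zc_def)
  moreover have "q ^ (2 * c + 1) * (- q) = - (q ^ (2 * (c + 1)))" by (simp add: power2_eq_square)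
  moreover have "q ^ (2 * c + 1) = q * q ^ (2 * c)" "- q = q * (- 1)" by simp_all
  ultimately have "q * (q ^ (2 * c)) = q * (- 1) \<or> - (q ^ (2 * (c + 1))) = 1" by metis
  then have "q * (q ^ (2 * c)) = q * (- 1) \<or> q ^ (2 * (c + 1)) = -1" by (metis minus_equation_iff)
  then have 1: "q ^ (2 * c) = -1 \<or> q ^ (2 * (c + 1)) = -1" using q0 by (simp only: mult_cancel_left) auto
  have "q ^ (4 * j) = 1" if "q ^ (2 * j) = -1" for j
  proof -
    have "q ^ (4 * j) = (q ^ (2 * j)) ^ 2" by (simp flip: power_mult)
    then show ?thesis using that by simp
  qed
  moreover have "q ^ (2 * 0) \<noteq> -1"
    using two by (metis add.inverse_inverse eq_neg_iff_add_eq_0 mult_0_right one_add_one power_0)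
  ultimately have "c \<noteq> 0 \<and> q ^ (4 * c) = 1 \<or> q ^ (4 * (c + 1)) = 1" using 1 by metis
  then show False using generic[of c] generic[of "c+1"] assms by auto
qed

text \<open>Where \<open>z k\<close> acts by 2 or -2, the Clifford algebra of \<open>C k\<close> and
  \<open>D k\<close> degenerates. This is confined to content 0, which \<open>unip\<close> takes
  care of.\<close>

lemma zc_sq: assumes "c \<noteq> 0" "c + 1 \<le> n" shows "zc c * zc c \<noteq> 4"
proof
  assume "zc c * zc c = 4"
  then have "(zc c - 2) * (zc c + 2) = 0" by (simp add: algebra_simps)
  then have "zc c = zc 0 \<or> zc c = - 2" by (auto simp: zc_0 eq_neg_iff_add_eq_0)
  then show False using zc_inj[of c 0] zc_not_minus_two[of c] assms by auto
qed

text \<open>Both sides are monic quadratics in \<open>y\<close>; equations 1 and 2 of the proof give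
  the sum and the product of the roots.\<close>

lemma neighbours_zq: assumes "p \<noteq> 0"
  shows "neighbours (zq p) y = (y - zq (p * q\<^sup>2)) * (y - zq (p / q\<^sup>2))"
proof -
  define s t where "s = q + inverse q" and "t = p + inverse p"
  have s: "s \<noteq> 0" using qq s_def by simp
  have "zq (p * q\<^sup>2) + zq (p / q\<^sup>2) = 2 * ((p * q^2 + inverse (p * q^2)) + (p / q^2 + inverse (p / q^2))) / s"
    unfolding zq_def s_def[symmetric] using s by (simp add: field_simps)
  also have "(p * q^2 + inverse (p * q^2)) + (p / q^2 + inverse (p / q^2)) = t * (s\<^sup>2 - 2)"
    using assms q0 by (simp add: t_def s_def divide_simps power2_eq_square) (simp add: algebra_simps)
  finally have 1: "zq (p * q\<^sup>2) + zq (p / q\<^sup>2) = zq p * (s\<^sup>2 - 2)"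
    by (simp add: zq_def t_def s_def)
  have frac: "(2 * a / s) * (2 * b / s) = 4 * (a * b) / s\<^sup>2" for a b :: 'a
    by (simp add: power2_eq_square)
  have "zq (p * q\<^sup>2) * zq (p / q\<^sup>2) = 4 * ((p * q^2 + inverse (p * q^2)) * (p / q^2 + inverse (p / q^2))) / s\<^sup>2"
    unfolding zq_def s_def[symmetric] by (rule frac)
  also have "(p * q^2 + inverse (p * q^2)) * (p / q^2 + inverse (p / q^2)) = t\<^sup>2 + s\<^sup>2 * (s\<^sup>2 - 4)"
    using assms q0 by (simp add: t_def s_def divide_simps power2_eq_square) (simp add: algebra_simps)
  also have "4 * (t\<^sup>2 + s\<^sup>2 * (s\<^sup>2 - 4)) / s\<^sup>2 = (zq p)\<^sup>2 + 4 * (s\<^sup>2 - 4)"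
  proof -
    have "(zq p)\<^sup>2 = 4 * (t * t) / s\<^sup>2" unfolding zq_def t_def[symmetric] s_def[symmetric] power2_eq_square[of "2 * t / s"]
      by (rule frac)
    then show ?thesis using s by (simp add: field_simps power2_eq_square)
  qed
  finally have 2: "zq (p * q\<^sup>2) * zq (p / q\<^sup>2) = (zq p)\<^sup>2 + 4 * (s\<^sup>2 - 4)" .
  have e: "(q - inverse q)\<^sup>2 = s\<^sup>2 - 4" using q0 by (simp add: s_def power2_eq_square algebra_simps)
  have "(y - zq (p * q\<^sup>2)) * (y - zq (p / q\<^sup>2)) = y\<^sup>2 - (zq (p * q\<^sup>2) + zq (p / q\<^sup>2)) * y + zq (p * q\<^sup>2) * zq (p / q\<^sup>2)"
    by (simp add: algebra_simps power2_eq_square)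
  also have "\<dots> = neighbours (zq p) y"
    unfolding 1 2 neighbours_def e by (simp add: algebra_simps power2_eq_square)
  finally show ?thesis by simp
qed

lemma neighbours_zc: "neighbours (zc c) y = (y - zc (Suc c)) * (y - zc (c - 1))"
proof -
  have 1: "q ^ (2 * c + 1) * q\<^sup>2 = q ^ (2 * Suc c + 1)" by (simp add: power2_eq_square)
  have 2: "zq (q ^ (2 * c + 1) / q\<^sup>2) = zc (c - 1)"
  proof (cases c)
    \<comment> \<open>Content 0 is its own lower neighbour, because \<open>zq\<close> is invariant
      under inversion; truncated subtraction happens to give just this.\<close>
    case 0
    have "zq (q / q\<^sup>2) = zq q" using q0 zq_eq_iff[of "q / q\<^sup>2" q] by (simp add: power2_eq_square)
    then show ?thesis using 0 by (simp add: zc_def)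
  next
    case (Suc b)
    then have "q ^ (2 * c + 1) / q\<^sup>2 = q ^ (2 * b + 1)" using q0 by (simp add: power2_eq_square)
    then show ?thesis using Suc by (simp add: zc_def)
  qed
  show ?thesis using neighbours_zq[of "q ^ (2 * c + 1)" y] q0 unfolding 1 2 by (simp add: zc_def)
qed

lemma sq_pow: "(q ^ m)\<^sup>2 = q ^ (2 * m)"
  by (metis power_mult mult.commute)

lemma pow_sq: "q ^ (2 * m) * q\<^sup>2 = q ^ (2 * (m + 1))"
  by (simp add: power2_eq_square)

text \<open>The hypothesis is the vanishing of the second factor in \<open>kappa_factor\<close> for
  adjacent eigenvalues. It reduces to the equality of \<open>zq (p\<^sup>2 * q)\<close> and
  \<open>zq q\<close>.\<close>

lemma kappa_zq:
  assumes "p \<noteq> 0" "8 - zq p * zq p - zq (p * q\<^sup>2) * zq p = 0"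
  shows "p\<^sup>2 = 1 \<or> p\<^sup>2 * q\<^sup>2 = 1"
proof -
  define s where "s = q + inverse q"
  have s: "s \<noteq> 0" using qq s_def by simp
  have "zq p + zq (p * q\<^sup>2) = 2 * (p + inverse p + (p * q^2 + inverse (p * q^2))) / s"
    unfolding zq_def s_def[symmetric] using s by (simp add: field_simps)
  also have "p + inverse p + (p * q^2 + inverse (p * q^2)) = s * (p * q + inverse (p * q))"
    using assms q0 by (simp add: s_def divide_simps power2_eq_square) (simp add: algebra_simps)
  finally have 1: "zq p + zq (p * q\<^sup>2) = 2 * (p * q + inverse (p * q))" using s by simp
  have "8 - zq p * (zq p + zq (p * q\<^sup>2)) = 0" using assms(2) by (simp add: algebra_simps)
  then have "8 * s = 4 * ((p + inverse p) * (p * q + inverse (p * q)))"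
  proof -
    define t w where "t = p + inverse p" and "w = p * q + inverse (p * q)"
    have "8 - (2 * t / s) * (2 * w) = 0"
      using \<open>8 - zq p * (zq p + zq (p * q\<^sup>2)) = 0\<close> unfolding 1 unfolding w_def t_def s_def zq_def .
    then have "8 * s = 4 * (t * w)" using s by (simp add: field_simps)
    then show ?thesis by (simp only: t_def w_def)
  qed
  also have "(p + inverse p) * (p * q + inverse (p * q)) = s + (p\<^sup>2 * q + inverse (p\<^sup>2 * q))"
    using assms q0 by (simp add: s_def divide_simps power2_eq_square) (simp add: algebra_simps)
  finally have "8 * s = 4 * (s + (p\<^sup>2 * q + inverse (p\<^sup>2 * q)))" .
  moreover have "4 * (2 * s) = 8 * s" by simp
  ultimately have "4 * (2 * s) = 4 * (s + (p\<^sup>2 * q + inverse (p\<^sup>2 * q)))" by (rule trans[rotated])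
  moreover have "(4::'a) \<noteq> 0" using two by (metis mult_eq_0_iff numeral_Bit0 mult_2)
  ultimately have "2 * s = s + (p\<^sup>2 * q + inverse (p\<^sup>2 * q))" by (metis mult_cancel_left)
  then have "p\<^sup>2 * q + inverse (p\<^sup>2 * q) = q + inverse q"
    unfolding s_def[symmetric] mult_2 by (metis add_left_cancel)
  then have "zq (p\<^sup>2 * q) = zq q" by (simp only: zq_def)
  then have "p\<^sup>2 * q = q \<or> p\<^sup>2 * q * q = 1" using zq_eq_iff[of "p\<^sup>2 * q" q] assms q0 by simp
  then show ?thesis using q0 by (auto simp: power2_eq_square mult.assoc)
qed

lemma kappa_up:
  assumes "2 * c + 2 \<le> n"
  shows "8 - zc c * zc c - zc (Suc c) * zc c \<noteq> 0"
proof
  assume "8 - zc c * zc c - zc (Suc c) * zc c = 0"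
  moreover have "q ^ (2 * c + 1) * q\<^sup>2 = q ^ (2 * Suc c + 1)" by (simp add: power2_eq_square)
  moreover have "q ^ (2 * c + 1) \<noteq> 0" using q0 by simp
  ultimately have "(q ^ (2 * c + 1))\<^sup>2 = 1 \<or> (q ^ (2 * c + 1))\<^sup>2 * q\<^sup>2 = 1"
    using kappa_zq[of "q ^ (2 * c + 1)"] unfolding zc_def by metis
  then have "q ^ (2 * (2 * c + 1)) = 1 \<or> q ^ (2 * (2 * c + 1 + 1)) = 1"
    by (simp only: sq_pow pow_sq)
  then show False using generic2[of "2 * c + 1"] generic2[of "2 * c + 1 + 1"] assms by auto
qed

text \<open>For the pattern \<open>b, b + 1, b\<close>. The second hypothesis excludes the
  exceptional case of \<open>double_root\<close>.\<close>

lemma kappa_down: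
  assumes "Suc b < n" "q ^ (2 * (2 * Suc b + 1)) \<noteq> 1"
  shows "8 - zc (Suc b) * zc (Suc b) - zc b * zc (Suc b) \<noteq> 0"
proof
  assume *: "8 - zc (Suc b) * zc (Suc b) - zc b * zc (Suc b) = 0"
  \<comment> \<open>Inverting the power leaves \<open>zq\<close> unchanged but turns multiplication
    by \<open>q\<^sup>2\<close> into a step down in content, so that \<open>kappa_zq\<close>
    applies.\<close>
  define p where "p = inverse (q ^ (2 * Suc b + 1))"
  have p0: "p \<noteq> 0" using q0 by (simp add: p_def)
  define A where "A = q ^ (2 * Suc b + 1)"
  have A0: "A \<noteq> 0" using q0 by (simp add: A_def)
  have pA: "p * A = 1" using A0 unfolding p_def A_def[symmetric] by simp
  have 1: "zq p = zc (Suc b)" using zq_eq_iff[OF p0 A0] pA by (simp add: A_def zc_def)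
  have "A = q ^ (2 * b + 1) * q\<^sup>2" by (simp add: A_def power2_eq_square)
  then have "p * q\<^sup>2 * q ^ (2 * b + 1) = 1" using pA by (simp only: mult_ac)
  moreover have "p * q\<^sup>2 \<noteq> 0" "q ^ (2 * b + 1) \<noteq> 0" using p0 q0 by simp_all
  ultimately have 2: "zq (p * q\<^sup>2) = zc b"
    using zq_eq_iff[of "p * q\<^sup>2" "q ^ (2 * b + 1)"] unfolding zc_def by metis
  have "p\<^sup>2 = 1 \<or> p\<^sup>2 * q\<^sup>2 = 1" using kappa_zq[OF p0] * 1 2 by simp
  moreover have "p\<^sup>2 * A\<^sup>2 = 1" using pA by (simp flip: power_mult_distrib)
  ultimately have "A\<^sup>2 = 1 \<or> A\<^sup>2 = q\<^sup>2" using A0 p0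
    by (metis mult.commute mult_cancel_left power2_eq_square mult.right_neutral power_eq_0_iff zero_neq_numeral)
  then have "q ^ (2 * (2 * Suc b + 1)) = 1 \<or> q ^ (2 * (2 * Suc b + 1)) = q\<^sup>2"
    by (simp only: A_def sq_pow)
  moreover have "q ^ (2 * (2 * Suc b + 1)) = q\<^sup>2 * q ^ (4 * Suc b)"
  proof -
    have "2 * (2 * Suc b + 1) = 2 + 4 * Suc b" by simp
    then show ?thesis by (metis power_add)
  qed
  ultimately have "q ^ (4 * Suc b) = 1" using assms(2) q0 by auto
  then show False using generic[of "Suc b"] assms by auto
qed

lemma kappa_down': "2 * Suc b + 1 \<le> n \<Longrightarrow> 8 - zc (Suc b) * zc (Suc b) - zc b * zc (Suc b) \<noteq> 0"
  using kappa_down[of b] generic2[of "2 * Suc b + 1"] by auto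

text \<open>The exceptional case: the contents \<open>b\<close> and \<open>b + 2\<close> around a
  box of content \<open>b + 1\<close> have the same eigenvalue. By \<open>exceptional_large\<close>
  it requires \<open>n < 2 * b + 3\<close>, and for larger shapes it does not arise.\<close>

lemma double_root: assumes "zc (Suc (Suc b)) = zc b" shows "q ^ (2 * (2 * Suc b + 1)) = 1"
proof -
  have "q ^ (2 * 2) = 1 \<or> q ^ (2 * (2 * Suc b + 1)) = 1" using zc_eqD[of b "Suc (Suc b)"] assms by (simp add: algebra_simps)
  then show ?thesis using q4 by simp
qed

lemma exceptional_large: "q ^ (2 * (2 * Suc b + 1)) = 1 \<Longrightarrow> n < 2 * Suc b + 1"
  using generic2[of "2 * Suc b + 1"] by (meson not_le le_add2)

lemma exceptional_eq: "q ^ (2 * (2 * Suc b + 1)) = 1 \<Longrightarrow> zc (Suc (Suc b)) = zc b"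
proof -
  assume *: "q ^ (2 * (2 * Suc b + 1)) = 1"
  have "q ^ (2 * Suc (Suc b) + 1) * q ^ (2 * b + 1) = q ^ (2 * (2 * Suc b + 1))"
    by (simp only: power_add[symmetric]) (simp add: algebra_simps)
  moreover have "q ^ (2 * Suc (Suc b) + 1) \<noteq> 0" "q ^ (2 * b + 1) \<noteq> 0" using q0 by simp_all
  ultimately show ?thesis using * zq_eq_iff unfolding zc_def by metis
qed

end

section \<open>Products of linear factors\<close>

context assoc_algebra
begin

text \<open>The product of the operators \<open>v - a\<close>, \<open>a\<close> in the list, applied to a vector.\<close>
fun lins :: "'r \<Rightarrow> 'a list \<Rightarrow> 'r \<Rightarrow> 'r" where
  "lins v [] x = x"
| "lins v (a # as) x = lins v as (v * x - a *s x)"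

lemma lins_zero: "lins v as 0 = 0"
  by (induction as) auto

lemma lins_diff: "lins v as (x - y) = lins v as x - lins v as y"
proof (induction as arbitrary: x y)
  case (Cons a as)
  have "v * (x - y) - a *s (x - y) = (v * x - a *s x) - (v * y - a *s y)"
    by (simp add: algebra_simps scale_right_diff_distrib)
  then show ?case by (simp only: lins.simps Cons)
qed simp

lemma lins_scale: "lins v as (b *s x) = b *s lins v as x"
proof (induction as arbitrary: x)
  case (Cons a as)
  have "v * (b *s x) - a *s (b *s x) = b *s (v * x - a *s x)"
    by (simp add: scale_right_diff_distrib mult_scale mult.commute)
  then show ?case by (simp only: lins.simps Cons)
qed simp

lemma lins_intertwine:
  assumes "u * p = p * v"
  shows "lins u as (p * x) = p * lins v as x"
proof (induction as arbitrary: x)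
  case (Cons a as)
  have "u * (p * x) - a *s (p * x) = p * (v * x - a *s x)"
    using assms by (simp add: right_diff_distrib mult_scale mult.assoc[symmetric])
  then show ?case using Cons by simp
qed simp

lemma lins_commute: "lins v as (v * x - b *s x) = v * lins v as x - b *s lins v as x"
  using lins_intertwine[of v v v as x] by (simp add: lins_diff lins_scale)

lemma lins_eigen: "v * y = b *s y \<Longrightarrow> lins v as y = (\<Prod>a\<leftarrow>as. b - a) *s y"
  by (induction as arbitrary: y)
    (simp_all add: lins_scale scale_left_diff_distrib[symmetric] mult.commute)

lemma lins_remove1: "b \<in> set as \<Longrightarrow> lins v as x = lins v (remove1 b as) (v * x - b *s x)"
proof (induction as arbitrary: x)
  case (Cons a as)
  then show ?case by (cases "a = b") (auto simp: algebra_simps mult_scale scale_right_diff_distrib scale_left_commute)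
qed simp

lemma lins_append: "lins v (as @ bs) x = lins v bs (lins v as x)"
  by (induction as arbitrary: x) auto

lemma lins_mem:
  assumes "\<And>x. x \<in> V \<Longrightarrow> v * x \<in> V" "subspace V" "x \<in> V"
  shows "lins v as x \<in> V"
  using assms(3) by (induction as arbitrary: x) (auto intro!: assms(1) subspace_diff[OF assms(2)] subspace_scale[OF assms(2)])

lemma prod_list_zero_iff: "(\<Prod>a\<leftarrow>as. b - a) = (0::'a) \<longleftrightarrow> b \<in> set as"
  by (induction as) auto

lemma eigen_in_list:
  assumes "lins v as y = 0" "v * y = b *s y" "y \<noteq> 0"
  shows "b \<in> set as"
  using assms by (simp add: lins_eigen prod_list_zero_iff)

text \<open>If \<open>v * y - b *s y\<close> were nonzero, \<open>b\<close> would have to occur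
  twice among the roots of an annihilating product, but the roots are distinct.\<close>

lemma semisimple_eigen:
  assumes "lins v as y = 0" "distinct as" "v * (v * y - b *s y) = b *s (v * y - b *s y)"
  shows "v * y = b *s y"
proof (rule ccontr)
  define w where "w = v * y - b *s y"
  assume "v * y \<noteq> b *s y"
  then have w: "w \<noteq> 0" "v * w = b *s w" using assms(3) by (auto simp: w_def)
  have "lins v as w = 0" using lins_commute[of v as y b] assms(1) by (simp add: w_def)
  then have b: "b \<in> set as" using eigen_in_list w by blast
  then have "lins v (remove1 b as) w = 0" using assms(1) lins_remove1[of b as v y] by (simp add: w_def)
  then have "b \<in> set (remove1 b as)" using eigen_in_list w by blast
  then show False using assms(2) by simp
qed

text \<open>Cuts an annihilating product down to the roots in \<open>bs\<close>, given that these
  contain all eigenvalues on \<open>V\<close> and that there are no Jordan blocks at them. The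
  factors in \<open>as\<close> are stripped one at a time.\<close>

lemma lins_reduce:
  assumes V: "subspace V" "\<And>x. x \<in> V \<Longrightarrow> v * x \<in> V"
    and eig: "\<And>y b. y \<in> V \<Longrightarrow> v * y = b *s y \<Longrightarrow> y \<noteq> 0 \<Longrightarrow> b \<in> set bs"
    and ss: "\<And>y b. y \<in> V \<Longrightarrow> b \<in> set bs \<Longrightarrow> v * (v * y - b *s y) = b *s (v * y - b *s y) \<Longrightarrow> v * y = b *s y"
    and "lins v as x = 0" "x \<in> V"
  shows "lins v bs x = 0"
  using assms(5,6)
proof (induction as arbitrary: x)
  case Nil
  then show ?case by (simp add: lins_zero)
next
  case (Cons a as)
  define w where "w = lins v bs x"
  have w: "w \<in> V" unfolding w_def by (rule lins_mem) (use V Cons in auto)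
  have "lins v bs (v * x - a *s x) = 0"
    using Cons V by (auto intro!: subspace_diff subspace_scale)
  then have vw: "v * w = a *s w" by (simp add: lins_commute w_def)
  show ?case
  proof (cases "a \<in> set bs")
    case False
    then show ?thesis using eig[OF w vw] by (auto simp: w_def)
  next
    case True
    define u where "u = lins v (remove1 a bs) x"
    have u: "u \<in> V" unfolding u_def by (rule lins_mem) (use V Cons in auto)
    have wu: "w = v * u - a *s u"
      unfolding w_def u_def lins_remove1[OF True] by (rule lins_commute)
    then have "v * u = a *s u" using ss[OF u True] vw by simp
    then show ?thesis using wu by (simp add: w_def)
  qed
qed

end

section \<open>A braid relation in a Clifford algebra\<close>

context assoc_algebra
begin

context
  fixes V :: "'r set" and c1 d1 c2 d2 w :: 'r and a b :: 'a
  assumes closed: "\<And>y. y \<in> V \<Longrightarrow> c1 * y \<in> V" "\<And>y. y \<in> V \<Longrightarrow> d1 * y \<in> V"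
      "\<And>y. y \<in> V \<Longrightarrow> c2 * y \<in> V" "\<And>y. y \<in> V \<Longrightarrow> d2 * y \<in> V" "\<And>y. y \<in> V \<Longrightarrow> w * y \<in> V"
    and sq: "\<And>y. y \<in> V \<Longrightarrow> c1 * (c1 * y) = 2 *s y" "\<And>y. y \<in> V \<Longrightarrow> d1 * (d1 * y) = 2 *s y"
      "\<And>y. y \<in> V \<Longrightarrow> c2 * (c2 * y) = 2 *s y" "\<And>y. y \<in> V \<Longrightarrow> d2 * (d2 * y) = 2 *s y"
    and ac: "\<And>y. y \<in> V \<Longrightarrow> d1 * (c1 * y) = (a + b) *s y - c1 * (d1 * y)"
      "\<And>y. y \<in> V \<Longrightarrow> d2 * (c2 * y) = b *s y + w * y - c2 * (d2 * y)"
      "\<And>y. y \<in> V \<Longrightarrow> c2 * (c1 * y) = - (2 *s y) - c1 * (c2 * y)"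
      "\<And>y. y \<in> V \<Longrightarrow> d2 * (d1 * y) = - (2 *s y) - d1 * (d2 * y)"
      "\<And>y. y \<in> V \<Longrightarrow> d2 * (c1 * y) = - (b *s y) - c1 * (d2 * y)"
      "\<And>y. y \<in> V \<Longrightarrow> c2 * (d1 * y) = - (b *s y) - d1 * (c2 * y)"
    and wc: "\<And>y. w * (c1 * y) = c1 * (w * y)" "\<And>y. w * (d1 * y) = d1 * (w * y)"
      "\<And>y. w * (c2 * y) = c2 * (w * y)" "\<And>y. w * (d2 * y) = d2 * (w * y)"
begin

text \<open>Coordinates with respect to the eight ordered even monomials in \<open>c1\<close>,
  \<open>d1\<close>, \<open>c2\<close>, \<open>d2\<close>, applied to \<open>y\<close>. The element
  \<open>w\<close> is not a scalar and is carried along by applying it to \<open>y\<close>, see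
  \<open>w_lc\<close>.\<close>

definition lc :: "'r \<Rightarrow> 'a \<Rightarrow> 'a \<Rightarrow> 'a \<Rightarrow> 'a \<Rightarrow> 'a \<Rightarrow> 'a \<Rightarrow> 'a \<Rightarrow> 'a \<Rightarrow> 'r"
  where "lc y p0 p1 p2 p3 p4 p5 p6 p7 = p0 *s y + p1 *s (c1 * (d1 * y)) + p2 *s (c2 * (d2 * y))
    + p3 *s (c1 * (d1 * (c2 * (d2 * y)))) + p4 *s (c1 * (d2 * y)) + p5 *s (d1 * (c2 * y))
    + p6 *s (c1 * (c2 * y)) + p7 *s (d1 * (d2 * y))"

lemma lc_add: "lc y p0 p1 p2 p3 p4 p5 p6 p7 + lc y r0 r1 r2 r3 r4 r5 r6 r7
    = lc y (p0+r0) (p1+r1) (p2+r2) (p3+r3) (p4+r4) (p5+r5) (p6+r6) (p7+r7)"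
  by (simp add: lc_def scale_left_distrib add_ac)

lemma lc_diff: "lc y p0 p1 p2 p3 p4 p5 p6 p7 - lc y r0 r1 r2 r3 r4 r5 r6 r7
    = lc y (p0-r0) (p1-r1) (p2-r2) (p3-r3) (p4-r4) (p5-r5) (p6-r6) (p7-r7)"
  by (simp add: lc_def scale_left_diff_distrib algebra_simps)

lemma lc_scale: "k *s lc y p0 p1 p2 p3 p4 p5 p6 p7
    = lc y (k*p0) (k*p1) (k*p2) (k*p3) (k*p4) (k*p5) (k*p6) (k*p7)"
  by (simp add: lc_def scale_right_distrib)

lemma w_lc: "w * lc y p0 p1 p2 p3 p4 p5 p6 p7 = lc (w * y) p0 p1 p2 p3 p4 p5 p6 p7"
  by (simp add: lc_def distrib_left mult_scale wc)

lemma lc_base: "y = lc y 1 0 0 0 0 0 0 0" "c1 * (d1 * y) = lc y 0 1 0 0 0 0 0 0"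
    "c2 * (d2 * y) = lc y 0 0 1 0 0 0 0 0" "c1 * (d1 * (c2 * (d2 * y))) = lc y 0 0 0 1 0 0 0 0"
  by (simp_all add: lc_def)

lemma g2_g1: assumes "y \<in> V"
  shows "c2 * (d2 * (c1 * (d1 * y))) = lc y (b*b - 4) 0 0 1 b b (-2) (-2)"
proof -
  note m = closed assms
  have "c2 * (d2 * (c1 * (d1 * y))) = - (b *s (c2 * (d1 * y))) - c2 * (c1 * (d2 * (d1 * y)))"
    using m by (simp add: ac(5) right_diff_distrib mult_scale)
  also have "c2 * (c1 * (d2 * (d1 * y))) = - (2 *s (d2 * (d1 * y))) - c1 * (c2 * (d2 * (d1 * y)))"
    using m by (simp add: ac(3))
  also have "c1 * (c2 * (d2 * (d1 * y))) = - (2 *s (c1 * (c2 * y))) - c1 * (c2 * (d1 * (d2 * y)))"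
    using m by (simp add: ac(4) right_diff_distrib mult_scale)
  also have "c1 * (c2 * (d1 * (d2 * y))) = - (b *s (c1 * (d2 * y))) - c1 * (d1 * (c2 * (d2 * y)))"
    using m by (simp add: ac(6) right_diff_distrib mult_scale)
  also have "d2 * (d1 * y) = - (2 *s y) - d1 * (d2 * y)" using m by (simp add: ac(4))
  also have "c2 * (d1 * y) = - (b *s y) - d1 * (c2 * y)" using m by (simp add: ac(6))
  finally show ?thesis
    by (simp add: lc_def algebra_simps scale_right_diff_distrib scale_right_distrib scale_left_diff_distrib)
qed

lemma g1_g1: assumes "y \<in> V"
  shows "c1 * (d1 * (c1 * (d1 * y))) = (a + b) *s (c1 * (d1 * y)) - 4 *s y"
  using closed assms by (simp add: ac(1) right_diff_distrib mult_scale sq)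

lemma g1_lc: assumes "y \<in> V"
  shows "c1 * (d1 * lc y p0 p1 p2 p3 p4 p5 p6 p7)
    = lc y (-4 * p1) (p0 + (a+b)*p1) (-4 * p3) (p2 + (a+b)*p3) ((a+b)*p4 + 2*p7) (-2*p6) (2*p5 + (a+b)*p6) (-2*p4)"
proof -
  note m = closed assms
  have 1: "c1 * (d1 * (c1 * (d1 * (c2 * (d2 * y))))) = (a + b) *s (c1 * (d1 * (c2 * (d2 * y)))) - 4 *s (c2 * (d2 * y))"
    using m g1_g1 by simp
  have 2: "c1 * (d1 * (c1 * (d2 * y))) = (a + b) *s (c1 * (d2 * y)) - 2 *s (d1 * (d2 * y))"
    using m by (simp add: ac(1) right_diff_distrib mult_scale sq)
  have 3: "c1 * (d1 * (c1 * (c2 * y))) = (a + b) *s (c1 * (c2 * y)) - 2 *s (d1 * (c2 * y))"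
    using m by (simp add: ac(1) right_diff_distrib mult_scale sq)
  have 4: "c1 * (d1 * (d1 * (c2 * y))) = 2 *s (c1 * (c2 * y))" "c1 * (d1 * (d1 * (d2 * y))) = 2 *s (c1 * (d2 * y))"
    using m by (simp_all add: sq mult_scale)
  show ?thesis
    by (simp add: lc_def distrib_left mult_scale g1_g1[OF assms] 1 2 3 4)
       (simp add: algebra_simps scale_right_diff_distrib scale_right_distrib scale_left_diff_distrib scale_left_distrib)
qed

lemma lc_g2: assumes "y \<in> V"
  shows "lc (c2 * (d2 * y)) p0 p1 p2 p3 p4 p5 p6 p7
    = lc y (-4*p2) (-4*p3) (p0 + b*p2) (p1 + b*p3) (b*p4 + 2*p6) (-2*p7) (-2*p4) (2*p5 + b*p7)
    + lc (w * y) 0 0 p2 p3 p4 0 0 p7"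
proof -
  note m = closed assms
  have 1: "c2 * (c2 * y) = 2 *s y" using m sq by simp
  have 2: "d2 * (c2 * (d2 * y)) = b *s (d2 * y) + d2 * (w * y) - 2 *s (c2 * y)"
    using m by (simp add: ac(2) algebra_simps mult_scale sq wc)
  have 3: "c2 * (c2 * (d2 * y)) = 2 *s (d2 * y)"
    using m by (simp_all add: sq mult_scale)
  show ?thesis
    by (simp add: lc_def distrib_left mult_scale 1 2 3 right_diff_distrib)
       (simp add: algebra_simps scale_right_diff_distrib scale_right_distrib scale_left_diff_distrib scale_left_distrib)
qed

lemma lc_cong:
  assumes "p0 = r0" "p1 = r1" "p2 = r2" "p3 = r3" "p4 = r4" "p5 = r5" "p6 = r6" "p7 = r7"
  shows "lc y p0 p1 p2 p3 p4 p5 p6 p7 = lc y r0 r1 r2 r3 r4 r5 r6 r7"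
  using assms by simp

text \<open>In \<open>three_boxes\<close>, \<open>G1\<close> and \<open>G2\<close> are multiples of
  the action of \<open>T i\<close> and of the action of \<open>T (Suc i)\<close> after
  \<open>b - w\<close>, so the left side is the defect of the braid relation. Comparing coordinates
  shows that only \<open>H\<close> survives, which links the outer two of the three letters.\<close>

lemma clifford_braid:
  assumes x: "x \<in> V"
    and G1: "\<And>y. G1 y = a *s y - c1 * (d1 * y)" and G2: "\<And>y. G2 y = b *s y - c2 * (d2 * y)"
    and H: "\<And>y. H y = (c1 + c2) * ((d1 + d2) * y) - a *s y"
  shows "b *s G1 (G2 (G1 x)) - w * G1 (G2 (G1 x)) - (a - b) *s G2 (G1 (G2 x))
    = (8*b - b*b*b - 4*a) *s H x + (a*b - 4) *s H (w * x)"
proof -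
  note m = closed x
  have g1l: "G1 (lc x p0 p1 p2 p3 p4 p5 p6 p7) = lc x (a*p0 - (-4 * p1)) (a*p1 - (p0 + (a+b)*p1))
     (a*p2 - (-4 * p3)) (a*p3 - (p2 + (a+b)*p3)) (a*p4 - ((a+b)*p4 + 2*p7)) (a*p5 - (-2*p6)) (a*p6 - (2*p5 + (a+b)*p6)) (a*p7 - (-2*p4))"
    for p0 p1 p2 p3 p4 p5 p6 p7
    by (simp only: G1 g1_lc[OF x] lc_scale lc_diff)
  have G1x: "G1 x = lc x a (-1) 0 0 0 0 0 0"
    unfolding G1 by (simp add: lc_def)
  have G2l: "G2 (lc y a (-1) 0 0 0 0 0 0) = lc y (b*a + (b*b - 4)) (-b) (-a) 1 b b (-2) (-2)" if "y \<in> V" for y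
  proof -
    have "lc y a (-1) 0 0 0 0 0 0 = a *s y - c1 * (d1 * y)" by (simp add: lc_def)
    then have "G2 (lc y a (-1) 0 0 0 0 0 0) = (b*a) *s y - b *s (c1 * (d1 * y)) - a *s (c2 * (d2 * y)) + c2 * (d2 * (c1 * (d1 * y)))"
      unfolding G2 by (simp only: right_diff_distrib mult_scale scale_right_diff_distrib scale_scale) (simp add: algebra_simps)
    also have "\<dots> = lc y (b*a) (-b) (-a) 0 0 0 0 0 + lc y (b*b - 4) 0 0 1 b b (-2) (-2)"
      unfolding g2_g1[OF that] by (simp add: lc_def[of y "b*a"])
    finally show ?thesis by (simp only: lc_add) (simp add: lc_def)
  qed
  have 1: "G2 (G1 x) = lc x (b*a + (b*b - 4)) (-b) (-a) 1 b b (-2) (-2)"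
    unfolding G1x by (rule G2l[OF x])
  have A: "G1 (G2 (G1 x)) = lc x (a*b*b + a*a*b - 4*a - 4*b) (4 - a*b) (4 - a*a) (a - b) (4 - b*b) (a*b - 4) 0 (2*b - 2*a)"
    unfolding 1 g1l by (rule lc_cong) (simp_all add: algebra_simps)
  have G1y: "G1 y = lc y a (-1) 0 0 0 0 0 0" for y unfolding G1 by (simp add: lc_def)
  have 2: "G1 (G2 x) = lc x (a*b) (-b) 0 0 0 0 0 0 - lc (c2 * (d2 * x)) a (-1) 0 0 0 0 0 0"
  proof -
    have "G1 (G2 x) = b *s G1 x - G1 (c2 * (d2 * x))"
      by (simp add: G1 G2 algebra_simps mult_scale scale_right_diff_distrib scale_left_commute)
    then show ?thesis unfolding G1y by (simp add: lc_scale mult.commute)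
  qed
  have "G2 (G1 (G2 x)) = b *s G2 (lc x a (-1) 0 0 0 0 0 0) - G2 (lc (c2 * (d2 * x)) a (-1) 0 0 0 0 0 0)"
    unfolding 2 by (simp add: G2 lc_def algebra_simps mult_scale scale_right_diff_distrib scale_left_commute)
  also have "\<dots> = lc x (b*(b*a + (b*b - 4))) (-b*b) (-b*a) b (b*b) (b*b) (-2*b) (-2*b)
     - lc (c2 * (d2 * x)) (b*a + (b*b - 4)) (-b) (-a) 1 b b (-2) (-2)"
    using m by (simp add: G2l lc_scale mult.commute[of b 2])
  also have "\<dots> = lc x (a*b*b + b*b*b - 4*a - 4*b) (4 - b*b) (4 - b*b - a*b) b 4 (b*b - 4) 0 (-2*b)
     - lc (w * x) 0 0 (-a) 1 b 0 0 (-2)"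
    unfolding lc_g2[OF x] diff_diff_eq[symmetric] lc_diff
    by (rule arg_cong2[of _ _ _ _ "(-)", OF lc_cong refl]) (simp_all add: algebra_simps)
  finally have B: "G2 (G1 (G2 x)) = lc x (a*b*b + b*b*b - 4*a - 4*b) (4 - b*b) (4 - b*b - a*b) b 4 (b*b - 4) 0 (-2*b)
     - lc (w * x) 0 0 (-a) 1 b 0 0 (-2)" .
  have Hy: "H y = lc y (-a-b) 1 1 0 1 (-1) 0 0" if "y \<in> V" for y
    using that m by (simp add: H lc_def distrib_left distrib_right ac(6) scale_left_diff_distrib)
  let ?M = "\<lambda>y. lc y (a*b*b + a*a*b - 4*a - 4*b) (4 - a*b) (4 - a*a) (a - b) (4 - b*b) (a*b - 4) 0 (2*b - 2*a)"
  let ?N = "lc x (a*b*b + b*b*b - 4*a - 4*b) (4 - b*b) (4 - b*b - a*b) b 4 (b*b - 4) 0 (-2*b)"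
  let ?N' = "lc (w * x) 0 0 (-a) 1 b 0 0 (-2)"
  have "b *s G1 (G2 (G1 x)) - w * G1 (G2 (G1 x)) - (a - b) *s G2 (G1 (G2 x))
    = (b *s ?M x - (a - b) *s ?N) + ((a - b) *s ?N' - ?M (w * x))"
    unfolding A B w_lc scale_right_diff_distrib[of _ ?N] by simp
  also have "b *s ?M x - (a - b) *s ?N = (8*b - b*b*b - 4*a) *s H x"
    unfolding Hy[OF x] lc_scale lc_diff by (rule lc_cong) (simp_all add: algebra_simps)
  also have "(a - b) *s ?N' - ?M (w * x) = (a*b - 4) *s H (w * x)"
    unfolding Hy[OF closed(5)[OF x]] lc_scale lc_diff by (rule lc_cong) (simp_all add: algebra_simps)
  finally show ?thesis .
qed

end
end

section \<open>Weight spaces\<close>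

locale hecke_clifford_generic = hecke_clifford_gens scale n q e T C + generic_parameter q n
  for scale :: "'a::field \<Rightarrow> 'r::ring \<Rightarrow> 'r" (infixr "*s" 75) and n q e T C
begin

lemma eps_nz: "eps \<noteq> 0" using eps0 by (simp add: eps_def)

text \<open>The head of the list belongs to the last letter. The base is a corner rather than the
  whole ring because \<open>e\<close> is only an idempotent of the ring type.\<close>

fun W :: "nat list \<Rightarrow> 'r set" where
  "W [] = {x. e * x = x}"
| "W (c # cs) = {x \<in> W cs. z (Suc (length cs)) * x = zc c *s x}"

lemma W_e: "x \<in> W cs \<Longrightarrow> e * x = x"
  by (induction cs) auto

lemma W_subspace: "subspace (W cs)"
  by (induction cs) (auto simp: subspace_def distrib_left mult_scale scale_right_distrib scale_left_commute)

lemma W_mult: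
  assumes "\<And>j. 1 \<le> j \<Longrightarrow> j \<le> length cs \<Longrightarrow> z j * r = r * z j" "e * r = r" "x \<in> W cs"
  shows "r * x \<in> W cs"
  using assms(1,3)
proof (induction cs)
  case Nil
  then show ?case using assms(2) by (simp add: mult.assoc[symmetric])
next
  case (Cons c cs)
  have "z (Suc (length cs)) * (r * x) = r * (z (Suc (length cs)) * x)"
    using Cons.prems(1)[of "Suc (length cs)"] by (simp add: mult.assoc[symmetric])
  then show ?case using Cons by (simp add: mult_scale)
qed

lemma W_z: "length cs \<le> n \<Longrightarrow> 1 \<le> j \<Longrightarrow> j \<le> n \<Longrightarrow> x \<in> W cs \<Longrightarrow> z j * x \<in> W cs"
  by (rule W_mult) (auto simp: z_z e_z)

lemma W_C: "length cs \<le> n \<Longrightarrow> 1 \<le> j \<Longrightarrow> j \<le> n \<Longrightarrow> x \<in> W cs \<Longrightarrow> C j * x \<in> W cs"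
  by (rule W_mult) (auto simp: C_z eC)

lemma W_D: "length cs \<le> n \<Longrightarrow> 1 \<le> j \<Longrightarrow> j \<le> n \<Longrightarrow> x \<in> W cs \<Longrightarrow> D j * x \<in> W cs"
  by (rule W_mult) (auto simp: D_z e_D)

lemma W_T: "length cs < k \<Longrightarrow> k < n \<Longrightarrow> x \<in> W cs \<Longrightarrow> T k * x \<in> W cs"
  by (rule W_mult) (auto simp: T_z_far eT)

lemma e_Phi: "1 \<le> k \<Longrightarrow> k < n \<Longrightarrow> e * Phi k = Phi k"
  by (simp add: Phi_def right_diff_distrib mult_scale e_left[OF eT] e_z e_g)

lemma W_Phi: "length cs < k \<Longrightarrow> k < n \<Longrightarrow> x \<in> W cs \<Longrightarrow> Phi k * x \<in> W cs"
  by (rule W_mult) (auto simp: z_Phi_far e_Phi)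

lemma W_Cons_z: "x \<in> W (c # cs) \<Longrightarrow> z (Suc (length cs)) * x = zc c *s x"
  by simp

lemma W_lins: "length cs < n \<Longrightarrow> x \<in> W cs \<Longrightarrow> lins (z (Suc (length cs))) as x \<in> W cs"
  by (rule lins_mem[OF _ W_subspace]) (auto intro: W_z)

lemma assoc_vec: "a * b = (c :: 'r) \<Longrightarrow> a * (b * y) = c * y"
  by (rule assoc_rule)

context
  fixes c k :: nat and cs :: "nat list"
  assumes k: "k = Suc (length cs)" "k < n"
begin

lemma k1: "1 \<le> k" using k by simp

lemma Phi_apply: "x \<in> W (c # cs) \<Longrightarrow>
    Phi k * x = T k * (zc c *s x - z (Suc k) * x) - eps *s (zc c *s x - g k * x)"
  using k by (simp add: Phi_def left_diff_distrib scale_mult mult.assoc)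

lemma Phi_weight: assumes "x \<in> W (c # cs)"
  shows "Phi k * x \<in> W cs" "z k * (Phi k * x) = Phi k * (z (Suc k) * x)"
    "z (Suc k) * (Phi k * x) = zc c *s (Phi k * x)"
proof -
  show "Phi k * x \<in> W cs" using W_Phi[of cs k x] assms k by auto
  show "z k * (Phi k * x) = Phi k * (z (Suc k) * x)"
    using z_Phi(1)[OF k1 k(2)] by (simp add: mult.assoc[symmetric])
  have "z (Suc k) * (Phi k * x) = Phi k * (z k * x)"
    using z_Phi(2)[OF k1 k(2)] by (simp add: mult.assoc[symmetric])
  then show "z (Suc k) * (Phi k * x) = zc c *s (Phi k * x)" using assms k by (simp add: mult_scale)
qed

lemma neighbours_coeffs:
  "zc (Suc c) + zc (c - 1) = (2 + eps * eps) * zc c" "zc (Suc c) * zc (c - 1) = zc c * zc c + 4 * (eps * eps)"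
proof -
  have 0: "neighbours (zc c) 0 = zc (Suc c) * zc (c - 1)" by (simp add: neighbours_zc)
  then show p: "zc (Suc c) * zc (c - 1) = zc c * zc c + 4 * (eps * eps)"
    by (simp add: neighbours_def power2_eq_square eps_def[symmetric] mult.commute)
  have "neighbours (zc c) 1 = (1 - zc (Suc c)) * (1 - zc (c - 1))" by (simp add: neighbours_zc)
  also have "\<dots> = 1 - (zc (Suc c) + zc (c - 1)) + zc (Suc c) * zc (c - 1)" by (simp add: algebra_simps)
  finally have "zc (Suc c) + zc (c - 1) = 1 + zc (Suc c) * zc (c - 1) - neighbours (zc c) 1" by simp
  also have "\<dots> = (2 + eps * eps) * zc c"
    unfolding p by (simp add: neighbours_def power2_eq_square eps_def[symmetric]) (simp add: algebra_simps)
  finally show "zc (Suc c) + zc (c - 1) = (2 + eps * eps) * zc c" .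
qed

lemma Phi_Phi_apply: assumes "x \<in> W (c # cs)"
  shows "Phi k * (Phi k * x) = - lins (z (Suc k)) [zc (Suc c), zc (c - 1)] x"
proof -
  define a v where "a = zc c" and "v = z (Suc k)"
  have u: "z k * x = a *s x" using assms k by (simp add: a_def)
  have uv: "z k * (v * x) = a *s (v * x)"
    using z_z[of k "Suc k"] k u by (simp add: v_def mult.assoc[symmetric]) (simp add: mult.assoc u mult_scale)
  have ex: "e * x = x" using assms W_e by blast
  have t: "(a * 2) *s y = a *s y + a *s y" for y
    by (simp only: mult_2_right scale_left_distrib)
  have "Phi k * (Phi k * x) = (Phi k * Phi k) * x" by (simp add: mult.assoc)
  also have "\<dots> = (eps * eps) *s (a *s (v * x) - 4 *s x) - (a *s (a *s x) - a *s (v * x) - a *s (v * x) + v * (v * x))"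
    unfolding Phi_Phi[OF k1 k(2)]
    by (simp add: v_def[symmetric] algebra_simps scale_mult mult_scale u uv ex)
  also have "\<dots> = - (v * (v * x) - ((2 + eps * eps) * a) *s (v * x) + (a * a + 4 * (eps * eps)) *s x)"
    by (simp add: algebra_simps scale_right_diff_distrib scale_left_distrib scale2 t)
  also have "\<dots> = - lins v [zc (Suc c), zc (c - 1)] x"
    unfolding a_def neighbours_coeffs[symmetric]
    by (simp add: algebra_simps scale_right_diff_distrib scale_left_distrib mult_scale)
  finally show ?thesis by (simp add: v_def)
qed

end

text \<open>Distinct roots taken from the addable contents express at once that the next
  \<open>z\<close> has no other eigenvalue on \<open>W cs\<close> and that it is diagonalisable
  there. Not every addable content is claimed to occur.\<close>

definition spec :: "nat list \<Rightarrow> bool"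
  where "spec cs \<longleftrightarrow> (\<exists>L. set L \<subseteq> zc ` addable (shape cs) \<and> distinct L \<and>
      (\<forall>x\<in>W cs. lins (z (Suc (length cs))) L x = 0))"

text \<open>In content 0 the element \<open>D k - C k\<close> has square \<open>2 - z k = 0\<close>; here it is required to vanish itself.\<close>
definition unip :: "nat list \<Rightarrow> bool"
  where "unip cs \<longleftrightarrow> (0 \<in> addable (shape cs) \<longrightarrow>
      (\<forall>x\<in>W (0 # cs). D (Suc (length cs)) * x = C (Suc (length cs)) * x))"

lemma spec_eigen:
  assumes "spec cs" "y \<in> W cs" "z (Suc (length cs)) * y = b *s y" "y \<noteq> 0"
  obtains c where "c \<in> addable (shape cs)" "b = zc c"
  using assms eigen_in_list unfolding spec_def by blast

lemma spec_semisimple: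
  assumes "spec cs" "y \<in> W cs"
    "z (Suc (length cs)) * (z (Suc (length cs)) * y - b *s y) = b *s (z (Suc (length cs)) * y - b *s y)"
  shows "z (Suc (length cs)) * y = b *s y"
  using assms semisimple_eigen unfolding spec_def by blast

lemma scale2_eq_0: "2 *s x = 0 \<Longrightarrow> x = 0"
  using two by simp

text \<open>No two consecutive boxes have the same content.\<close>
lemma no_repeat:
  assumes k: "k = Suc (length cs)" "k < n" and std: "std (c # cs)" and sp: "spec cs" and un: "unip cs"
    and x: "x \<in> W (c # cs)" "z (Suc k) * x = zc c *s x"
  shows "x = 0"
proof (rule ccontr)
  assume x0: "x \<noteq> 0"
  have k1: "1 \<le> k" using k by simp
  define a where "a = zc c"
  have cle: "c \<le> length cs" using addable_le_sum[OF finite_shape, of c cs] sum_shape[of cs] std by simp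
  \<comment> \<open>The difference \<open>z k * (T k * y) - a *s (T k * y)\<close> equals
    \<open>eps *s (a *s y - g k * y)\<close>, again an eigenvector for \<open>a\<close>. As
    \<open>z k\<close> is diagonalisable on \<open>W cs\<close>, it vanishes, so \<open>g k\<close>
    also acts by \<open>a\<close>.\<close>
  have main: "z k * (T k * y) = a *s (T k * y)" "g k * y = a *s y"
    if y: "y \<in> W (c # cs)" "z (Suc k) * y = a *s y" for y
  proof -
    have u: "z k * y = a *s y" using y k by (simp add: a_def)
    have "z k * T k = T k * z (Suc k) + eps *s (z k - g k)" using T_z'[OF k1 k(2)] by simp
    then have "z k * (T k * y) = T k * (z (Suc k) * y) + eps *s (z k * y - g k * y)"
      by (simp add: mult.assoc[symmetric] distrib_right scale_mult left_diff_distrib)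
    then have 1: "z k * (T k * y) - a *s (T k * y) = eps *s (a *s y - g k * y)"
      using y u by (simp add: mult_scale)
    have "z k * (g k * y) = a *s (g k * y)"
    proof -
      have h: "z k * g k = g k * z k" using z_g[OF k1 k(2), of k] k1 k(2) by simp
      show ?thesis by (simp only: assoc_vec[OF h]) (simp add: mult.assoc u mult_scale)
    qed
    then have "z k * (z k * (T k * y) - a *s (T k * y)) = a *s (z k * (T k * y) - a *s (T k * y))"
      unfolding 1 by (simp add: mult_scale right_diff_distrib u scale_right_diff_distrib mult_ac)
    moreover have "T k * y \<in> W cs" using W_T[of cs k y] y k by auto
    ultimately show 2: "z k * (T k * y) = a *s (T k * y)"
      using spec_semisimple[OF sp, of "T k * y" a] k by simp
    then show "g k * y = a *s y" using 1 eps_nz by simp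
  qed
  have gx: "g k * x = a *s x" using main x by (simp add: a_def)
  have ux: "z k * x = a *s x" using x k by (simp add: a_def)
  \<comment> \<open>With \<open>z k\<close>, \<open>z (Suc k)\<close> and \<open>g k\<close> all
    acting by \<open>a\<close>, the equation \<open>g_g\<close> reads
    \<open>a * a = 2 * a * a - 4\<close>.\<close>
  have "g k * (g k * x) = (z k + z (Suc k)) * (g k * x) - 4 *s (e * x)"
    by (simp only: assoc_vec[OF g_g[OF k1 k(2)]]) (simp add: left_diff_distrib scale_mult mult.assoc)
  then have "(a * a) *s x = ((a * a) *s x + (a * a) *s x) - 4 *s x"
    using x W_e[of x] ux by (simp add: gx mult_scale distrib_right a_def[symmetric] scale_right_distrib)
  then have "(a * a - 4) *s x = 0" by (simp add: scale_left_diff_distrib)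
  then have "a * a = 4" using x0 by simp
  then have c: "c = 0" using zc_sq[of c] cle k unfolding a_def by auto
  then have a: "a = 2" by (simp add: a_def zc_0)
  have un': "D k * y = C k * y" if "y \<in> W cs" "z k * y = 2 *s y" for y
    using un std that k unfolding unip_def c by (simp add: zc_0)
  \<comment> \<open>\<open>unip\<close> applies to \<open>T k * y\<close>. Moving \<open>T k\<close>
    to the left leaves \<open>eps\<close> times \<open>(C k - C (Suc k)) * y\<close>, which must
    vanish although \<open>C k - C (Suc k)\<close> has square 2.\<close>
  have last: "y = 0" if y: "y \<in> W (c # cs)" "z (Suc k) * y = 2 *s y" "D (Suc k) * y = C (Suc k) * y" for y
  proof -
    have Ty: "T k * y \<in> W cs" using W_T[of cs k y] y k by auto
    have "D k * (T k * y) = C k * (T k * y)"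
      using un'[OF Ty] main(1)[OF y(1)] y a by simp
    moreover have "D k * (T k * y) = T k * (D (Suc k) * y)"
      using TD2(1)[OF k1 k(2)] by (simp add: mult.assoc[symmetric])
    moreover have "C k * (T k * y) = T k * (C (Suc k) * y) + eps *s ((C k - C (Suc k)) * y)"
    proof -
      have h: "C k * T k = T k * C (Suc k) + eps *s (C k - C (Suc k))" using TC2(2)[OF k1 k(2)] by simp
      show ?thesis by (simp only: assoc_vec[OF h]) (simp add: distrib_right scale_mult mult.assoc)
    qed
    ultimately have "(C k - C (Suc k)) * y = 0" using y eps_nz by simp
    then have "(C k - C (Suc k)) * ((C k - C (Suc k)) * y) = 0" by simp
    then have "2 *s (e * y) = 0" using c_c[OF k1 k(2)] by (simp add: mult.assoc[symmetric] scale_mult)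
    then show ?thesis using W_e[OF y(1)] scale2_eq_0 by simp
  qed
  \<comment> \<open>The third hypothesis of \<open>last\<close> is met first by
    \<open>N * x\<close>, because \<open>N\<close> has square \<open>2 *s e - z (Suc k)\<close>,
    which kills \<open>x\<close>, and then by \<open>x\<close> itself.\<close>
  define N where "N = D (Suc k) - C (Suc k)"
  have Nx: "N * x \<in> W (c # cs)"
    unfolding N_def left_diff_distrib
    by (intro subspace_diff W_subspace W_C W_D) (use x k in auto)
  have "z (Suc k) * N = N * z (Suc k)"
    using C_z[of "Suc k" "Suc k"] D_z[of "Suc k" "Suc k"] k
    by (simp add: N_def left_diff_distrib right_diff_distrib)
  then have zN: "z (Suc k) * (N * x) = 2 *s (N * x)"
    using x a by (simp only: assoc_vec) (simp add: mult.assoc a_def[symmetric] mult_scale)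
  have h: "N * N = 2 *s e - z (Suc k)"
    using CC_k[OF k1 k(2)] by (simp add: N_def z_def algebra_simps scale2)
  have "N * (N * x) = 0" using x W_e[OF x(1)] a by (simp only: assoc_vec[OF h]) (simp add: left_diff_distrib scale_mult a_def[symmetric])
  then have "D (Suc k) * (N * x) = C (Suc k) * (N * x)" by (simp add: N_def left_diff_distrib)
  then have "N * x = 0" using last[OF Nx zN] by simp
  then have "D (Suc k) * x = C (Suc k) * x" by (simp add: N_def left_diff_distrib)
  then show False using last[of x] x x0 a by (simp add: a_def)
qed

end

section \<open>Subalgebras on the first letters and transport between tableaux of the same
  shape\<close>

context hecke_clifford_generic
begin

inductive_set Hs :: "nat \<Rightarrow> 'r set" for m :: nat where
  Hs_e: "e \<in> Hs m"
| Hs_scale: "r \<in> Hs m \<Longrightarrow> a *s r \<in> Hs m"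
| Hs_add: "r \<in> Hs m \<Longrightarrow> s \<in> Hs m \<Longrightarrow> r + s \<in> Hs m"
| Hs_mult: "r \<in> Hs m \<Longrightarrow> s \<in> Hs m \<Longrightarrow> r * s \<in> Hs m"
| Hs_T: "1 \<le> i \<Longrightarrow> i < m \<Longrightarrow> T i \<in> Hs m"
| Hs_C: "1 \<le> i \<Longrightarrow> i \<le> m \<Longrightarrow> C i \<in> Hs m"

lemma Hs_diff: "r \<in> Hs m \<Longrightarrow> s \<in> Hs m \<Longrightarrow> r - s \<in> Hs m"
  using Hs_add[OF _ Hs_scale[of s m "-1"]] by fastforce

lemma Hs_mono: "m \<le> l \<Longrightarrow> r \<in> Hs m \<Longrightarrow> r \<in> Hs l"
  by (rotate_tac, induction rule: Hs.induct) (auto intro: Hs.intros)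

lemma Hs_unit: "r \<in> Hs m \<Longrightarrow> m \<le> n \<Longrightarrow> e * r = r \<and> r * e = r"
proof (induction rule: Hs.induct)
  case (Hs_mult r s)
  then show ?case by (metis mult.assoc)
qed (auto simp: ee mult_scale scale_mult distrib_left distrib_right eT Te eC Ce)

lemma Hs_D: "1 \<le> j \<Longrightarrow> j \<le> m \<Longrightarrow> D j \<in> Hs m"
proof (induction j rule: D.induct)
  case (3 k)
  then show ?case by (auto simp: D.simps(3) Ti_def intro!: Hs.intros Hs_diff)
qed (auto intro: Hs.intros)

lemma Hs_z: "1 \<le> j \<Longrightarrow> j \<le> m \<Longrightarrow> z j \<in> Hs m"
  by (auto simp: z_def intro!: Hs_add Hs_mult Hs_C Hs_D)

lemma Hs_g: "1 \<le> k \<Longrightarrow> k < m \<Longrightarrow> g k \<in> Hs m"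
  by (auto simp: g_def intro!: Hs_diff Hs_mult Hs_C Hs_D)

lemma Hs_Phi: "1 \<le> k \<Longrightarrow> k < m \<Longrightarrow> Phi k \<in> Hs m"
  by (auto simp: Phi_def intro!: Hs_diff Hs_mult Hs_z Hs_T Hs_g Hs_scale)

text \<open>These elements commute with each \<open>C j\<close> and \<open>D j\<close> of a later
  letter, not just with \<open>z j\<close>. Transport along them thus preserves the identity in
  \<open>unip\<close> as well as eigenvalues.\<close>

definition Tr :: "nat \<Rightarrow> 'r set"
  where "Tr m = {r \<in> Hs m. \<forall>j. m < j \<and> j \<le> n \<longrightarrow> C j * r = r * C j \<and> D j * r = r * D j}"

lemma Tr_e: "e \<in> Tr m" by (auto simp: Tr_def Hs_e eC Ce e_D D_e)

lemma Tr_mult: "r \<in> Tr m \<Longrightarrow> s \<in> Tr m \<Longrightarrow> r * s \<in> Tr m"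
proof -
  assume r: "r \<in> Tr m" and s: "s \<in> Tr m"
  have "x * (r * s) = r * s * x" if "x * r = r * x" "x * s = s * x" for x :: 'r
    by (simp only: assoc_vec[OF that(1)] mult.assoc that(2))
  then show "r * s \<in> Tr m" using r s by (auto simp: Tr_def Hs_mult)
qed

lemma Tr_scale: "r \<in> Tr m \<Longrightarrow> a *s r \<in> Tr m"
  by (auto simp: Tr_def Hs_scale scale_mult mult_scale)

lemma Tr_mono: "m \<le> l \<Longrightarrow> r \<in> Tr m \<Longrightarrow> r \<in> Tr l"
  by (auto simp: Tr_def intro: Hs_mono)

lemma Tr_Phi: "1 \<le> k \<Longrightarrow> Suc k = m \<Longrightarrow> m \<le> n \<Longrightarrow> Phi k \<in> Tr m"
  using CD_Phi_far[of k] by (auto simp: Tr_def intro: Hs_Phi)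

lemma Tr_z: assumes "r \<in> Tr m" "m < j" "j \<le> n" shows "z j * r = r * z j"
proof -
  have 1: "C j * r = r * C j" "D j * r = r * D j" using assms by (auto simp: Tr_def)
  show ?thesis
    by (simp only: z_def distrib_left distrib_right mult.assoc 1)
       (simp only: 1 mult.assoc[symmetric])
qed

lemma contents_bound:
  assumes "std ts" "c \<in> addable (shape ts)" "d \<in> addable (shape ts)" "c \<noteq> d"
  shows "c + d \<le> length ts"
  using addable_two[OF finite_shape assms(2-4)] sum_shape[OF assms(1)] by simp

text \<open>Contents addable to one shape are never adjacent, and the size bound carries this over
  to the eigenvalues; hence the intertwiner is invertible on such a pair.\<close>

lemma not_neighbours:
  assumes "std ts" "c \<in> addable (shape ts)" "d \<in> addable (shape ts)" "c \<noteq> d" "length ts + 2 \<le> n"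
  shows "zc d \<noteq> zc (Suc c)" "zc d \<noteq> zc (c - 1)" "zc c \<noteq> zc d"
proof -
  have b: "c + d \<le> length ts" using contents_bound assms by blast
  have s: "d \<noteq> Suc c" "c \<noteq> Suc d" using addable_not_Suc assms by blast+
  show "zc d \<noteq> zc (Suc c)" "zc c \<noteq> zc d" using zc_inj b s assms by auto
  show "zc d \<noteq> zc (c - 1)" using zc_inj[of d "c - 1"] b s assms by auto
qed

lemma zc_addable_inj:
  assumes "std ts" "c \<in> addable (shape ts)" "d \<in> addable (shape ts)" "c \<noteq> d" "length ts < n"
  shows "zc c \<noteq> zc d"
  using zc_inj[of c d] contents_bound[OF assms(1-4)] assms by auto

lemma swap_boxes:
  assumes "std ts" "c \<in> addable (shape ts)" "d \<in> addable (shape ts)" "c \<noteq> d" "k = Suc (length ts)" "k < n"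
  obtains b where "b \<noteq> 0" "\<And>x. x \<in> W (d # c # ts) \<Longrightarrow> Phi k * x \<in> W (c # d # ts) \<and> Phi k * (Phi k * x) = b *s x"
proof
  \<comment> \<open>The scalar by which the square of \<open>Phi k\<close> acts, by
    \<open>Phi_Phi_apply\<close>.\<close>
  let ?b = "- ((zc d - zc (Suc c)) * (zc d - zc (c - 1)))"
  show "?b \<noteq> 0" using not_neighbours[OF assms(1-4)] assms(5,6) by auto
  fix x assume x: "x \<in> W (d # c # ts)"
  then have xc: "x \<in> W (c # ts)" and v: "z (Suc k) * x = zc d *s x" using assms by auto
  have "Phi k * x \<in> W (c # d # ts)"
    using Phi_weight[OF assms(5,6) xc] v assms(5) by (simp add: mult_scale)
  moreover have "Phi k * (Phi k * x) = ?b *s x"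
    unfolding Phi_Phi_apply[OF assms(5,6) xc] lins_eigen[OF v] by simp
  ultimately show "Phi k * x \<in> W (c # d # ts) \<and> Phi k * (Phi k * x) = ?b *s x" by simp
qed

text \<open>A left inverse is enough: vectors are moved to \<open>W ds\<close>, and what is found
  out about them there is brought back.\<close>

definition conn :: "nat list \<Rightarrow> nat list \<Rightarrow> bool"
  where "conn cs ds \<longleftrightarrow> length cs = length ds \<and> (\<exists>r\<in>Tr (length cs). \<exists>r'\<in>Tr (length cs).
    \<forall>x\<in>W cs. r * x \<in> W ds \<and> r' * (r * x) = x)"

lemma conn_refl: "conn cs cs"
  unfolding conn_def by (auto intro!: bexI[OF _ Tr_e] simp: W_e)

lemma conn_trans: assumes "conn cs ds" "conn ds ts" shows "conn cs ts"
proof -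
  obtain r r' where r: "r \<in> Tr (length cs)" "r' \<in> Tr (length cs)"
    "\<And>x. x \<in> W cs \<Longrightarrow> r * x \<in> W ds \<and> r' * (r * x) = x" "length cs = length ds"
    using assms(1) by (auto simp: conn_def)
  obtain s s' where s: "s \<in> Tr (length cs)" "s' \<in> Tr (length cs)"
    "\<And>x. x \<in> W ds \<Longrightarrow> s * x \<in> W ts \<and> s' * (s * x) = x" "length ds = length ts"
    using assms(2) r(4) by (auto simp: conn_def)
  show ?thesis unfolding conn_def
    by (rule conjI, use r s in simp, rule bexI[OF _ Tr_mult[OF s(1) r(1)]], rule bexI[OF _ Tr_mult[OF r(2) s(2)]])
      (use r s in \<open>auto simp: mult.assoc\<close>)
qed

lemma conn_Cons: assumes "conn cs ds" "length cs < n" shows "conn (c # cs) (c # ds)"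
proof -
  obtain r r' where r: "r \<in> Tr (length cs)" "r' \<in> Tr (length cs)"
    "\<And>x. x \<in> W cs \<Longrightarrow> r * x \<in> W ds \<and> r' * (r * x) = x" "length cs = length ds"
    using assms(1) by (auto simp: conn_def)
  have zr: "z (Suc (length cs)) * (r * x) = r * (z (Suc (length cs)) * x)" for x
    using Tr_z[OF r(1), of "Suc (length cs)"] assms(2) by (simp add: mult.assoc[symmetric])
  have r2: "r \<in> Tr (length (c # cs))" "r' \<in> Tr (length (c # cs))"
    using r Tr_mono[of "length cs" "length (c # cs)"] by auto
  show ?thesis unfolding conn_def
    by (rule conjI, use r in simp, rule bexI[OF _ r2(1)], rule bexI[OF _ r2(2)])
      (use r zr in \<open>auto simp: mult_scale\<close>)
qed

lemma conn_swap:
  assumes "std ts" "c \<in> addable (shape ts)" "d \<in> addable (shape ts)" "c \<noteq> d" "length ts + 2 \<le> n"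
  shows "conn (d # c # ts) (c # d # ts)"
proof -
  let ?k = "Suc (length ts)"
  have k: "?k < n" using assms by simp
  obtain b where b: "b \<noteq> 0"
    "\<And>x. x \<in> W (d # c # ts) \<Longrightarrow> Phi ?k * x \<in> W (c # d # ts) \<and> Phi ?k * (Phi ?k * x) = b *s x"
    using swap_boxes[OF assms(1-4) refl k] by blast
  have P: "Phi ?k \<in> Tr (length (d # c # ts))" using Tr_Phi[of ?k] assms(5) by simp
  show ?thesis unfolding conn_def
    by (rule conjI, simp, rule bexI[OF _ P], rule bexI[OF _ Tr_scale[OF P, of "inverse b"]])
      (use b in \<open>auto simp: scale_mult\<close>)
qed

text \<open>Equal last boxes are stripped. If they differ, the induction hypothesis brings both
  tableaux to the form provided by \<open>two_removable\<close>, where one intertwiner exchanges the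
  last two boxes.\<close>

lemma transport: "std cs \<Longrightarrow> std ds \<Longrightarrow> shape cs = shape ds \<Longrightarrow> length cs \<le> n \<Longrightarrow> conn cs ds"
proof (induction "length cs" arbitrary: cs ds rule: less_induct)
  case less
  have len: "length cs = length ds" using sum_shape less.prems by metis
  show ?case
  proof (cases cs)
    case Nil
    then show ?thesis using len conn_refl by simp
  next
    case (Cons c cs1)
    then obtain d ds1 where ds: "ds = d # ds1" using len by (cases ds) auto
    have IH: "conn as bs" if "std as" "std bs" "shape as = shape bs" "length as = length cs1" for as bs
      using less.hyps[of as bs] less.prems that Cons by auto
    show ?thesis
    proof (cases "c = d")
      case True
      then have "shape cs1 = shape ds1"
        using add_box_inject less.prems zero_notin_shape unfolding Cons ds by (metis shape.simps(2) std.simps(2))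
      then have "conn cs1 ds1" using IH less.prems Cons ds by auto
      then show ?thesis unfolding Cons ds True by (rule conn_Cons) (use less.prems Cons in auto)
    next
      case False
      obtain ts where ts: "std ts" "c \<in> addable (shape ts)" "d \<in> addable (shape ts)"
          "shape cs1 = add_box d (shape ts)" "shape ds1 = add_box c (shape ts)"
        using two_removable less.prems False unfolding Cons ds by metis
      have l: "length cs1 = Suc (length ts)" "length ds1 = Suc (length ts)"
        using sum_shape[of cs1] sum_shape[of "d # ts"] ts less.prems Cons len ds by auto
      have 1: "conn cs1 (d # ts)" by (rule IH) (use ts l less.prems Cons in auto)
      have 2: "conn (c # ts) ds1" by (rule IH) (use ts l less.prems ds in auto)
      have "conn (c # cs1) (c # d # ts)" by (rule conn_Cons[OF 1]) (use less.prems Cons in auto)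
      moreover have "conn (c # d # ts) (d # c # ts)"
        by (rule conn_swap) (use ts False l less.prems Cons in auto)
      moreover have "conn (d # c # ts) (d # ds1)" by (rule conn_Cons[OF 2]) (use less.prems Cons l in auto)
      ultimately show ?thesis unfolding Cons ds using conn_trans by blast
    qed
  qed
qed

section \<open>Three consecutive boxes\<close>

lemma sum_sq:
  assumes "p * (p * x) = 2 *s x" "s * (s * x) = 2 *s x" "s * (p * x) = - (2 *s x) - p * (s * x)"
  shows "(p + s) * ((p + s) * x) = 2 *s x"
  using assms by (simp add: distrib_left distrib_right)

lemma sum_anti:
  assumes "r1 * (p1 * x) = (a + b) *s x - p1 * (r1 * x)" "r2 * (p2 * x) = b *s x + w * x - p2 * (r2 * x)"
    "r2 * (p1 * x) = - (b *s x) - p1 * (r2 * x)" "p2 * (r1 * x) = - (b *s x) - r1 * (p2 * x)"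
  shows "(r1 + r2) * ((p1 + p2) * x) = a *s x + w * x - (p1 + p2) * ((r1 + r2) * x)"
  using assms by (simp add: distrib_left distrib_right scale_left_distrib)

context
  fixes i :: nat and ts :: "nat list" and ca cb :: nat and U :: "'r set"
  assumes i: "i = Suc (length ts)" "i + 2 \<le> n"
    and ne: "zc ca \<noteq> zc cb"
    and U: "subspace U" "U \<subseteq> W (cb # ca # ts)"
    and UC: "\<And>j y. y \<in> U \<Longrightarrow> i \<le> j \<Longrightarrow> j \<le> i + 2 \<Longrightarrow> C j * y \<in> U"
    and UD: "\<And>j y. y \<in> U \<Longrightarrow> i \<le> j \<Longrightarrow> j \<le> i + 2 \<Longrightarrow> D j * y \<in> U"
    and P1: "\<And>y. y \<in> U \<Longrightarrow> Phi i * y = 0" and P2: "\<And>y. y \<in> U \<Longrightarrow> Phi (Suc i) * y = 0"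
begin

abbreviation (input) "\<alpha> \<equiv> zc ca"
abbreviation (input) "\<beta> \<equiv> zc cb"
abbreviation (input) "\<omega> \<equiv> z (Suc (Suc i))"
abbreviation (input) "c1 \<equiv> C i - C (Suc i)"
abbreviation (input) "d1 \<equiv> D i - D (Suc i)"
abbreviation (input) "c2 \<equiv> C (Suc i) - C (Suc (Suc i))"
abbreviation (input) "d2 \<equiv> D (Suc i) - D (Suc (Suc i))"

lemma i_range: "1 \<le> i" "i < n" "1 \<le> Suc i" "Suc i < n" using i by auto

lemma U_w: "y \<in> U \<Longrightarrow> \<omega> * y \<in> U"
  unfolding z_def distrib_right mult.assoc by (intro subspace_add[OF U(1)] UC UD) auto

lemma U_z: "y \<in> U \<Longrightarrow> z i * y = \<alpha> *s y" "y \<in> U \<Longrightarrow> z (Suc i) * y = \<beta> *s y" "y \<in> U \<Longrightarrow> e * y = y"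
  using U(2) i W_e by (auto simp: subset_iff)

lemma U_c: "y \<in> U \<Longrightarrow> c1 * y \<in> U" "y \<in> U \<Longrightarrow> d1 * y \<in> U" "y \<in> U \<Longrightarrow> c2 * y \<in> U" "y \<in> U \<Longrightarrow> d2 * y \<in> U"
  unfolding left_diff_distrib by (auto intro!: subspace_diff[OF U(1)] UC UD)

lemma U_rules:
  assumes "y \<in> U"
  shows "c1 * (c1 * y) = 2 *s y" "d1 * (d1 * y) = 2 *s y" "c2 * (c2 * y) = 2 *s y" "d2 * (d2 * y) = 2 *s y"
    "d1 * (c1 * y) = (\<alpha> + \<beta>) *s y - c1 * (d1 * y)"
    "d2 * (c2 * y) = \<beta> *s y + \<omega> * y - c2 * (d2 * y)"
    "c2 * (c1 * y) = - (2 *s y) - c1 * (c2 * y)"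
    "d2 * (d1 * y) = - (2 *s y) - d1 * (d2 * y)"
    "d2 * (c1 * y) = - (\<beta> *s y) - c1 * (d2 * y)"
    "c2 * (d1 * y) = - (\<beta> *s y) - d1 * (c2 * y)"
proof -
  note r = i_range and y = U_z[OF assms]
  have gy: "g i * y = c1 * (d1 * y)" "g (Suc i) * y = c2 * (d2 * y)" by (simp_all add: g_def mult.assoc)
  have app: "A * (B * y) = X * y" if "A * B = X" for A B X :: 'r using that by (rule assoc_vec)
  show "c1 * (c1 * y) = 2 *s y" "d1 * (d1 * y) = 2 *s y" "c2 * (c2 * y) = 2 *s y" "d2 * (d2 * y) = 2 *s y"
    using y by (simp_all only: app[OF c_c[OF r(1,2)]] app[OF d_d[OF r(1,2)]] app[OF c_c[OF r(3,4)]] app[OF d_d[OF r(3,4)]] scale_mult)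
  show "d1 * (c1 * y) = (\<alpha> + \<beta>) *s y - c1 * (d1 * y)"
    by (simp only: app[OF d_c[OF r(1,2)]] left_diff_distrib[of "z i + z (Suc i)" "g i"]
      distrib_right[of "z i" "z (Suc i)"] y gy scale_left_distrib)
  show "d2 * (c2 * y) = \<beta> *s y + \<omega> * y - c2 * (d2 * y)"
    by (simp only: app[OF d_c[OF r(3,4)]] left_diff_distrib[of "z (Suc i) + \<omega>" "g (Suc i)"]
      distrib_right[of "z (Suc i)" \<omega>] y gy scale_left_distrib)
  have C: "C j * C k = - (C k * C j)" "D j * D k = - (D k * D j)" "D j * C k = - (C k * D j)"
    if "k < j" "i \<le> k" "j \<le> i + 2" for j k
    using C_anti[of j k] D_anti[of j k] C_D[of k j] that r i by auto
  have Cj: "C (Suc i) * C (Suc i) = e" "D (Suc i) * D (Suc i) = e"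
    using CC[of "Suc i"] D_D_eq[of "Suc i"] r by auto
  have A: "C (Suc i) * C i = - (C i * C (Suc i))" "C (Suc (Suc i)) * C i = - (C i * C (Suc (Suc i)))"
     "C (Suc (Suc i)) * C (Suc i) = - (C (Suc i) * C (Suc (Suc i)))"
     "D (Suc i) * D i = - (D i * D (Suc i))" "D (Suc (Suc i)) * D i = - (D i * D (Suc (Suc i)))"
     "D (Suc (Suc i)) * D (Suc i) = - (D (Suc i) * D (Suc (Suc i)))"
     "D (Suc i) * C i = - (C i * D (Suc i))" "D (Suc (Suc i)) * C i = - (C i * D (Suc (Suc i)))"
     "D (Suc (Suc i)) * C (Suc i) = - (C (Suc i) * D (Suc (Suc i)))"
     using C[of i "Suc i"] C[of i "Suc (Suc i)"] C[of "Suc i" "Suc (Suc i)"] by simp_all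
  have A': "D i * C (Suc i) = - (C (Suc i) * D i)" "D i * C (Suc (Suc i)) = - (C (Suc (Suc i)) * D i)"
    "D (Suc i) * C (Suc (Suc i)) = - (C (Suc (Suc i)) * D (Suc i))"
    using C_D[of "Suc i" i] C_D[of "Suc (Suc i)" i] C_D[of "Suc (Suc i)" "Suc i"] r i by auto
  have h: "c2 * c1 = - (2 *s e) - c1 * c2"
    by (simp add: algebra_simps scale2 A Cj)
  show "c2 * (c1 * y) = - (2 *s y) - c1 * (c2 * y)"
    by (simp only: app[OF h] left_diff_distrib[of _ "c1 * c2"] left_diff_distrib[of _ "d1 * d2"]
      left_diff_distrib[of _ "c1 * d2"] left_diff_distrib[of _ "d1 * c2"] mult_minus_left scale_mult mult.assoc y)
  have h: "d2 * d1 = - (2 *s e) - d1 * d2"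
    by (simp add: algebra_simps scale2 A Cj)
  show "d2 * (d1 * y) = - (2 *s y) - d1 * (d2 * y)"
    by (simp only: app[OF h] left_diff_distrib[of _ "c1 * c2"] left_diff_distrib[of _ "d1 * d2"]
      left_diff_distrib[of _ "c1 * d2"] left_diff_distrib[of _ "d1 * c2"] mult_minus_left scale_mult mult.assoc y)
  have h: "d2 * c1 = - z (Suc i) - c1 * d2"
    by (simp add: algebra_simps z_def A)
  show "d2 * (c1 * y) = - (\<beta> *s y) - c1 * (d2 * y)"
    by (simp only: app[OF h] left_diff_distrib[of _ "c1 * c2"] left_diff_distrib[of _ "d1 * d2"]
      left_diff_distrib[of _ "c1 * d2"] left_diff_distrib[of _ "d1 * c2"] mult_minus_left scale_mult mult.assoc y)
  have h: "c2 * d1 = - z (Suc i) - d1 * c2"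
    by (simp add: algebra_simps z_def A')
  show "c2 * (d1 * y) = - (\<beta> *s y) - d1 * (c2 * y)"
    by (simp only: app[OF h] left_diff_distrib[of _ "c1 * c2"] left_diff_distrib[of _ "d1 * d2"]
      left_diff_distrib[of _ "c1 * d2"] left_diff_distrib[of _ "d1 * c2"] mult_minus_left scale_mult mult.assoc y)
qed

lemma w_comm: "\<omega> * (c1 * y) = c1 * (\<omega> * y)" "\<omega> * (d1 * y) = d1 * (\<omega> * y)"
    "\<omega> * (c2 * y) = c2 * (\<omega> * y)" "\<omega> * (d2 * y) = d2 * (\<omega> * y)"
proof -
  have 1: "\<omega> * (C j * y) = C j * (\<omega> * y)" "\<omega> * (D j * y) = D j * (\<omega> * y)" if "i \<le> j" "j \<le> i + 2" for j
  proof -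
    have h: "\<omega> * C j = C j * \<omega>" "\<omega> * D j = D j * \<omega>"
      using C_z[of j "Suc (Suc i)"] D_z[of j "Suc (Suc i)"] that i by auto
    show "\<omega> * (C j * y) = C j * (\<omega> * y)" "\<omega> * (D j * y) = D j * (\<omega> * y)"
      by (simp_all only: assoc_vec[OF h(1)] assoc_vec[OF h(2)] mult.assoc)
  qed
  show "\<omega> * (c1 * y) = c1 * (\<omega> * y)" "\<omega> * (d1 * y) = d1 * (\<omega> * y)"
    "\<omega> * (c2 * y) = c2 * (\<omega> * y)" "\<omega> * (d2 * y) = d2 * (\<omega> * y)"
    by (simp_all only: left_diff_distrib right_diff_distrib) (simp_all add: 1)
qed

text \<open>\<open>c1 + c2\<close> telescopes to \<open>C i - C (Suc (Suc i))\<close>, and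
  \<open>d1 + d2\<close> likewise, so the first term is the analogue of \<open>g\<close> for the
  letters \<open>i\<close> and \<open>i + 2\<close>.\<close>

definition "H13 y = (c1 + c2) * ((d1 + d2) * y) - \<alpha> *s y"

text \<open>As both intertwiners vanish on \<open>U\<close>, \<open>T i\<close> acts there as a
  multiple of \<open>G1\<close>, and \<open>T (Suc i)\<close> acts as a multiple of
  \<open>G2\<close> after \<open>\<beta> - \<omega>\<close>. The braid relation thereby becomes a
  relation in the Clifford algebra.\<close>

lemma three_boxes:
  assumes x: "x \<in> U"
  shows "(8*\<beta> - \<beta>*\<beta>*\<beta> - 4*\<alpha>) *s H13 x + (\<alpha>*\<beta> - 4) *s H13 (\<omega> * x) = 0"
proof -
  note r = i_range
  define G1 G2 where "G1 = (\<lambda>y. \<alpha> *s y - c1 * (d1 * y))" and "G2 = (\<lambda>y. \<beta> *s y - c2 * (d2 * y))"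
  have GU: "G1 y \<in> U" "G2 y \<in> U" if "y \<in> U" for y
    unfolding G1_def G2_def by (intro subspace_diff[OF U(1)] subspace_scale[OF U(1)] U_c that)+
  have T1: "(\<alpha> - \<beta>) *s (T i * y) = eps *s G1 y" if "y \<in> U" for y
  proof -
    have "y \<in> W (ca # ts)" using U(2) that by auto
    moreover have "g i * y = c1 * (d1 * y)" by (simp add: g_def mult.assoc)
    ultimately have "Phi i * y = T i * (\<alpha> *s y - z (Suc i) * y) - eps *s (\<alpha> *s y - c1 * (d1 * y))"
      using Phi_apply[of i ts y ca] i by simp
    then show ?thesis using P1[OF that] U_z(2)[OF that]
      unfolding G1_def by (simp only: right_diff_distrib[of "T i"] mult_scale scale_left_diff_distrib) simp
  qed
  have T2: "T (Suc i) * (\<beta> *s y - \<omega> * y) = eps *s G2 y" if "y \<in> U" for y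
  proof -
    have "y \<in> W (cb # ca # ts)" using U(2) that by auto
    moreover have "g (Suc i) * y = c2 * (d2 * y)" by (simp add: g_def mult.assoc)
    ultimately have "Phi (Suc i) * y = T (Suc i) * (\<beta> *s y - \<omega> * y) - eps *s (\<beta> *s y - c2 * (d2 * y))"
      using Phi_apply[of "Suc i" "ca # ts" y cb] i by simp
    then show ?thesis using P2[OF that] unfolding G2_def by simp
  qed
  have Gl: "G1 (\<beta> *s y - \<omega> * y) = \<beta> *s G1 y - \<omega> * G1 y" "G2 (\<beta> *s y - \<omega> * y) = \<beta> *s G2 y - \<omega> * G2 y" for y
  proof -
    have lin: "k *s (\<beta> *s y - \<omega> * y) - (\<beta> *s X - \<omega> * X) = \<beta> *s (k *s y - X) - \<omega> * (k *s y - X)" for X k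
      by (simp add: right_diff_distrib mult_scale scale_right_diff_distrib mult.commute)
    have 1: "c1 * (d1 * (\<beta> *s y - \<omega> * y)) = \<beta> *s (c1 * (d1 * y)) - \<omega> * (c1 * (d1 * y))"
      "c2 * (d2 * (\<beta> *s y - \<omega> * y)) = \<beta> *s (c2 * (d2 * y)) - \<omega> * (c2 * (d2 * y))"
      by (simp_all only: right_diff_distrib mult_scale w_comm)
    show "G1 (\<beta> *s y - \<omega> * y) = \<beta> *s G1 y - \<omega> * G1 y" unfolding G1_def 1 by (rule lin)
    show "G2 (\<beta> *s y - \<omega> * y) = \<beta> *s G2 y - \<omega> * G2 y" unfolding G2_def 1 by (rule lin)
  qed
  define y1 where "y1 = \<beta> *s x - \<omega> * x"
  \<comment> \<open>Two factors \<open>\<beta> - \<omega>\<close>: one side of the braid relation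
    contains \<open>T (Suc i)\<close> twice, and each occurrence is known only behind such a factor,
    which cannot be divided out since \<open>\<omega>\<close> need not act as a scalar.\<close>
  define y2 where "y2 = \<beta> *s y1 - \<omega> * y1"
  have y1: "y1 \<in> U" unfolding y1_def by (intro subspace_diff[OF U(1)] subspace_scale[OF U(1)] U_w x)
  have y2: "y2 \<in> U" unfolding y2_def by (intro subspace_diff[OF U(1)] subspace_scale[OF U(1)] U_w y1)
  have Gy: "G1 y2 = \<beta> *s G1 y1 - \<omega> * G1 y1" "G1 (G2 y1) = \<beta> *s G1 (G2 x) - \<omega> * G1 (G2 x)"
     "G1 (G2 (G1 y1)) = \<beta> *s G1 (G2 (G1 x)) - \<omega> * G1 (G2 (G1 x))"
    unfolding y2_def y1_def by (simp_all only: Gl)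
  have "(\<alpha> - \<beta>) *s (T i * (T (Suc i) * (T i * y2))) = T i * (T (Suc i) * ((\<alpha> - \<beta>) *s (T i * y2)))"
    by (simp only: mult_scale)
  also have "\<dots> = eps *s (T i * (T (Suc i) * G1 y2))"
    by (simp only: T1[OF y2] mult_scale)
  also have "T (Suc i) * G1 y2 = eps *s G2 (G1 y1)" unfolding Gy(1) by (rule T2[OF GU(1)[OF y1]])
  finally have "(\<alpha> - \<beta>) *s ((\<alpha> - \<beta>) *s (T i * (T (Suc i) * (T i * y2)))) = (eps * eps) *s ((\<alpha> - \<beta>) *s (T i * G2 (G1 y1)))"
    by (simp add: mult_scale mult_ac)
  also have "(\<alpha> - \<beta>) *s (T i * G2 (G1 y1)) = eps *s G1 (G2 (G1 y1))" using T1 GU y1 by blast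
  finally have L: "(\<alpha> - \<beta>) *s ((\<alpha> - \<beta>) *s (T i * (T (Suc i) * (T i * y2)))) = (eps * eps * eps) *s G1 (G2 (G1 y1))" by simp
  have "T (Suc i) * y2 = eps *s G2 y1" unfolding y2_def by (rule T2[OF y1])
  then have "(\<alpha> - \<beta>) *s (T (Suc i) * (T i * (T (Suc i) * y2))) = eps *s (T (Suc i) * ((\<alpha> - \<beta>) *s (T i * G2 y1)))"
    by (simp add: mult_scale mult_ac)
  also have "(\<alpha> - \<beta>) *s (T i * G2 y1) = eps *s G1 (G2 y1)" using T1 GU y1 by blast
  also have "eps *s (T (Suc i) * (eps *s G1 (G2 y1))) = (eps * eps) *s (T (Suc i) * G1 (G2 y1))"
    by (simp add: mult_scale)
  also have "T (Suc i) * G1 (G2 y1) = eps *s G2 (G1 (G2 x))" unfolding Gy(2) using T2 GU x by blast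
  finally have R: "(\<alpha> - \<beta>) *s (T (Suc i) * (T i * (T (Suc i) * y2))) = (eps * eps * eps) *s G2 (G1 (G2 x))" by simp
  have "T i * (T (Suc i) * (T i * y2)) = T (Suc i) * (T i * (T (Suc i) * y2))"
    using braid[of i] r by (simp add: mult.assoc[symmetric])
  then have "(eps * eps * eps) *s G1 (G2 (G1 y1)) = (eps * eps * eps) *s ((\<alpha> - \<beta>) *s G2 (G1 (G2 x)))"
    using L R by (simp add: mult_ac)
  then have "G1 (G2 (G1 y1)) = (\<alpha> - \<beta>) *s G2 (G1 (G2 x))"
    by (rule scale_left_imp_eq[rotated]) (simp add: eps_nz)
  then have "\<beta> *s G1 (G2 (G1 x)) - \<omega> * G1 (G2 (G1 x)) - (\<alpha> - \<beta>) *s G2 (G1 (G2 x)) = 0"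
    unfolding Gy(3) by simp
  moreover have "\<beta> *s G1 (G2 (G1 x)) - \<omega> * G1 (G2 (G1 x)) - (\<alpha> - \<beta>) *s G2 (G1 (G2 x))
      = (8*\<beta> - \<beta>*\<beta>*\<beta> - 4*\<alpha>) *s H13 x + (\<alpha>*\<beta> - 4) *s H13 (\<omega> * x)"
    by (rule clifford_braid[where V = U and ?c1.0 = c1 and ?d1.0 = d1 and ?c2.0 = c2 and ?d2.0 = d2])
      (use x U_c U_w U_rules w_comm in \<open>auto simp: G1_def G2_def H13_def\<close>)
  ultimately show ?thesis by simp
qed

text \<open>With \<open>c = c1 + c2\<close> and \<open>d = d1 + d2\<close> the hypothesis says that
  \<open>c * d\<close> acts on \<open>y\<close> by \<open>\<alpha>\<close>. Computing
  \<open>c * d * c * d\<close> also by exchanging the inner \<open>d * c\<close>, with squares 2,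
  gives \<open>\<alpha>\<^sup>2 = 2 * \<alpha>\<^sup>2 - 4\<close>.\<close>

lemma H13_zero:
  assumes y: "y \<in> U" "\<omega> * y = \<alpha> *s y" "H13 y = 0" and a4: "\<alpha> * \<alpha> \<noteq> 4"
  shows "y = 0"
proof -
  define c d where "c = c1 + c2" and "d = d1 + d2"
  have cc: "c * (c * x) = 2 *s x" and dd: "d * (d * x) = 2 *s x"
    and dc: "d * (c * x) = \<alpha> *s x + \<omega> * x - c * (d * x)" if "x \<in> U" for x
  proof -
    show "c * (c * x) = 2 *s x" unfolding c_def by (rule sum_sq; rule U_rules[OF that])
    show "d * (d * x) = 2 *s x" unfolding d_def by (rule sum_sq; rule U_rules[OF that])
    show "d * (c * x) = \<alpha> *s x + \<omega> * x - c * (d * x)"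
      unfolding c_def d_def by (rule sum_anti; rule U_rules[OF that])
  qed
  have dU: "d * y \<in> U" unfolding d_def distrib_right by (intro subspace_add[OF U(1)] U_c y)
  have wd: "\<omega> * (d * y) = \<alpha> *s (d * y)"
    unfolding d_def distrib_right distrib_left w_comm y(2) by (simp only: mult_scale scale_right_distrib)
  have cd: "c * (d * y) = \<alpha> *s y" using y(3) unfolding H13_def c_def d_def by simp
  have "c * (d * (c * (d * y))) = \<alpha> *s (\<alpha> *s y)" unfolding cd mult_scale ..
  moreover have "d * (c * (d * y)) = \<alpha> *s (d * y) + \<alpha> *s (d * y) - c * (2 *s y)"
    unfolding dc[OF dU] wd dd[OF y(1)] ..
  ultimately have "\<alpha> *s (\<alpha> *s y) = c * (\<alpha> *s (d * y) + \<alpha> *s (d * y) - c * (2 *s y))" by simp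
  also have "\<dots> = \<alpha> *s (\<alpha> *s y) + \<alpha> *s (\<alpha> *s y) - 2 *s (2 *s y)"
    by (simp only: distrib_left right_diff_distrib mult_scale cd cc[OF y(1)])
  finally have "(\<alpha> * \<alpha> - 4) *s y = 0" by (simp add: scale_left_diff_distrib)
  then show ?thesis using a4 by simp
qed

lemma H13_scale: "H13 (k *s y) = k *s H13 y"
  by (simp add: H13_def mult_scale scale_right_diff_distrib mult.commute)

lemma H13_add: "H13 (x + y) = H13 x + H13 y"
  unfolding H13_def by (simp only: distrib_left scale_right_distrib) simp

lemma kappa_factor: "8*\<beta> - \<beta>*\<beta>*\<beta> - 4*\<alpha> + (\<alpha>*\<beta> - 4) * \<alpha> = (\<beta> - \<alpha>) * (8 - \<beta>*\<beta> - \<alpha>*\<beta>)"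
  by (simp add: algebra_simps)

text \<open>Once \<open>\<omega>\<close> acts by \<open>\<alpha>\<close>, the two coefficients in
  \<open>three_boxes\<close> add up to the product in \<open>kappa_factor\<close>.\<close>

lemma three_boxes_eigen:
  assumes x: "x \<in> U" "\<omega> * x = \<alpha> *s x" and K: "8 - \<beta>*\<beta> - \<alpha>*\<beta> \<noteq> 0"
  shows "H13 x = 0"
proof -
  have "(8*\<beta> - \<beta>*\<beta>*\<beta> - 4*\<alpha> + (\<alpha>*\<beta> - 4) * \<alpha>) *s H13 x = 0"
    using three_boxes[OF x(1)] x(2) by (simp add: H13_scale scale_left_distrib)
  then show ?thesis unfolding kappa_factor using ne K by simp
qed

text \<open>The nilpotent part \<open>y\<close> satisfies \<open>H13 y = 0\<close>. If the factor in
  \<open>three_boxes_eigen\<close> is nonzero, that lemma gives it; if the factor vanishes,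
  \<open>three_boxes\<close> for \<open>x\<close> retains only the term
  \<open>(\<alpha>*\<beta> - 4) *s H13 y\<close>.\<close>

lemma three_boxes_semisimple:
  assumes x: "x \<in> U" "\<omega> * (\<omega> * x - \<alpha> *s x) = \<alpha> *s (\<omega> * x - \<alpha> *s x)"
    and a4: "\<alpha> * \<alpha> \<noteq> 4" "\<alpha> * \<beta> \<noteq> 4"
  shows "\<omega> * x = \<alpha> *s x"
proof -
  define y where "y = \<omega> * x - \<alpha> *s x"
  have y: "y \<in> U" unfolding y_def by (intro subspace_diff[OF U(1)] subspace_scale[OF U(1)] U_w x)
  have wx: "\<omega> * x = y + \<alpha> *s x" by (simp add: y_def)
  have wy: "\<omega> * y = \<alpha> *s y" using x(2) by (simp add: y_def)
  have "H13 y = 0"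
  proof (cases "8 - \<beta>*\<beta> - \<alpha>*\<beta> = 0")
    case True
    have "(8*\<beta> - \<beta>*\<beta>*\<beta> - 4*\<alpha> + (\<alpha>*\<beta> - 4) * \<alpha>) *s H13 x + (\<alpha>*\<beta> - 4) *s H13 y = 0"
      using three_boxes[OF x(1)] unfolding wx H13_add H13_scale
      by (simp add: scale_left_distrib scale_right_distrib add_ac)
    then have "(\<alpha>*\<beta> - 4) *s H13 y = 0" unfolding kappa_factor True by simp
    then show ?thesis using a4 by simp
  qed (rule three_boxes_eigen[OF y wy])
  then have "y = 0" by (rule H13_zero[OF y wy _ a4(1)])
  then show ?thesis by (simp add: y_def)
qed

text \<open>By the identity at letter \<open>i\<close>, \<open>H13 x\<close> is
  \<open>- (c * N)\<close>; its vanishing kills \<open>N\<close>, as \<open>c\<close> has square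
  2.\<close>

lemma three_boxes_unip:
  assumes x: "x \<in> U" "\<omega> * x = \<alpha> *s x" "D i * x = C i * x" and \<alpha>: "\<alpha> = 2" and K: "8 - \<beta>*\<beta> - \<alpha>*\<beta> \<noteq> 0"
  shows "D (Suc (Suc i)) * x = C (Suc (Suc i)) * x"
proof -
  define c N where "c = c1 + c2" and "N = D (Suc (Suc i)) * x - C (Suc (Suc i)) * x"
  have cc: "c * (c * y) = 2 *s y" if "y \<in> U" for y
    unfolding c_def by (rule sum_sq; rule U_rules[OF that])
  have NU: "N \<in> U" unfolding N_def by (intro subspace_diff[OF U(1)] UC UD x) auto
  have "(d1 + d2) * x = c * x - N" using x(3) by (simp add: c_def N_def left_diff_distrib)
  then have "H13 x = c * (c * x - N) - 2 *s x" unfolding H13_def \<alpha> c_def by simp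
  also have "\<dots> = - (c * N)" by (simp add: right_diff_distrib cc[OF x(1)])
  finally have "c * N = 0" using three_boxes_eigen[OF x(1,2) K] by simp
  then have "2 *s N = 0" using cc[OF NU] by simp
  then have "N = 0" by (rule scale2_eq_0)
  then show ?thesis by (simp add: N_def)
qed

end
end

section \<open>The spectrum of the \<open>z k\<close>\<close>

context hecke_clifford_generic
begin

context
  fixes i :: nat and ts :: "nat list" and ca cb :: nat
  assumes i: "i = Suc (length ts)" "i + 2 \<le> n"
    and ne: "zc ca \<noteq> zc cb"
    and std: "std (ca # ts)"
    and sp: "spec ts" "unip ts" "spec (ca # ts)"
    and nadd: "\<And>c'. c' \<in> addable (shape ts) \<Longrightarrow> zc c' \<noteq> zc cb"
begin

text \<open>\<open>Phi i\<close> would move the eigenvalue of content \<open>cb\<close> to letter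
  \<open>i\<close>, where \<open>spec ts\<close> and \<open>nadd\<close> exclude it.\<close>

lemma Phi_kill_1: assumes "y \<in> W (cb # ca # ts)" shows "Phi i * y = 0"
proof (rule ccontr)
  assume 0: "Phi i * y \<noteq> 0"
  have y: "y \<in> W (ca # ts)" using assms by simp
  have k: "i < n" using i by simp
  have "z i * (Phi i * y) = zc cb *s (Phi i * y)"
    using Phi_weight(2)[OF i(1) k y] assms i by (simp add: mult_scale)
  then show False using spec_eigen[OF sp(1) Phi_weight(1)[OF i(1) k y] _ 0] nadd i by metis
qed

text \<open>The image is a generalised eigenvector at letter \<open>Suc i\<close>, hence a genuine
  one by \<open>spec\<close>. It then has the eigenvalue of content \<open>ca\<close> at two
  successive letters, against \<open>no_repeat\<close>.\<close>

lemma Phi_kill_2: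
  assumes "y \<in> W (cb # ca # ts)" "z (i + 2) * (z (i + 2) * y - zc ca *s y) = zc ca *s (z (i + 2) * y - zc ca *s y)"
  shows "Phi (Suc i) * y = 0"
proof -
  have k: "Suc i = Suc (length (ca # ts))" "Suc i < n" using i by auto
  define p where "p = Phi (Suc i) * y"
  have p: "p \<in> W (ca # ts)" and zp: "z (Suc i) * p = Phi (Suc i) * (z (i + 2) * y)"
    unfolding p_def using Phi_weight(1,2)[OF k assms(1)] by simp_all
  have q: "z (Suc i) * (Phi (Suc i) * x) = Phi (Suc i) * (z (i + 2) * x)" for x
    using z_Phi(1)[of "Suc i"] i by (simp add: mult.assoc[symmetric])
  have "z (Suc i) * p - zc ca *s p = Phi (Suc i) * (z (i + 2) * y - zc ca *s y)"
    unfolding zp by (simp add: p_def right_diff_distrib mult_scale)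
  then have "z (Suc i) * (z (Suc i) * p - zc ca *s p) = zc ca *s (z (Suc i) * p - zc ca *s p)"
    by (simp only: q assms(2) mult_scale)
  then have "z (Suc i) * p = zc ca *s p" using spec_semisimple[OF sp(3) p] i by simp
  then show ?thesis using no_repeat[OF i(1) _ std sp(1,2) p] i by (simp add: p_def)
qed

definition pattern_space where "pattern_space = {y \<in> W (cb # ca # ts). z (i + 2) * (z (i + 2) * y - zc ca *s y) = zc ca *s (z (i + 2) * y - zc ca *s y)}"

lemma len: "length (cb # ca # ts) \<le> n" using i by simp

lemma U_sub: "subspace pattern_space"
proof -
  have 1: "pattern_space = W (cb # ca # ts) \<inter> {y. z (i + 2) * (z (i + 2) * y - zc ca *s y) = zc ca *s (z (i + 2) * y - zc ca *s y)}"
    by (auto simp: pattern_space_def)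
  have f: "z (i + 2) * (x + y) - zc ca *s (x + y) = (z (i + 2) * x - zc ca *s x) + (z (i + 2) * y - zc ca *s y)"
    "z (i + 2) * (k *s x) - zc ca *s (k *s x) = k *s (z (i + 2) * x - zc ca *s x)" for x y k
    by (simp_all add: distrib_left mult_scale scale_right_distrib scale_right_diff_distrib mult.commute)
  have "subspace {y. z (i + 2) * (z (i + 2) * y - zc ca *s y) = zc ca *s (z (i + 2) * y - zc ca *s y)}"
    unfolding subspace_def
  proof (intro conjI ballI allI; (unfold mem_Collect_eq)?)
    show "z (i + 2) * (z (i + 2) * 0 - zc ca *s 0) = zc ca *s (z (i + 2) * 0 - zc ca *s 0)" by simp
    fix x assume x: "z (i + 2) * (z (i + 2) * x - zc ca *s x) = zc ca *s (z (i + 2) * x - zc ca *s x)"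
    show "z (i + 2) * (z (i + 2) * (x + y) - zc ca *s (x + y)) = zc ca *s (z (i + 2) * (x + y) - zc ca *s (x + y))"
      if y: "z (i + 2) * (z (i + 2) * y - zc ca *s y) = zc ca *s (z (i + 2) * y - zc ca *s y)" for y
      unfolding f(1) by (subst distrib_left, subst scale_right_distrib) (simp only: x y)
    show "z (i + 2) * (z (i + 2) * (k *s x) - zc ca *s (k *s x)) = zc ca *s (z (i + 2) * (k *s x) - zc ca *s (k *s x))" for k
      unfolding f(2) by (subst mult_scale, subst x) (rule scale_left_commute)
  qed
  then show ?thesis unfolding 1 by (intro subspace_inter W_subspace)
qed

lemma U_W: "pattern_space \<subseteq> W (cb # ca # ts)" by (auto simp: pattern_space_def)

lemma U_CD: assumes "y \<in> pattern_space" "i \<le> j" "j \<le> i + 2" shows "C j * y \<in> pattern_space" "D j * y \<in> pattern_space"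
proof -
  have y: "y \<in> W (cb # ca # ts)" using assms U_W by auto
  have j: "1 \<le> j" "j \<le> n" "1 \<le> i + 2" using assms i by auto
  have c: "z (i + 2) * (C j * x) = C j * (z (i + 2) * x)" "z (i + 2) * (D j * x) = D j * (z (i + 2) * x)" for x
    using C_z[OF j(1,2,3) i(2)] D_z[OF j(1,2,3) i(2)] by (simp_all add: mult.assoc[symmetric])
  have d: "C j * (z (i + 2) * y) - zc ca *s (C j * y) = C j * (z (i + 2) * y - zc ca *s y)"
    "D j * (z (i + 2) * y) - zc ca *s (D j * y) = D j * (z (i + 2) * y - zc ca *s y)"
    by (simp_all add: right_diff_distrib mult_scale)
  have E: "z (i + 2) * (z (i + 2) * y - zc ca *s y) = zc ca *s (z (i + 2) * y - zc ca *s y)"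
    using assms(1) by (simp add: pattern_space_def)
  have "z (i + 2) * (z (i + 2) * (C j * y) - zc ca *s (C j * y)) = zc ca *s (z (i + 2) * (C j * y) - zc ca *s (C j * y))"
    unfolding c(1) d(1) unfolding c(1) E mult_scale ..
  then show "C j * y \<in> pattern_space" using W_C[OF len j(1,2) y] unfolding pattern_space_def by blast
  have "z (i + 2) * (z (i + 2) * (D j * y) - zc ca *s (D j * y)) = zc ca *s (z (i + 2) * (D j * y) - zc ca *s (D j * y))"
    unfolding c(2) d(2) unfolding c(2) E mult_scale ..
  then show "D j * y \<in> pattern_space" using W_D[OF len j(1,2) y] unfolding pattern_space_def by blast
qed

lemma U_Phi: "y \<in> pattern_space \<Longrightarrow> Phi i * y = 0" "y \<in> pattern_space \<Longrightarrow> Phi (Suc i) * y = 0"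
  using Phi_kill_1 Phi_kill_2 by (auto simp: pattern_space_def)

lemmas U_facts = i ne U_sub U_W U_CD U_Phi

lemma pattern_contra:
  assumes "8 - zc cb * zc cb - zc ca * zc cb \<noteq> 0" "zc ca * zc ca \<noteq> 4"
    "y \<in> W (cb # ca # ts)" "z (i + 2) * y = zc ca *s y"
  shows "y = 0"
proof -
  have y: "y \<in> pattern_space" using assms by (simp add: pattern_space_def)
  have wy: "z (Suc (Suc i)) * y = zc ca *s y" using assms by simp
  show ?thesis
    by (rule H13_zero[OF U_facts y wy three_boxes_eigen[OF U_facts y wy assms(1)] assms(2)])
qed

lemma pattern_semisimple:
  assumes "zc ca * zc ca \<noteq> 4" "zc ca * zc cb \<noteq> 4"
    "y \<in> W (cb # ca # ts)" "z (i + 2) * (z (i + 2) * y - zc ca *s y) = zc ca *s (z (i + 2) * y - zc ca *s y)"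
  shows "z (i + 2) * y = zc ca *s y"
proof -
  have y: "y \<in> pattern_space" using assms by (simp add: pattern_space_def)
  show ?thesis using three_boxes_semisimple[OF U_facts y _ assms(1,2)] assms(4) by simp
qed

lemma pattern_unip:
  assumes "8 - zc cb * zc cb - zc ca * zc cb \<noteq> 0" "ca = 0"
    "y \<in> W (cb # ca # ts)" "z (i + 2) * y = zc ca *s y"
  shows "D (i + 2) * y = C (i + 2) * y"
proof -
  have y: "y \<in> pattern_space" using assms(3,4) by (simp add: pattern_space_def)
  have wy: "z (Suc (Suc i)) * y = zc ca *s y" using assms(4) by simp
  have "D i * y = C i * y" using sp(2) std assms(2,3) i by (auto simp: unip_def)
  then show ?thesis using three_boxes_unip[OF U_facts y wy _ _ assms(1)] assms(2) by (simp add: zc_0)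
qed

end

section \<open>The inductive step for \<open>spec\<close> and \<open>unip\<close>\<close>

context
  fixes c k :: nat and cs :: "nat list"
  assumes k: "k = Suc (length cs)" "k < n" and std: "std (c # cs)"
    and IH: "\<And>ds. std ds \<Longrightarrow> length ds < k \<Longrightarrow> spec ds \<and> unip ds"
begin

lemma stdcs: "std cs" "c \<in> addable (shape cs)" "spec cs" "unip cs"
  using std IH[of cs] k by auto

lemma sumcs: "x = 0 \<or> x \<in> shape cs \<Longrightarrow> y = 0 \<or> y \<in> shape cs \<Longrightarrow> x \<noteq> y \<Longrightarrow> x + y + 2 \<le> n"
  using sum_two_le[OF finite_shape[of cs], of x y] unfolding sum_shape[OF stdcs(1)] using k by linarith

lemma c_bound: "c + 2 \<le> n"
  using addable_le_sum[OF finite_shape stdcs(2)] sum_shape[OF stdcs(1)] k by simp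

text \<open>Rearranging the boxes before \<open>c\<close> by elements of \<open>Tr k\<close> leaves
  every statement about letter \<open>Suc k\<close> intact.\<close>

lemma move:
  assumes "std (b # ts)" "shape (b # ts) = shape cs"
  obtains r r' where "r \<in> Tr k" "r' \<in> Tr k" "Suc (length ts) = length cs"
    "\<And>x. x \<in> W (c # cs) \<Longrightarrow> r * x \<in> W (c # b # ts) \<and> r' * (r * x) = x"
proof -
  have 1: "conn cs (b # ts)" using transport[OF stdcs(1) assms(1)] assms(2) k by simp
  have 2: "conn (c # cs) (c # b # ts)" by (rule conn_Cons[OF 1]) (use k in simp)
  obtain r r' where r: "r \<in> Tr (length (c # cs))" "r' \<in> Tr (length (c # cs))"
    "\<forall>x\<in>W (c # cs). r * x \<in> W (c # b # ts) \<and> r' * (r * x) = x"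
    using 2 unfolding conn_def by blast
  have l: "length (c # cs) = k" using k by simp
  have "Suc (length ts) = length cs" using 1 unfolding conn_def by simp
  then show ?thesis using that[of r r'] r unfolding l by blast
qed

lemma no_rep: "y \<in> W (c # cs) \<Longrightarrow> z (Suc k) * y = zc c *s y \<Longrightarrow> y = 0"
  using no_repeat[OF k std stdcs(3,4)] by blast

lemma Phi_neighbour:
  assumes "y \<in> W (c # cs)" "z (Suc k) * y = b *s y" "y \<noteq> 0" "Phi k * y = 0"
  shows "b = zc (Suc c) \<or> b = zc (c - 1)"
proof -
  have "lins (z (Suc k)) [zc (Suc c), zc (c - 1)] y = 0"
    using Phi_Phi_apply[OF k assms(1)] assms(4) by simp
  then show ?thesis using eigen_in_list[OF _ assms(2,3)] by fastforce
qed

text \<open>Provides the hypothesis \<open>nadd\<close> for the pattern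
  \<open>b, b + 1, b\<close>.\<close>

lemma down_nadd:
  assumes "std (b # ts)" "b \<noteq> 0" "Suc (Suc (length ts)) < n" "c' \<in> addable (shape ts)"
  shows "zc c' \<noteq> zc (Suc b)"
proof (cases "c' = b")
  case True
  have "b \<le> length ts" using addable_le_sum[OF finite_shape, of b ts] sum_shape[of ts] assms by simp
  then show ?thesis using zc_Suc[of b] assms True by simp
next
  case False
  have "b + c' \<le> length ts" using contents_bound[of ts b c'] assms False by simp
  moreover have "c' \<noteq> Suc b" using addable_not_Suc[of b "shape ts" c'] assms by simp
  ultimately show ?thesis using zc_inj[of c' "Suc b"] assms by auto
qed

text \<open>If \<open>Phi k * y\<close> is nonzero, it shows the eigenvalue \<open>b\<close> one
  letter earlier. Otherwise \<open>b\<close> belongs to content \<open>c + 1\<close> or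
  \<open>c - 1\<close>, and where the shape forbids such a box, a box of that content can be moved
  directly before \<open>c\<close>, so that \<open>pattern_contra\<close> applies outside the
  exceptional case.\<close>

lemma eigen_addable:
  assumes y: "y \<in> W (c # cs)" "z (Suc k) * y = b *s y" "y \<noteq> 0"
  shows "\<exists>d\<in>addable (shape (c # cs)). b = zc d"
proof (cases "Phi k * y = 0")
  case False
  have "z k * (Phi k * y) = b *s (Phi k * y)" using Phi_weight(2)[OF k y(1)] y(2) by (simp add: mult_scale)
  then obtain d where d: "d \<in> addable (shape cs)" "b = zc d"
    using spec_eigen[OF stdcs(3) Phi_weight(1)[OF k y(1)] _ False] k by auto
  then have "d \<noteq> c" using no_rep y by auto
  then show ?thesis using d addable_add_box by auto
next
  case True
  consider "b = zc (Suc c)" "Suc (Suc c) \<notin> shape cs" | "b = zc (Suc c)" "Suc (Suc c) \<in> shape cs"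
    | a where "c = Suc a" "b = zc a"
    using Phi_neighbour[OF y True] no_rep[OF y(1)] y(2,3) by (cases c) auto
  then show ?thesis
  proof cases
    case 1
    then show ?thesis using addable_up by auto
  next
    \<comment> \<open>The row of length \<open>c + 2\<close> blocks a box of content
      \<open>c + 1\<close>. Its own last box has this content and can be moved before the box
      \<open>c\<close>, which gives the pattern \<open>c + 1, c, c + 1\<close>.\<close>
    case 2
    have nS: "Suc c \<notin> shape cs" using stdcs(2) by (auto simp: addable_def)
    obtain ts where ts: "std (Suc c # ts)" "shape (Suc c # ts) = shape cs"
      using rearrange_last[OF 2(2) nS stdcs(1)] by blast
    obtain r r' where r: "r \<in> Tr k" "Suc (length ts) = length cs"
      "\<And>x. x \<in> W (c # cs) \<Longrightarrow> r * x \<in> W (c # Suc c # ts) \<and> r' * (r * x) = x"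
      using move[OF ts] by metis
    have cts: "c = 0 \<or> c \<in> shape ts" using stdcs(2) unfolding ts(2)[symmetric] by (auto simp: addable_def add_box_def)
    have Sc: "Suc c \<in> shape ts" using ts(1) by (auto simp: addable_def)
    have zr: "z (Suc k) * (r * y) = zc (Suc c) *s (r * y)"
      using Tr_z[OF r(1), of "Suc k"] k y(2) 2(1) by (simp add: assoc_vec[of _ _ "r * z (Suc k)"] mult.assoc mult_scale)
    have "r * y = 0"
    proof (rule pattern_contra[of "Suc (length ts)" ts "Suc c" c])
      show "zc (Suc c) \<noteq> zc c" using zc_Suc[of c] c_bound by auto
      show "spec ts" "unip ts" "spec (Suc c # ts)" using IH[of ts] IH[of "Suc c # ts"] ts r k by auto
      show "zc c' \<noteq> zc c" if "c' \<in> addable (shape ts)" for c'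
      proof -
        have "c' \<noteq> c" using that Sc by (auto simp: addable_def)
        moreover have "c + c' \<le> length ts" using sum_two_le[OF finite_shape[of ts] cts, of c'] that sum_shape[of ts] ts \<open>c' \<noteq> c\<close>
          by (auto simp: addable_def)
        ultimately show ?thesis using zc_inj[of c' c] r k by auto
      qed
      have "c + Suc (Suc c) + 2 \<le> n" using sumcs[of c "Suc (Suc c)"] 2(2) stdcs(2) by (auto simp: addable_def)
      then show "8 - zc c * zc c - zc (Suc c) * zc c \<noteq> 0" using kappa_up[of c] by simp
      show "zc (Suc c) * zc (Suc c) \<noteq> 4" using zc_sq[of "Suc c"] c_bound by simp
      show "z (Suc (length ts) + 2) * (r * y) = zc (Suc c) *s (r * y)" using zr r k by simp
    qed (use ts r k y in auto)
    then show ?thesis using r(3)[OF y(1)] y(3) by simp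
  next
    case (3 a)
    show ?thesis
    proof (cases "a = 0 \<or> a \<in> shape cs")
      case True
      then show ?thesis using addable_down stdcs(2) 3 by auto
    next
      case a: False
      show ?thesis
      proof (cases "q ^ (2 * (2 * Suc a + 1)) = 1")
        \<comment> \<open>Here content \<open>a\<close> has the eigenvalue of content
          \<open>a + 2\<close>, and a box of content \<open>a + 2\<close> is addable by the size
          bound.\<close>
        case True
        then have "n < 2 * Suc a + 1" by (rule exceptional_large)
        then have "Suc (Suc c) \<notin> shape cs" using sumcs[of c "Suc (Suc c)"] stdcs(2) 3 by (auto simp: addable_def)
        then show ?thesis using addable_up[of c "shape cs"] exceptional_eq[OF True] 3
          by (intro bexI[of _ "Suc c"]) auto
      next
        \<comment> \<open>The last box of the row of length \<open>a + 1\<close> has content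
          \<open>a\<close>; moving it before the box \<open>c\<close> gives the pattern
          \<open>a, a + 1, a\<close>.\<close>
        case False
        have Sa: "Suc a \<in> shape cs" using stdcs(2) 3 by (auto simp: addable_def)
        obtain ts where ts: "std (a # ts)" "shape (a # ts) = shape cs"
          using rearrange_last[OF Sa _ stdcs(1)] a by blast
        obtain r r' where r: "r \<in> Tr k" "Suc (length ts) = length cs"
          "\<And>x. x \<in> W (c # cs) \<Longrightarrow> r * x \<in> W (c # a # ts) \<and> r' * (r * x) = x"
          using move[OF ts] by metis
        have zr: "z (Suc k) * (r * y) = zc a *s (r * y)"
          using Tr_z[OF r(1), of "Suc k"] k y(2) 3 by (simp add: assoc_vec[of _ _ "r * z (Suc k)"] mult.assoc mult_scale)
        have "r * y = 0"
        proof (rule pattern_contra[of "Suc (length ts)" ts a "Suc a"])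
          show "zc a \<noteq> zc (Suc a)" using zc_Suc[of a] c_bound 3 by auto
          show "spec ts" "unip ts" "spec (a # ts)" using IH[of ts] IH[of "a # ts"] ts r k by auto
          show "zc c' \<noteq> zc (Suc a)" if "c' \<in> addable (shape ts)" for c'
            using down_nadd[OF ts(1) _ _ that] a r k by auto
          show "8 - zc (Suc a) * zc (Suc a) - zc a * zc (Suc a) \<noteq> 0" using kappa_down[OF _ False] c_bound 3 by simp
          show "zc a * zc a \<noteq> 4" using zc_sq[of a] c_bound a 3 by simp
          show "z (Suc (length ts) + 2) * (r * y) = zc a *s (r * y)" using zr r k by simp
          show "r * y \<in> W (Suc a # a # ts)" using r(3)[OF y(1)] 3 by simp
        qed (use ts r k y in auto)
        then show ?thesis using r(3)[OF y(1)] y(3) by simp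
      qed
    qed
  qed
qed

text \<open>\<open>Phi k\<close> takes a Jordan block to letter \<open>k\<close>, where there is
  none, so \<open>Phi k\<close> kills \<open>x\<close> and \<open>b\<close> is the eigenvalue of a
  neighbour of \<open>c\<close>. Then \<open>Phi k\<close> kills \<open>y\<close> too, by
  \<open>not_neighbours\<close>, and the quadratic in \<open>Phi_Phi_apply\<close> leaves only the
  case of a double root.\<close>

lemma semisimple_addable:
  assumes y: "y \<in> W (c # cs)" and d: "d \<in> addable (shape (c # cs))" "b = zc d"
    and gen: "z (Suc k) * (z (Suc k) * y - b *s y) = b *s (z (Suc k) * y - b *s y)"
  shows "z (Suc k) * y = b *s y"
proof (rule ccontr)
  assume no: "z (Suc k) * y \<noteq> b *s y"
  define x where "x = z (Suc k) * y - b *s y"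
  have x0: "x \<noteq> 0" using no by (simp add: x_def)
  have x: "x \<in> W (c # cs)" unfolding x_def
    by (intro subspace_diff subspace_scale W_subspace W_z y) (use k in auto)
  have zx: "z (Suc k) * x = b *s x" using gen by (simp add: x_def)
  have zP: "z k * (Phi k * v) = Phi k * (z (Suc k) * v)" for v
    using z_Phi(1)[of k] k by (simp add: mult.assoc[symmetric])
  have "z k * (Phi k * y) - b *s (Phi k * y) = Phi k * x"
    by (simp add: zP x_def right_diff_distrib mult_scale)
  moreover have "z k * (Phi k * x) = b *s (Phi k * x)" by (simp add: zP zx mult_scale)
  ultimately have zp: "z k * (Phi k * y) = b *s (Phi k * y)"
    using spec_semisimple[OF stdcs(3) Phi_weight(1)[OF k y], of b] k by simp
  then have "Phi k * x = 0"
    using \<open>z k * (Phi k * y) - b *s (Phi k * y) = Phi k * x\<close> by simp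
  then have nb: "b = zc (Suc c) \<or> b = zc (c - 1)" using Phi_neighbour[OF x zx x0] by blast
  have "Phi k * y = 0"
  proof (rule ccontr)
    assume "Phi k * y \<noteq> 0"
    then obtain d' where d': "d' \<in> addable (shape cs)" "b = zc d'"
      using spec_eigen[OF stdcs(3) Phi_weight(1)[OF k y]] zp k by metis
    then have "c \<noteq> d'" using no_rep[OF x] zx x0 by auto
    then show False using not_neighbours[OF stdcs(1,2) d'(1)] nb d'(2) k by auto
  qed
  then have l: "lins (z (Suc k)) [zc (Suc c), zc (c - 1)] y = 0"
    using Phi_Phi_apply[OF k y] by simp
  have dbl: "zc (Suc c) = zc (c - 1)"
  proof (rule ccontr)
    assume "zc (Suc c) \<noteq> zc (c - 1)"
    then show False using semisimple_eigen[OF l _ gen] no by simp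
  qed
  have "c \<noteq> 0"
  proof
    assume "c = 0"
    then show False using dbl zc_Suc[of 0] n1 by simp
  qed
  then obtain a where a: "c = Suc a" by (cases c) auto
  have ba: "b = zc a" using nb dbl a by auto
  have exc: "n < 2 * Suc a + 1" using double_root[of a] dbl a exceptional_large[of a] by simp
  have Sa: "Suc a \<in> shape cs" using stdcs(2) a by (auto simp: addable_def)
  have a0: "a \<noteq> 0"
  proof
    assume "a = 0"
    then have "n < 3" using exc by simp
    then have "cs = []" using k by (cases cs) auto
    then show False using Sa by simp
  qed
  have aS: "a \<notin> shape cs" using sumcs[of a "Suc a"] Sa exc by auto
  obtain ts where ts: "std (a # ts)" "shape (a # ts) = shape cs"
    using rearrange_last[OF Sa aS stdcs(1)] by blast
  obtain r r' where r: "r \<in> Tr k" "Suc (length ts) = length cs"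
    "\<And>x. x \<in> W (c # cs) \<Longrightarrow> r * x \<in> W (c # a # ts) \<and> r' * (r * x) = x"
    using move[OF ts] by metis
  have zr: "z (Suc k) * (r * v) = r * (z (Suc k) * v)" for v
    using Tr_z[OF r(1), of "Suc k"] k by (simp add: mult.assoc[symmetric])
  have rx: "z (Suc k) * (r * y) - b *s (r * y) = r * x"
    by (simp add: zr x_def right_diff_distrib mult_scale)
  \<comment> \<open>The double root leads to the pattern \<open>a, a + 1, a\<close>, this time with
    a possible Jordan block.\<close>
  have "z (Suc (length ts) + 2) * (r * y) = zc a *s (r * y)"
  proof (rule pattern_semisimple[of "Suc (length ts)" ts a "Suc a"])
    show ne: "zc a \<noteq> zc (Suc a)" using zc_Suc[of a] c_bound a by auto
    show "spec ts" "unip ts" "spec (a # ts)" using IH[of ts] IH[of "a # ts"] ts r k by auto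
    show "zc c' \<noteq> zc (Suc a)" if "c' \<in> addable (shape ts)" for c'
      using down_nadd[OF ts(1) a0 _ that] r k by auto
    show "zc a * zc a \<noteq> 4" using zc_sq[of a] c_bound a a0 by simp
    have "neighbours (zc a) (zc (Suc a)) = 0" by (simp add: neighbours_zc)
    then show "zc a * zc (Suc a) \<noteq> 4" using ne by (auto simp: neighbours_def)
    show "r * y \<in> W (Suc a # a # ts)" using r(3)[OF y] a by simp
    have "z (Suc k) * (r * x) = zc a *s (r * x)" using zx ba by (simp add: zr mult_scale)
    then show "z (Suc (length ts) + 2) * (z (Suc (length ts) + 2) * (r * y) - zc a *s (r * y)) =
      zc a *s (z (Suc (length ts) + 2) * (r * y) - zc a *s (r * y))"
      using rx r k ba by simp
  qed (use ts r k y in auto)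
  then have "r * x = 0" using rx r k ba by simp
  then show False using r(3)[OF x] x0 by simp
qed

text \<open>\<open>Phi k\<close> turns the annihilating product of \<open>z k\<close> into one of
  \<open>z (Suc k)\<close>, up to the two linear factors of its square; \<open>lins_reduce\<close>
  then cuts it down to the addable contents.\<close>

lemma spec_step: "spec (c # cs)"
proof -
  define bs where "bs = map zc (sorted_list_of_set (addable (shape (c # cs))))"
  have fin: "finite (addable (shape (c # cs)))" by (intro finite_addable finite_shape)
  have set: "set bs = zc ` addable (shape (c # cs))" using fin by (simp add: bs_def)
  have "inj_on zc (addable (shape (c # cs)))"
    by (rule inj_onI) (metis zc_addable_inj std k length_Cons)
  then have dist: "distinct bs" using fin by (simp add: bs_def distinct_map)
  obtain L where L: "\<And>x. x \<in> W cs \<Longrightarrow> lins (z k) L x = 0"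
    using stdcs(3) k by (auto simp: spec_def)
  have all: "lins (z (Suc k)) (L @ [zc (Suc c), zc (c - 1)]) x = 0" if x: "x \<in> W (c # cs)" for x
  proof -
    have x': "lins (z (Suc k)) L x \<in> W (c # cs)"
      using W_lins[of "c # cs" x] x k by simp
    have "Phi k * lins (z (Suc k)) L x = lins (z k) L (Phi k * x)"
      using lins_intertwine[OF z_Phi(1)[of k]] k by simp
    also have "\<dots> = 0" using L Phi_weight(1)[OF k x] by simp
    finally show ?thesis using Phi_Phi_apply[OF k x'] by (simp only: lins_append) simp
  qed
  have "lins (z (Suc k)) bs x = 0" if x: "x \<in> W (c # cs)" for x
  proof (rule lins_reduce[OF W_subspace[of "c # cs"] _ _ _ all[OF x] x])
    show "z (Suc k) * y \<in> W (c # cs)" if "y \<in> W (c # cs)" for y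
      using W_z[of "c # cs" "Suc k" y] that k by simp
    show "b \<in> set bs" if "y \<in> W (c # cs)" "z (Suc k) * y = b *s y" "y \<noteq> 0" for y b
      using eigen_addable[OF that] set by auto
    show "z (Suc k) * y = b *s y" if "y \<in> W (c # cs)" "b \<in> set bs"
      "z (Suc k) * (z (Suc k) * y - b *s y) = b *s (z (Suc k) * y - b *s y)" for y b
      using semisimple_addable[OF that(1) _ _ that(3)] that(2) set by auto
  qed
  then show ?thesis unfolding spec_def using set dist k by (intro exI[of _ bs]) auto
qed

text \<open>A box of content 0 cannot directly follow another one. After content 1 it completes the
  pattern \<open>0, 1, 0\<close>. After a larger content \<open>Phi k\<close> moves it one letter
  earlier, where \<open>unip cs\<close> holds, and kills no nonzero vector with these
  eigenvalues.\<close>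

lemma unip_step: "unip (c # cs)"
  unfolding unip_def
proof (intro impI ballI)
  assume add: "0 \<in> addable (shape (c # cs))"
  fix x assume x: "x \<in> W (0 # c # cs)"
  have x1: "x \<in> W (c # cs)" and zx: "z (Suc k) * x = zc 0 *s x" using x k by auto
  define N where "N = D (Suc k) - C (Suc k)"
  have Nx: "N * x \<in> W (c # cs)" unfolding N_def left_diff_distrib
    by (intro subspace_diff W_subspace W_C W_D) (use x1 k in auto)
  have c0: "c \<noteq> 0"
  proof
    assume "c = 0"
    then show False using add not_addable_same[of 0 "shape cs"] by simp
  qed
  have "N * x = 0"
  proof (cases "c = 1")
    case True
    have S: "Suc 0 \<in> shape cs" using stdcs(2) True by (auto simp: addable_def)
    obtain ts where ts: "std (0 # ts)" "shape (0 # ts) = shape cs"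
      using rearrange_last[OF S zero_notin_shape stdcs(1)] by blast
    obtain r r' where r: "r \<in> Tr k" "Suc (length ts) = length cs"
      "\<And>x. x \<in> W (c # cs) \<Longrightarrow> r * x \<in> W (c # 0 # ts) \<and> r' * (r * x) = x"
      using move[OF ts] by metis
    have zr: "z (Suc k) * (r * v) = r * (z (Suc k) * v)" for v
      using Tr_z[OF r(1), of "Suc k"] k by (simp add: mult.assoc[symmetric])
    have "D (Suc (length ts) + 2) * (r * x) = C (Suc (length ts) + 2) * (r * x)"
    proof (rule pattern_unip[of "Suc (length ts)" ts 0 "Suc 0"])
      show ne: "zc 0 \<noteq> zc (Suc 0)" using zc_Suc[of 0] n1 by auto
      show "spec ts" "unip ts" "spec (0 # ts)" using IH[of ts] IH[of "0 # ts"] ts r k by auto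
      show "zc c' \<noteq> zc (Suc 0)" if c': "c' \<in> addable (shape ts)" for c'
      proof (cases "c' = 0")
        case False
        have "c' \<noteq> Suc 0" using addable_not_Suc[of 0 "shape ts" c'] ts c' by simp
        moreover have "c' \<le> length ts" using addable_le_sum[OF finite_shape c'] sum_shape[of ts] ts by simp
        ultimately show ?thesis using zc_inj[of c' "Suc 0"] r k by auto
      qed (use ne in simp)
      show "8 - zc (Suc 0) * zc (Suc 0) - zc 0 * zc (Suc 0) \<noteq> 0" using kappa_down'[of 0] r k by simp
      show "r * x \<in> W (Suc 0 # 0 # ts)" using r(3)[OF x1] True by simp
      show "z (Suc (length ts) + 2) * (r * x) = zc 0 *s (r * x)" using zr zx r k by (simp add: mult_scale)
    qed (use ts r k in auto)
    then have "D (Suc k) * (r * x) = C (Suc k) * (r * x)" using r k by simp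
    moreover have "D (Suc k) * r = r * D (Suc k)" "C (Suc k) * r = r * C (Suc k)"
      using r(1) k by (auto simp: Tr_def)
    ultimately have "r * (N * x) = 0"
      by (simp add: N_def left_diff_distrib right_diff_distrib mult.assoc[symmetric])
    then show ?thesis using r(3)[OF Nx] by simp
  next
    case False
    have add': "0 \<in> addable (shape cs)" using addable_add_boxD[of 0 c "shape cs"] add c0 False by auto
    have "Phi k * x \<in> W cs" "z k * (Phi k * x) = zc 0 *s (Phi k * x)"
      using Phi_weight(1,2)[OF k x1] zx by (simp_all add: mult_scale)
    then have "D k * (Phi k * x) = C k * (Phi k * x)" using stdcs(4) add' k by (auto simp: unip_def)
    moreover have "Phi k * (N * x) = D k * (Phi k * x) - C k * (Phi k * x)"
      using C_Phi[of k] D_Phi[of k] k by (simp add: N_def left_diff_distrib right_diff_distrib mult.assoc[symmetric])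
    ultimately have PN: "Phi k * (N * x) = 0" by simp
    have "z (Suc k) * N = N * z (Suc k)"
      using C_z[of "Suc k" "Suc k"] D_z[of "Suc k" "Suc k"] k
      by (simp add: N_def left_diff_distrib right_diff_distrib)
    then have zN: "z (Suc k) * (N * x) = zc 0 *s (N * x)"
      using zx by (simp only: assoc_vec) (simp add: mult.assoc mult_scale)
    show ?thesis
    proof (rule ccontr)
      assume "N * x \<noteq> 0"
      then have "zc 0 = zc (Suc c) \<or> zc 0 = zc (c - 1)" using Phi_neighbour[OF Nx zN _ PN] by blast
      then show False using zc_inj[of 0 "Suc c"] zc_inj[of 0 "c - 1"] c0 False c_bound by auto
    qed
  qed
  then show "D (Suc (length (c # cs))) * x = C (Suc (length (c # cs))) * x"
    using k by (simp add: N_def left_diff_distrib)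
qed

end

theorem spectrum: "std cs \<Longrightarrow> length cs < n \<Longrightarrow> spec cs \<and> unip cs"
proof (induction "length cs" arbitrary: cs rule: less_induct)
  case less
  show ?case
  proof (cases cs)
    case Nil
    have "z (Suc 0) = 2 *s e" using CC[of 1] n1 by (simp add: z_def scale2)
    then have "\<forall>x\<in>W []. lins (z (Suc 0)) [zc 0] x = 0" by (simp add: zc_0 scale_mult)
    then have "spec []" unfolding spec_def by (intro exI[of _ "[zc 0]"]) (auto simp: addable_def)
    then show ?thesis using Nil by (simp add: unip_def)
  next
    case (Cons c ds)
    then show ?thesis
      using spec_step[of "length cs" ds c] unip_step[of "length cs" ds c] less by auto
  qed
qed

end

section \<open>Idempotents\<close>

context assoc_algebra
begin

lemma lins_mult: "lins v as (x * y) = lins v as x * y"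
  by (induction as arbitrary: x) (simp_all add: mult.assoc[symmetric] scale_mult[symmetric] left_diff_distrib[symmetric])

text \<open>Lagrange interpolation without denominators: for distinct roots, the products omitting
  one factor each generate the unit ideal of polynomials.\<close>

lemma lins_removals:
  assumes "distinct as" "lins v as u = 0" "\<And>a. a \<in> set as \<Longrightarrow> lins v (remove1 a as) u = 0"
  shows "u = 0"
  using assms
proof (induction as arbitrary: u)
  case (Cons a as)
  have 1: "lins v as u = 0" using Cons.prems(3)[of a] by simp
  have "v * u - a *s u = 0"
  proof (rule Cons.IH)
    show "lins v as (v * u - a *s u) = 0" using Cons.prems(2) by simp
    show "lins v (remove1 b as) (v * u - a *s u) = 0" if "b \<in> set as" for b
      using Cons.prems(3)[of b] Cons.prems(1) that by (auto split: if_splits)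
  qed (use Cons.prems in simp)
  then have "v * u = a *s u" by simp
  then show ?case using 1 Cons.prems(1) lins_eigen[of v u a as] prod_list_zero_iff[of a as] by auto
qed simp

end

context hecke_clifford_generic
begin

definition eigs :: "nat list \<Rightarrow> 'a list"
  where "eigs cs = map zc (sorted_list_of_set (addable (shape cs)))"

text \<open>Lagrange interpolation in one \<open>z k\<close> after the other, so that multiplication
  by \<open>E cs\<close> projects \<open>W []\<close> onto \<open>W cs\<close>. Some of these
  elements may be zero.\<close>

fun E :: "nat list \<Rightarrow> 'r" where
  "E [] = e"
| "E (c # cs) = inverse (\<Prod>a\<leftarrow>remove1 (zc c) (eigs cs). zc c - a) *s
      lins (z (Suc (length cs))) (remove1 (zc c) (eigs cs)) (E cs)"

lemma set_eigs: "set (eigs cs) = zc ` addable (shape cs)"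
  by (simp add: eigs_def finite_addable finite_shape)

lemma distinct_eigs: assumes "std cs" "length cs < n" shows "distinct (eigs cs)"
proof -
  have "inj_on zc (addable (shape cs))"
    by (rule inj_onI) (metis zc_addable_inj assms)
  then show ?thesis by (simp add: eigs_def distinct_map finite_addable finite_shape)
qed

lemma lins_eigs:
  assumes "std cs" "length cs < n" "x \<in> W cs"
  shows "lins (z (Suc (length cs))) (eigs cs) x = 0"
proof -
  have sp: "spec cs" using spectrum assms by blast
  obtain L where L: "\<And>x. x \<in> W cs \<Longrightarrow> lins (z (Suc (length cs))) L x = 0"
    using sp by (auto simp: spec_def)
  show ?thesis
  proof (rule lins_reduce[OF W_subspace[of cs] _ _ _ L[OF assms(3)] assms(3)])
    show "z (Suc (length cs)) * y \<in> W cs" if "y \<in> W cs" for y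
      using W_z[of cs "Suc (length cs)" y] that assms by simp
    show "b \<in> set (eigs cs)" if "y \<in> W cs" "z (Suc (length cs)) * y = b *s y" "y \<noteq> 0" for y b
      using spec_eigen[OF sp that] set_eigs by auto
    show "z (Suc (length cs)) * y = b *s y" if "y \<in> W cs" "b \<in> set (eigs cs)"
      "z (Suc (length cs)) * (z (Suc (length cs)) * y - b *s y) = b *s (z (Suc (length cs)) * y - b *s y)" for y b
      using spec_semisimple[OF sp that(1,3)] .
  qed
qed

lemma E_Cons_mult: "E (c # cs) * x = inverse (\<Prod>a\<leftarrow>remove1 (zc c) (eigs cs). zc c - a) *s
      lins (z (Suc (length cs))) (remove1 (zc c) (eigs cs)) (E cs * x)"
  by (simp add: scale_mult lins_mult)

lemma coeff_nz: "std (c # cs) \<Longrightarrow> length cs < n \<Longrightarrow> (\<Prod>a\<leftarrow>remove1 (zc c) (eigs cs). zc c - a) \<noteq> 0"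
  using distinct_eigs[of cs] by (simp add: prod_list_zero_iff)

lemma Hs_lins: "x \<in> Hs m \<Longrightarrow> 1 \<le> j \<Longrightarrow> j \<le> m \<Longrightarrow> lins (z j) as x \<in> Hs m"
proof (induction as arbitrary: x)
  case (Cons a as)
  have "z j * x - a *s x \<in> Hs m" using Cons.prems by (intro Hs_diff Hs_mult Hs_z Hs_scale)
  then show ?case using Cons by simp
qed simp

lemma E_Hs: "E cs \<in> Hs (length cs)"
  by (induction cs) (auto intro!: Hs_e Hs_scale Hs_lins intro: Hs_mono[of "length cs" "Suc (length cs)" for cs])

lemma E_W: "std cs \<Longrightarrow> length cs \<le> n \<Longrightarrow> x \<in> W [] \<Longrightarrow> E cs * x \<in> W cs"
proof (induction cs)
  case (Cons c cs)
  define v u where "v = z (Suc (length cs))" and "u = lins v (remove1 (zc c) (eigs cs)) (E cs * x)"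
  have 1: "E cs * x \<in> W cs" using Cons by simp
  have u: "u \<in> W cs" unfolding u_def v_def by (rule W_lins) (use Cons 1 in auto)
  have "zc c \<in> set (eigs cs)" using Cons.prems by (simp add: set_eigs)
  then have "lins v (eigs cs) (E cs * x) = v * u - zc c *s u"
    unfolding u_def lins_commute[symmetric] by (rule lins_remove1)
  moreover have "lins v (eigs cs) (E cs * x) = 0" unfolding v_def by (rule lins_eigs) (use Cons 1 in auto)
  ultimately have "u \<in> W (c # cs)" using u by (simp add: v_def)
  then show ?case unfolding E_Cons_mult u_def[unfolded v_def, symmetric] by (rule subspace_scale[OF W_subspace])
qed auto

lemma E_id: "std cs \<Longrightarrow> length cs \<le> n \<Longrightarrow> x \<in> W cs \<Longrightarrow> E cs * x = x"
proof (induction cs)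
  case (Cons c cs)
  have l: "lins (z (Suc (length cs))) as x = (\<Prod>a\<leftarrow>as. zc c - a) *s x" for as
    by (rule lins_eigen) (use Cons in simp)
  have "E cs * x = x" using Cons by simp
  then show ?case using Cons.prems coeff_nz[of c cs] unfolding E_Cons_mult by (simp add: l)
qed auto

lemma E_orth:
  "std ds \<Longrightarrow> std cs \<Longrightarrow> length ds = length cs \<Longrightarrow> length cs \<le> n \<Longrightarrow> ds \<noteq> cs \<Longrightarrow> x \<in> W cs \<Longrightarrow> E ds * x = 0"
proof (induction ds cs rule: list_induct2')
  case (4 d ds c cs)
  show ?case
  proof (cases "ds = cs")
    case True
    then have "d \<noteq> c" using 4 by auto
    then have "zc d \<noteq> zc c" using zc_addable_inj[of cs d c] 4 True by auto
    then have "zc c \<in> set (remove1 (zc d) (eigs cs))" using 4 by (simp add: set_eigs)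
    moreover have "E cs * x = x" using E_id 4 by auto
    moreover have l: "lins (z (Suc (length cs))) as x = (\<Prod>a\<leftarrow>as. zc c - a) *s x" for as
      by (rule lins_eigen) (use 4 in simp)
    ultimately show ?thesis unfolding E_Cons_mult True by (simp only: l prod_list_zero_iff[THEN iffD2]) simp
  next
    case False
    then have "E ds * x = 0" using 4 by auto
    then show ?thesis unfolding E_Cons_mult by (simp add: lins_zero)
  qed
qed auto

definition Std :: "nat \<Rightarrow> nat list set" where "Std m = {cs. std cs \<and> length cs = m}"

lemma finite_Std: "finite (Std m)"
proof -
  have "c \<le> length cs" if "std (c # cs)" for c cs
    using addable_le_sum[OF finite_shape, of c cs] sum_shape[of cs] that by auto
  then have "set cs \<subseteq> {..length cs}" if "std cs" for cs
    using that by (induction cs) force+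
  then have "Std m \<subseteq> {cs. set cs \<subseteq> {..m} \<and> length cs = m}" by (auto simp: Std_def)
  then show ?thesis using finite_lists_length_eq[of "{..m}" m] finite_subset by blast
qed

lemma E_separate: "m \<le> n \<Longrightarrow> x \<in> W [] \<Longrightarrow> (\<And>cs. cs \<in> Std m \<Longrightarrow> E cs * x = 0) \<Longrightarrow> x = 0"
proof (induction m arbitrary: x)
  case 0
  then show ?case by (force simp: Std_def)
next
  case (Suc m)
  show ?case
  proof (rule Suc.IH)
    fix cs assume "cs \<in> Std m"
    then have cs: "std cs" "length cs = m" by (auto simp: Std_def)
    have x: "E cs * x \<in> W cs" using E_W Suc cs by simp
    show "E cs * x = 0"
    proof (rule lins_removals)
      show "distinct (eigs cs)" "lins (z (Suc (length cs))) (eigs cs) (E cs * x) = 0"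
        using distinct_eigs lins_eigs cs Suc x by auto
      fix a assume "a \<in> set (eigs cs)"
      then obtain c where c: "c \<in> addable (shape cs)" "a = zc c" by (auto simp: set_eigs)
      then have "E (c # cs) * x = 0" using Suc.prems(3)[of "c # cs"] cs by (simp add: Std_def)
      then show "lins (z (Suc (length cs))) (remove1 a (eigs cs)) (E cs * x) = 0"
        unfolding E_Cons_mult using coeff_nz[of c cs] c cs Suc by simp
    qed
  qed (use Suc in auto)
qed

lemma E_sum: assumes "m \<le> n" "x \<in> W []" shows "(\<Sum>cs\<in>Std m. E cs * x) = x"
proof -
  have W: "E cs * x \<in> W cs" if "cs \<in> Std m" for cs using E_W that assms by (simp add: Std_def)
  have W0: "E cs * x \<in> W []" if "cs \<in> Std m" for cs using W_e[OF W[OF that]] by simp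
  have S: "(\<Sum>cs\<in>Std m. E cs * x) \<in> W []" by (rule subspace_sum[OF W_subspace]) (use W0 in auto)
  have "x - (\<Sum>cs\<in>Std m. E cs * x) = 0"
  proof (rule E_separate[OF assms(1)])
    show "x - (\<Sum>cs\<in>Std m. E cs * x) \<in> W []" using S assms W_subspace subspace_diff by blast
    fix ds assume ds: "ds \<in> Std m"
    have "E ds * (\<Sum>cs\<in>Std m. E cs * x) = (\<Sum>cs\<in>Std m. if cs = ds then E ds * x else 0)"
      unfolding sum_distrib_left
    proof (rule sum.cong)
      fix cs assume cs: "cs \<in> Std m"
      show "E ds * (E cs * x) = (if cs = ds then E ds * x else 0)"
        using E_id[OF _ _ W[OF cs]] E_orth[OF _ _ _ _ _ W[OF cs], of ds] ds cs assms by (auto simp: Std_def)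
    qed simp
    also have "\<dots> = E ds * x" using ds finite_Std by simp
    finally show "E ds * (x - (\<Sum>cs\<in>Std m. E cs * x)) = 0" by (simp add: right_diff_distrib)
  qed
  then show ?thesis by simp
qed

section \<open>Double cosets\<close>

text \<open>\<open>r'\<close> is \<open>r\<close> with its odd part negated. Without a grading at
  hand, it is constructed along the generation of \<open>r\<close>, which yields one
  \<open>r'\<close> for all later letters.\<close>

lemma Hs_parity:
  assumes "r \<in> Hs m" "m \<le> n"
  obtains r' where "r' \<in> Hs m" "\<And>j. m < j \<Longrightarrow> j \<le> n \<Longrightarrow> C j * r = r' * C j"
    "\<And>j. m < j \<Longrightarrow> j \<le> n \<Longrightarrow> D j * r = r' * D j"
proof -
  have "\<exists>r'\<in>Hs m. \<forall>j. m < j \<and> j \<le> n \<longrightarrow> C j * r = r' * C j \<and> D j * r = r' * D j"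
    using assms(1)
  proof (induction rule: Hs.induct)
    case Hs_e
    then show ?case using Hs.Hs_e eC Ce e_D D_e by (intro bexI[of _ e]) auto
  next
    case (Hs_scale r a)
    then obtain r' where "r' \<in> Hs m" "\<forall>j. m < j \<and> j \<le> n \<longrightarrow> C j * r = r' * C j \<and> D j * r = r' * D j" by blast
    then show ?case by (intro bexI[of _ "a *s r'"]) (auto simp: mult_scale scale_mult intro: Hs.Hs_scale)
  next
    case (Hs_add r s)
    then obtain r' s' where "r' \<in> Hs m" "\<forall>j. m < j \<and> j \<le> n \<longrightarrow> C j * r = r' * C j \<and> D j * r = r' * D j"
      "s' \<in> Hs m" "\<forall>j. m < j \<and> j \<le> n \<longrightarrow> C j * s = s' * C j \<and> D j * s = s' * D j" by blast
    then show ?case by (intro bexI[of _ "r' + s'"]) (auto simp: distrib_left distrib_right intro: Hs.Hs_add)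
  next
    case (Hs_mult r s)
    then obtain r' s' where r: "r' \<in> Hs m" "\<And>j. m < j \<Longrightarrow> j \<le> n \<Longrightarrow> C j * r = r' * C j \<and> D j * r = r' * D j"
      and s: "s' \<in> Hs m" "\<And>j. m < j \<Longrightarrow> j \<le> n \<Longrightarrow> C j * s = s' * C j \<and> D j * s = s' * D j" by blast
    have "C j * (r * s) = r' * s' * C j \<and> D j * (r * s) = r' * s' * D j" if "m < j" "j \<le> n" for j
    proof -
      have 1: "C j * r = r' * C j" "D j * r = r' * D j" "C j * s = s' * C j" "D j * s = s' * D j"
        using r s that by auto
      show ?thesis by (simp only: assoc_vec[OF 1(1)] assoc_vec[OF 1(2)] mult.assoc 1(3,4))
    qed
    then show ?case using r s by (intro bexI[of _ "r' * s'"]) (auto intro: Hs.Hs_mult)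
  next
    case (Hs_T i)
    then show ?case using TC_far[of i] T_D[of i] assms(2) by (intro bexI[of _ "T i"]) (auto intro: Hs.Hs_T)
  next
    case (Hs_C i)
    have "C j * C i = (- 1) *s C i * C j \<and> D j * C i = (- 1) *s C i * D j" if "m < j" "j \<le> n" for j
      using C_anti[of j i] C_D[of i j] Hs_C assms(2) that by (auto simp: scale_mult)
    moreover have "(- 1) *s C i \<in> Hs m" using Hs_C by (intro Hs.Hs_scale Hs.Hs_C)
    ultimately show ?case by blast
  qed
  then show ?thesis using that by blast
qed

lemma T_Hs: "r \<in> Hs m \<Longrightarrow> m < k \<Longrightarrow> k < n \<Longrightarrow> T k * r = r * T k"
proof (induction rule: Hs.induct)
  case Hs_e
  then show ?case using Te[of k] eT[of k] by simp
next
  case (Hs_mult r s)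
  then have 1: "T k * r = r * T k" "T k * s = s * T k" by auto
  show ?case by (simp only: assoc_vec[OF 1(1)] mult.assoc 1(2))
next
  case (Hs_T i)
  then show ?case using T_far[of k i] by simp
next
  case (Hs_C i)
  then show ?case using TC_far[of k i] by simp
qed (auto simp: mult_scale scale_mult distrib_left distrib_right)

lemma Hs_C_left: assumes "r \<in> Hs m" "m < j" "j \<le> n"
  obtains r' where "r' \<in> Hs m" "\<And>x. C j * (r * x) = r' * (C j * x)" "\<And>x. D j * (r * x) = r' * (D j * x)"
proof -
  obtain r' where r': "r' \<in> Hs m" "C j * r = r' * C j" "D j * r = r' * D j"
    using Hs_parity[OF assms(1)] assms by (metis le_trans less_imp_le)
  show ?thesis by (rule that[OF r'(1)]) (simp_all only: assoc_vec[OF r'(2)] assoc_vec[OF r'(3)] mult.assoc)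
qed

text \<open>The sums of elements of \<open>Hs k * V\<close> and
  \<open>Hs k * T k * Hs k * V\<close>. Starting from a set \<open>V\<close> instead of the unit
  lets \<open>V\<close> absorb the Clifford generator of letter \<open>Suc k\<close>.\<close>

inductive_set dcoset :: "nat \<Rightarrow> 'r set \<Rightarrow> 'r set" for k V where
  dc_one: "r \<in> Hs k \<Longrightarrow> y \<in> V \<Longrightarrow> r * y \<in> dcoset k V"
| dc_T: "1 \<le> k \<Longrightarrow> r \<in> Hs k \<Longrightarrow> s \<in> Hs k \<Longrightarrow> y \<in> V \<Longrightarrow> r * (T k * (s * y)) \<in> dcoset k V"
| dc_add: "x \<in> dcoset k V \<Longrightarrow> y \<in> dcoset k V \<Longrightarrow> x + y \<in> dcoset k V"

lemma dc_Hs: "x \<in> dcoset k V \<Longrightarrow> r \<in> Hs k \<Longrightarrow> r * x \<in> dcoset k V"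
proof (induction rule: dcoset.induct)
  case (dc_one s y)
  then show ?case using dcoset.dc_one[OF Hs_mult] by (simp add: mult.assoc[symmetric])
next
  case (dc_T r' s y)
  then have "(r * r') * (T k * (s * y)) \<in> dcoset k V" by (intro dcoset.dc_T Hs_mult)
  then show ?case by (simp add: mult.assoc)
qed (auto simp: distrib_left intro: dcoset.dc_add)

lemma dc_scale: "x \<in> dcoset k V \<Longrightarrow> k \<le> n \<Longrightarrow> (\<And>y. y \<in> V \<Longrightarrow> e * y = y) \<Longrightarrow> a *s x \<in> dcoset k V"
proof (induction rule: dcoset.induct)
  case (dc_one r y)
  then show ?case using dcoset.dc_one[OF Hs_scale[of r k a]] by (simp add: scale_mult)
next
  case (dc_T r s y)
  then show ?case using dcoset.dc_T[OF _ Hs_scale[of r k a]] by (simp add: scale_mult)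
qed (auto simp: scale_right_distrib intro: dcoset.dc_add)

text \<open>This is the decomposition of the algebra on \<open>k + 1\<close> letters into double cosets of the one on
  \<open>k\<close> letters.\<close>
lemma dc_closed:
  assumes "Suc k \<le> n" "\<And>y. y \<in> V \<Longrightarrow> e * y = y" "\<And>y. y \<in> V \<Longrightarrow> C (Suc k) * y \<in> V"
    "r \<in> Hs (Suc k)" "x \<in> dcoset k V"
  shows "r * x \<in> dcoset k V"
  using assms
proof (induction k arbitrary: V r x rule: less_induct)
  case (less k)
  note kn = less.prems(1) and eV = less.prems(2) and CV = less.prems(3)
  have k: "k < n" using kn by simp
  have emem: "e * w = w" if "w \<in> dcoset k V" for w
    using that
  proof (induction rule: dcoset.induct)
    case (dc_one r y)
    then show ?case using Hs_unit[OF dc_one(1)] k by (simp add: mult.assoc[symmetric])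
  next
    case (dc_T r s y)
    then show ?case using Hs_unit[OF dc_T(2)] k by (simp add: mult.assoc[symmetric])
  qed (simp add: distrib_left)
  note sc = dc_scale[OF _ less_imp_le[OF k] eV]
  have diff: "u - w \<in> dcoset k V" if "u \<in> dcoset k V" "w \<in> dcoset k V" for u w
    using dc_add[OF that(1) sc[OF that(2), of "- 1"]] by simp
  have C: "C (Suc k) * w \<in> dcoset k V" if "w \<in> dcoset k V" for w
    using that
  proof (induction rule: dcoset.induct)
    case (dc_one r y)
    obtain r' where r': "r' \<in> Hs k" "\<And>x. C (Suc k) * (r * x) = r' * (C (Suc k) * x)"
      using Hs_C_left[OF dc_one(1) lessI kn] by blast
    then show ?case using dcoset.dc_one CV dc_one by metis
  next
    case (dc_T r s y)
    obtain r' where r': "r' \<in> Hs k" "\<And>x. C (Suc k) * (r * x) = r' * (C (Suc k) * x)"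
      using Hs_C_left[OF dc_T(2) lessI kn] by blast
    have "C (Suc k) * (T k * x) = T k * (C k * x)" for x
      using TC2(1)[of k] dc_T k by (simp add: mult.assoc[symmetric])
    then have "C (Suc k) * (r * (T k * (s * y))) = r' * (T k * ((C k * s) * y))"
      by (simp add: r'(2) mult.assoc)
    then show ?case using dcoset.dc_T[OF dc_T(1) r'(1) _ dc_T(4)] Hs_mult[OF Hs_C[of k k] dc_T(3)] dc_T(1) by simp
  qed (auto simp: distrib_left intro: dcoset.dc_add)
  have T: "T k * w \<in> dcoset k V" if k1: "1 \<le> k" and "w \<in> dcoset k V" for w
    using that(2)
  proof (induction rule: dcoset.induct)
    case (dc_one r y)
    have "e * (T k * (r * y)) \<in> dcoset k V" by (rule dc_T[OF k1 Hs_e]) (use dc_one in auto)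
    then show ?case using eT[of k] k1 k by (simp add: e_left)
  next
    case (dc_T r s y)
    obtain l where l: "k = Suc l" using k1 by (cases k) auto
    define v where "v = T k * (s * y)"
    have TT: "T k * (T k * x) = eps *s (T k * x) + e * x" for x
      using TT[OF k1 k] by (simp add: mult.assoc[symmetric] eps_def distrib_right scale_mult)
    have es: "e * (s * y) = s * y" using emem[OF dcoset.dc_one[OF dc_T(3,4)]] .
    have ev: "e * v = v" using eT[OF k1 k] by (simp add: v_def e_left)
    have Tv: "T k * v \<in> dcoset k V"
    proof -
      have "T k * v = eps *s (e * (T k * (s * y))) + s * y"
        using es ev by (simp add: TT v_def)
      moreover have "e * (T k * (s * y)) \<in> dcoset k V" by (rule dcoset.dc_T[OF k1 Hs_e dc_T(3,4)])
      ultimately show ?thesis using sc dcoset.dc_one[OF dc_T(3,4)] dcoset.dc_add by metis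
    qed
    have TCT: "T k * (C k * v) \<in> dcoset k V"
    proof -
      have "T k * (C k * v) = C (Suc k) * (T k * v)" using TC2(1)[OF k1 k] by (simp add: mult.assoc[symmetric])
      then show ?thesis using C Tv by simp
    qed
    \<comment> \<open>The induction hypothesis is applied to \<open>r\<close> acting on
      \<open>v\<close>; adjoining \<open>C k * v\<close> makes the starting set stable under the
      last Clifford generator.\<close>
    define V' where "V' = {v, C k * v}"
    have V': "e * u = u" "C (Suc l) * u \<in> V'" if "u \<in> V'" for u
      using that ev CC[of k] k1 k eC[of k] by (auto simp: V'_def l[symmetric] e_left mult.assoc[symmetric])
    have "e * v \<in> dcoset l V'" by (rule dcoset.dc_one[OF Hs_e]) (simp add: V'_def)
    then have "r * v \<in> dcoset l V'"
      using less.IH[of l V' r v] l k V' dc_T(2) ev by simp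
    then have "T k * (r * v) \<in> dcoset k V"
    proof (induction rule: dcoset.induct)
      case (dc_one h u)
      have 1: "T k * h = h * T k" using T_Hs[OF dc_one(1)] l k by simp
      have h: "h \<in> Hs k" using dc_one(1) Hs_mono[of l k] l by simp
      show ?case unfolding assoc_vec[OF 1] mult.assoc using dc_one(2) Tv TCT dc_Hs[OF _ h] by (auto simp: V'_def)
    next
      case (dc_T h h' u)
      have 1: "T k * h = h * T k" "T k * h' = h' * T k" using T_Hs dc_T l k by auto
      have h: "h \<in> Hs k" "h' \<in> Hs k" "T l \<in> Hs k" using dc_T Hs_mono[of l k] l Hs_T[of l k] by auto
      \<comment> \<open>In the coset of \<open>T l\<close> the two factors \<open>T k\<close> meet
        around \<open>T l\<close>, and the braid relation leaves only one of them.\<close>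
      have br: "T k * (T l * (T k * x)) = T l * (T k * (T l * x))" for x
        using braid[of l] dc_T(1) l k by (simp add: mult.assoc[symmetric])
      have eq: "T k * (h * (T l * (h' * u))) = h * (T k * (T l * (h' * u)))"
        by (simp only: assoc_vec[OF 1(1)] mult.assoc)
      have B: "h * (T k * (T l * (h' * (T k * (t * x))))) \<in> dcoset k V" if "t \<in> Hs k" "x \<in> V" for t x
      proof -
        have "h' * (T k * (t * x)) = T k * (h' * (t * x))" by (simp only: assoc_vec[OF 1(2)] mult.assoc)
        then have "h * (T k * (T l * (h' * (T k * (t * x))))) = (h * T l) * (T k * ((T l * (h' * t)) * x))"
          by (simp add: br mult.assoc)
        then show ?thesis using dcoset.dc_T[OF k1 _ _ that(2), of "h * T l" "T l * (h' * t)"] h that(1)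
          by (simp add: Hs_mult)
      qed
      have u: "u = v \<or> u = C k * v" using dc_T(4) by (simp add: V'_def)
      then show ?case
      proof
        assume "u = v"
        then show ?thesis unfolding eq using B \<open>s \<in> Hs k\<close> \<open>y \<in> V\<close> by (simp add: v_def)
      next
        assume u: "u = C k * v"
        obtain s' where s': "s' \<in> Hs k" "\<And>x. C (Suc k) * (s * x) = s' * (C (Suc k) * x)"
          using Hs_C_left[OF \<open>s \<in> Hs k\<close> lessI kn] by blast
        have CT: "C k * (T k * x) = T k * (C (Suc k) * x) + eps *s (C k * x) - eps *s (C (Suc k) * x)" for x
        proof -
          have h: "C k * T k = T k * C (Suc k) + eps *s (C k - C (Suc k))" using TC2(2)[OF k1 k] by simp
          show ?thesis by (simp only: assoc_vec[OF h]) (simp add: distrib_right scale_mult mult.assoc left_diff_distrib scale_right_diff_distrib)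
        qed
        have "u = T k * (s' * (C (Suc k) * y)) + eps *s (C k * (s * y)) - eps *s (s' * (C (Suc k) * y))"
          unfolding u v_def CT s'(2) ..
        then have "T k * (h * (T l * (h' * u))) = h * (T k * (T l * (h' * (T k * (s' * (C (Suc k) * y))))))
            + eps *s (h * (T k * ((T l * (h' * (C k * s))) * y)))
            - eps *s (h * (T k * ((T l * (h' * s')) * (C (Suc k) * y))))"
          unfolding eq by (simp add: distrib_left right_diff_distrib mult_scale mult.assoc)
        moreover have "h * (T k * (T l * (h' * (T k * (s' * (C (Suc k) * y)))))) \<in> dcoset k V"
          by (rule B[OF s'(1) CV[OF \<open>y \<in> V\<close>]])
        moreover have "h * (T k * ((T l * (h' * (C k * s))) * y)) \<in> dcoset k V"
          by (rule dcoset.dc_T[OF k1 h(1) _ \<open>y \<in> V\<close>]) (use h k1 \<open>s \<in> Hs k\<close> in \<open>auto intro!: Hs_mult Hs_C\<close>)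
        moreover have "h * (T k * ((T l * (h' * s')) * (C (Suc k) * y))) \<in> dcoset k V"
          by (rule dcoset.dc_T[OF k1 h(1) _ CV[OF \<open>y \<in> V\<close>]]) (use h s' in \<open>auto intro!: Hs_mult\<close>)
        ultimately show ?thesis using sc diff dcoset.dc_add by metis
      qed
    qed (auto simp: distrib_left intro: dcoset.dc_add)
    then show ?case unfolding v_def .
  qed (auto simp: distrib_left intro: dcoset.dc_add)
  show ?case using less.prems(4,5)
  proof (induction arbitrary: x rule: Hs.induct)
    case Hs_e
    then show ?case using emem by simp
  next
    case (Hs_scale r a)
    then show ?case using sc by (simp add: scale_mult)
  next
    case (Hs_add r s)
    then show ?case using dcoset.dc_add by (simp add: distrib_right)
  next
    case (Hs_mult r s)
    then show ?case by (simp add: mult.assoc)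
  next
    case (Hs_T i)
    then show ?case using T dc_Hs[OF _ Hs.Hs_T[of i k]] by (cases "i = k") auto
  next
    case (Hs_C i)
    then show ?case using C dc_Hs[OF _ Hs.Hs_C[of i k]] by (cases "i = Suc k") auto
  qed
qed

end

context hecke_clifford_generic
begin

section \<open>Corners of the weight idempotents\<close>

definition Clifford_stable :: "nat \<Rightarrow> 'r set \<Rightarrow> bool"
  where "Clifford_stable m U \<longleftrightarrow> subspace U \<and> (\<forall>j x. 1 \<le> j \<and> j \<le> m \<and> x \<in> U \<longrightarrow> C j * x \<in> U \<and> D j * x \<in> U)"

text \<open>What \<open>corner\<close> claims about \<open>E ds * (r * x)\<close> for
  \<open>x\<close> in \<open>U\<close>. For different tableaux of the same shape nothing is claimed;
  such pairs occur in its induction, and the final argument avoids them by choosing one tableau per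
  shape.\<close>

definition target :: "nat list \<Rightarrow> nat list \<Rightarrow> 'r set \<Rightarrow> 'r set"
  where "target cs ds U = (if cs = ds then U else if shape cs \<noteq> shape ds then {0} else UNIV)"

lemma subspace_target: "subspace U \<Longrightarrow> subspace (target cs ds U)"
  by (simp add: target_def subspace_UNIV)

text \<open>Passing \<open>C j\<close> twice restores \<open>r\<close>, and \<open>z j\<close> is a
  sum of products of two elements that change \<open>r\<close> in the same way.\<close>

lemma z_Hs: assumes "r \<in> Hs m" "m < j" "j \<le> n" shows "z j * (r * x) = r * (z j * x)"
proof -
  have 1: "C j * (s * y) = (C j * s) * y" for s y by (simp add: mult.assoc)
  obtain r' where r': "r' \<in> Hs m" "C j * r = r' * C j" "D j * r = r' * D j"
    using Hs_parity[of r m] assms by (metis le_trans less_imp_le)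
  obtain r2 where r2: "r2 \<in> Hs m" "C j * r' = r2 * C j" "D j * r' = r2 * D j"
    using Hs_parity[OF r'(1)] assms by (metis le_trans less_imp_le)
  have u: "e * r = r" "e * r2 = r2" "r2 * e = r2" using Hs_unit assms r2 by auto
  have j: "C j * C j = e" using CC[of j] assms by simp
  have "r = e * r" using u by simp
  also have "\<dots> = C j * (C j * r)" using j by (simp add: mult.assoc[symmetric])
  also have "\<dots> = r2 * (C j * C j)" by (simp only: r'(2) assoc_vec[OF r2(2)] mult.assoc)
  also have "\<dots> = r2" using j u by simp
  finally have e: "r2 = r" by simp
  have "z j * r = C j * (D j * r) + D j * (C j * r)" by (simp add: z_def distrib_right mult.assoc)
  also have "\<dots> = r2 * z j"
    by (simp only: r'(2,3) assoc_vec[OF r2(2)] assoc_vec[OF r2(3)] mult.assoc z_def distrib_left)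
  finally have h: "z j * r = r * z j" by (simp add: e)
  show ?thesis by (simp only: assoc_vec[OF h] mult.assoc)
qed

lemma z_E: assumes "1 \<le> j" "j \<le> n" "length cs \<le> n" shows "z j * (E cs * x) = E cs * (z j * x)"
  using assms(3)
proof (induction cs)
  case Nil
  then show ?case using e_z[of j] z_e[of j] assms by (simp add: mult.assoc[symmetric])
next
  case (Cons c cs)
  have "z j * lins (z (Suc (length cs))) as y = lins (z (Suc (length cs))) as (z j * y)" for as y
    using lins_intertwine[of "z (Suc (length cs))" "z j" "z (Suc (length cs))"] z_z[of j "Suc (length cs)"] assms Cons
    by simp
  then show ?case using Cons unfolding E_Cons_mult by (simp add: mult_scale)
qed

lemma E_eigen_zero:
  assumes "std (c # cs)" "length cs < n" "e * w = w" "z (Suc (length cs)) * w = b *s w" "b \<noteq> zc c"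
  shows "E (c # cs) * w = 0"
proof -
  have "E (c # cs) * w \<in> W (c # cs)" by (rule E_W) (use assms in auto)
  then have "z (Suc (length cs)) * (E (c # cs) * w) = zc c *s (E (c # cs) * w)" by simp
  moreover have "z (Suc (length cs)) * (E (c # cs) * w) = b *s (E (c # cs) * w)"
    using z_E[of "Suc (length cs)" "c # cs" w] assms by (simp add: mult_scale)
  ultimately have "zc c *s (E (c # cs) * w) = b *s (E (c # cs) * w)" by simp
  then have "(zc c - b) *s (E (c # cs) * w) = 0" by (simp add: scale_left_diff_distrib)
  then show ?thesis using assms(5) by simp
qed

lemma E_eigen:
  assumes "std (c # cs)" "length cs < n" "z (Suc (length cs)) * w = zc c *s w"
  shows "E (c # cs) * w = E cs * w"
proof -
  have "z (Suc (length cs)) * (E cs * w) = zc c *s (E cs * w)"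
    using z_E[of "Suc (length cs)" cs w] assms by (simp add: mult_scale)
  then have "lins (z (Suc (length cs))) as (E cs * w) = (\<Prod>a\<leftarrow>as. zc c - a) *s (E cs * w)" for as
    by (rule lins_eigen)
  then show ?thesis unfolding E_Cons_mult using coeff_nz[OF assms(1,2)] by simp
qed

text \<open>Induction over double cosets. Elements without \<open>T k\<close> fall under the
  induction hypothesis. For the others, the vector to the right of \<open>T k\<close> is split into
  weight vectors by \<open>E_sum\<close>, and on each of them \<open>T k\<close> is expressed by
  \<open>Phi k\<close> and Clifford elements.\<close>

lemma corner:
  assumes "k \<le> n" "cs \<in> Std k" "ds \<in> Std k" "Clifford_stable k U" "x \<in> U" "x \<in> W cs" "r \<in> Hs k"
  shows "E ds * (r * x) \<in> target cs ds U"
  using assms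
proof (induction k arbitrary: cs ds U x r)
  case 0
  have "r * y \<in> U" if "y \<in> U" "e * y = y" for y
  proof -
    have "r * y \<in> U \<and> e * (r * y) = r * y" using \<open>r \<in> Hs 0\<close> that
      by (induction arbitrary: y rule: Hs.induct)
        (use \<open>Clifford_stable 0 U\<close> in \<open>auto simp: Clifford_stable_def scale_mult mult_scale distrib_right distrib_left
          mult.assoc intro: subspace_add subspace_scale\<close>)
    then show ?thesis by simp
  qed
  moreover have "e * (r * x) = r * x" using Hs_unit[OF \<open>r \<in> Hs 0\<close>] by (simp add: mult.assoc[symmetric])
  moreover have "e * x = x" using W_e 0 by blast
  ultimately show ?case using 0 by (simp add: Std_def target_def)
next
  case (Suc k)
  obtain d cs1 where cs: "cs = d # cs1" "std cs1" "length cs1 = k" "d \<in> addable (shape cs1)"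
    using Suc.prems(2) by (cases cs) (auto simp: Std_def)
  obtain d' ds1 where ds: "ds = d' # ds1" "std ds1" "length ds1 = k" "d' \<in> addable (shape ds1)"
    using Suc.prems(3) by (cases ds) (auto simp: Std_def)
  have kn: "k < n" using Suc.prems(1) by simp
  define V where "V = U \<inter> W cs"
  have Us: "subspace U" and Ust: "Clifford_stable k U"
    using Suc.prems(4) by (auto simp: Clifford_stable_def)
  have VW: "y \<in> W cs1" "z (Suc k) * y = zc d *s y" "y \<in> U" "e * y = y" if "y \<in> V" for y
    using that cs W_e by (auto simp: V_def)
  have VC: "C (Suc k) * y \<in> V" "D (Suc k) * y \<in> V" if "y \<in> V" for y
    using that Suc.prems(1,4) W_C[of cs "Suc k" y] W_D[of cs "Suc k" y] cs by (auto simp: V_def Clifford_stable_def)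
  define G where "G = target cs ds U"
  have Gs: "subspace G" unfolding G_def by (rule subspace_target[OF Us])
  have rx: "r * x \<in> dcoset k V"
  proof (rule dc_closed[OF Suc.prems(1) _ VC(1) Suc.prems(7)])
    have xV: "x \<in> V" using Suc.prems by (simp add: V_def)
    have "e * x \<in> dcoset k V" by (rule dc_one[OF Hs_e xV])
    then show "x \<in> dcoset k V" using VW(4)[OF xV] by simp
  qed (rule VW(4))
  have one: "E ds * (h * y) \<in> G" if h: "h \<in> Hs k" and y: "y \<in> V" for h y
  proof -
    have zh: "z (Suc k) * (h * y) = zc d *s (h * y)"
      using z_Hs[OF h, of "Suc k"] kn VW(2)[OF y] by (simp add: mult_scale)
    have eh: "e * (h * y) = h * y" using Hs_unit[OF h] kn by (simp add: mult.assoc[symmetric])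
    have IH: "E ds1 * (h * y) \<in> target cs1 ds1 U"
      by (rule Suc.IH) (use kn cs ds Ust VW y h in \<open>auto simp: Std_def\<close>)
    show ?thesis
    proof (cases "zc d = zc d'")
      case False
      then have "E ds * (h * y) = 0" unfolding ds(1) using E_eigen_zero[of d' ds1 "h * y" "zc d"] ds eh zh kn by simp
      then show ?thesis using subspace_0[OF Gs] by simp
    next
      case True
      have E: "E ds * (h * y) = E ds1 * (h * y)" unfolding ds(1) using E_eigen[of d' ds1 "h * y"] ds zh kn True by simp
      consider "cs = ds" | "shape cs = shape ds" "cs \<noteq> ds" | "shape cs \<noteq> shape ds" by blast
      then show ?thesis
      proof cases
        case 1
        then show ?thesis using IH cs ds unfolding E by (simp add: G_def target_def)
      next
        case 2
        then show ?thesis by (simp add: G_def target_def)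
      next
        case 3
        have "shape cs1 \<noteq> shape ds1"
        proof
          assume s: "shape cs1 = shape ds1"
          then have "d = d'" using zc_addable_inj[of cs1 d d'] True cs ds kn by auto
          then show False using 3 s cs ds by simp
        qed
        then have "E ds * (h * y) = 0" unfolding E using IH by (auto simp: target_def split: if_splits)
        then show ?thesis using subspace_0[OF Gs] by simp
      qed
    qed
  qed
  have two: "E ds * (h * (T k * (h' * y))) \<in> G" if k1: "1 \<le> k" and h: "h \<in> Hs k" "h' \<in> Hs k" and y: "y \<in> V" for h h' y
  proof -
    define Y where "Y js = E js * (h' * y)" for js
    have W0: "h' * y \<in> W []" using Hs_unit[OF h(2)] kn by (simp add: mult.assoc[symmetric])
    have sum: "h' * y = (\<Sum>js\<in>Std k. Y js)" unfolding Y_def using E_sum[OF _ W0, of k] kn by simp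
    have part: "E ds * (h * (T k * Y js)) \<in> G" if js: "js \<in> Std k" for js
    proof (cases "Y js = 0")
      case True
      then show ?thesis using subspace_0[OF Gs] by simp
    next
      case nz: False
      obtain c ts where jt: "js = c # ts" using js k1 by (cases js) (auto simp: Std_def)
      have j: "std ts" "c \<in> addable (shape ts)" "k = Suc (length ts)" using js jt by (auto simp: Std_def)
      have stj: "std (c # ts)" using j by simp
      have Em: "E js \<in> Hs k" using E_Hs[of js] js by (simp add: Std_def)
      have "Y js \<in> target cs1 js U" unfolding Y_def
        by (rule Suc.IH) (use kn cs js Ust VW y h in \<open>auto simp: Std_def\<close>)
      then have shj: "shape js = shape cs1" using nz by (auto simp: target_def split: if_splits)
      have YW: "Y js \<in> W (c # ts)" unfolding Y_def jt[symmetric] by (rule E_W) (use js W0 kn in \<open>auto simp: Std_def\<close>)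
      have zY: "z (Suc k) * Y js = zc d *s Y js"
        unfolding Y_def using z_E[of "Suc k" js] z_Hs[OF h(2), of "Suc k"] kn js VW(2)[OF y] by (simp add: Std_def mult_scale)
      have sp: "spec ts" "unip ts" using spectrum[OF j(1)] j kn by auto
      have ne: "zc c \<noteq> zc d"
      proof
        assume "zc c = zc d"
        then have "z (Suc k) * Y js = zc c *s Y js" using zY by simp
        then show False using no_repeat[OF j(3) kn stj sp YW] nz by simp
      qed
      define p where "p = Phi k * Y js"
      have Phi: "p = (zc c - zc d) *s (T k * Y js) - eps *s (zc c *s Y js - g k * Y js)"
        unfolding p_def Phi_apply[OF j(3) kn YW] zY by (simp add: right_diff_distrib mult_scale scale_left_diff_distrib)
      \<comment> \<open>If this is nonzero, following the eigenvalues shows that \<open>ds\<close>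
        has the shape of \<open>cs\<close> but ends in \<open>c\<close> instead of \<open>d\<close>,
        and then \<open>target\<close> claims nothing.\<close>
      have hp: "E ds * (h * p) \<in> G"
      proof (cases "E ds * (h * p) = 0")
        case True
        then show ?thesis using subspace_0[OF Gs] by simp
      next
        case hp0: False
        then have p0: "p \<noteq> 0" by auto
        have pW: "p \<in> W ts" and zp: "z k * p = zc d *s p" and zp': "z (Suc k) * p = zc c *s p"
          unfolding p_def using Phi_weight[OF j(3) kn YW] zY by (simp_all add: mult_scale)
        obtain d2 where d2: "d2 \<in> addable (shape ts)" "zc d = zc d2"
          using spec_eigen[OF sp(1) pW _ p0] zp j(3) by metis
        have cd2: "d2 \<noteq> c" using ne d2 by auto
        then have "d2 \<in> addable (shape cs1)" using addable_add_box[OF d2(1), of c] shj jt by simp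
        then have dd2: "d2 = d" using zc_addable_inj[of cs1 d2 d] d2(2) cs kn by auto
        have zhp: "z (Suc k) * (h * p) = zc c *s (h * p)"
          using z_Hs[OF h(1), of "Suc k"] kn zp' by (simp add: mult_scale)
        have ehp: "e * (h * p) = h * p" using Hs_unit[OF h(1)] kn by (simp add: mult.assoc[symmetric])
        have d'c: "zc d' = zc c"
        proof (rule ccontr)
          assume "zc d' \<noteq> zc c"
          then have "E (d' # ds1) * (h * p) = 0"
            by (intro E_eigen_zero[where b = "zc c"]) (use ds ehp zhp kn in auto)
          then show False using hp0 unfolding ds(1) by simp
        qed
        have E: "E ds * (h * p) = E ds1 * (h * p)" unfolding ds(1) using E_eigen[of d' ds1 "h * p"] ds zhp kn d'c by simp
        have "E ds1 * (h * p) \<in> target (d # ts) ds1 UNIV"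
        proof (rule Suc.IH)
          show "Clifford_stable k UNIV" by (simp add: Clifford_stable_def subspace_UNIV)
          show "p \<in> W (d # ts)" using pW zp j(3) by simp
          show "d # ts \<in> Std k" using j d2 dd2 by (simp add: Std_def)
        qed (use kn ds h in \<open>auto simp: Std_def\<close>)
        then have sh: "shape (d # ts) = shape ds1" using hp0 E by (auto simp: target_def split: if_splits)
        have "c \<in> addable (shape ds1)" using addable_add_box[OF j(2), of d] cd2 dd2 sh by simp
        then have d': "d' = c" using zc_addable_inj[of ds1 d' c] d'c ds kn by auto
        have "shape ds = add_box c (add_box d (shape ts))" using sh ds d' by simp
        also have "\<dots> = add_box d (add_box c (shape ts))" using add_box_commute[of d "shape ts" c] j d2 dd2 by simp
        also have "\<dots> = shape cs" using shj jt cs by simp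
        finally have s: "shape ds = shape cs" .
        have "cs \<noteq> ds" using d' ne ds cs by auto
        then show ?thesis using s by (simp add: G_def target_def)
      qed
      \<comment> \<open>The elements \<open>C (Suc k)\<close> and \<open>D (Suc k)\<close> in
        \<open>g k\<close> are moved to the right until \<open>V\<close> absorbs them; no
        \<open>T k\<close> is left, and \<open>one\<close> applies.\<close>
      have hg: "E ds * (h * (zc c *s Y js - g k * Y js)) \<in> G"
      proof -
        have m: "C k \<in> Hs k" "D k \<in> Hs k" using k1 by (auto intro: Hs_C Hs_D)
        obtain m1 where m1: "m1 \<in> Hs k" "\<And>x. C (Suc k) * ((E js * h') * x) = m1 * (C (Suc k) * x)"
          "\<And>x. D (Suc k) * ((E js * h') * x) = m1 * (D (Suc k) * x)"
          using Hs_C_left[OF Hs_mult[OF Em h(2)] lessI Suc.prems(1)] by blast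
        obtain m2 where m2: "m2 \<in> Hs k" "\<And>x. C (Suc k) * ((D k * (E js * h')) * x) = m2 * (C (Suc k) * x)"
          using Hs_C_left[OF Hs_mult[OF m(2) Hs_mult[OF Em h(2)]] lessI Suc.prems(1)] by blast
        obtain m3 where m3: "m3 \<in> Hs k" "\<And>x. C (Suc k) * (m1 * x) = m3 * (C (Suc k) * x)"
          using Hs_C_left[OF m1(1) lessI Suc.prems(1)] by blast
        have Ye: "Y js = (E js * h') * y" by (simp add: Y_def mult.assoc)
        have DY: "D (Suc k) * Y js = m1 * (D (Suc k) * y)" unfolding Ye by (rule m1(3))
        have gY: "g k * Y js = C k * (D k * Y js) - C k * (D (Suc k) * Y js) - C (Suc k) * (D k * Y js) + C (Suc k) * (D (Suc k) * Y js)"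
          by (simp add: g_def algebra_simps)
        have CDY: "C (Suc k) * (D k * Y js) = m2 * (C (Suc k) * y)" using m2(2)[of y] by (simp add: Ye mult.assoc)
        have "h * (zc c *s Y js - g k * Y js) = zc c *s ((h * (E js * h')) * y) - (h * (C k * (D k * (E js * h')))) * y
           + (h * (C k * m1)) * (D (Suc k) * y) + (h * m2) * (C (Suc k) * y) - (h * m3) * (C (Suc k) * (D (Suc k) * y))"
          unfolding gY CDY DY m3(2) by (simp add: Ye algebra_simps mult_scale)
        moreover have "E ds * ((h * (E js * h')) * y) \<in> G" "E ds * ((h * (C k * (D k * (E js * h')))) * y) \<in> G"
          "E ds * ((h * (C k * m1)) * (D (Suc k) * y)) \<in> G" "E ds * ((h * m2) * (C (Suc k) * y)) \<in> G"
          "E ds * ((h * m3) * (C (Suc k) * (D (Suc k) * y))) \<in> G"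
          by (intro one Hs_mult h Em m m1(1) m2(1) m3(1) y VC)+
        ultimately show ?thesis
          by (simp only: distrib_left right_diff_distrib mult_scale)
            (intro subspace_add[OF Gs] subspace_diff[OF Gs] subspace_scale[OF Gs])
      qed
      have "T k * Y js = inverse (zc c - zc d) *s (p + eps *s (zc c *s Y js - g k * Y js))"
        using ne by (simp add: Phi)
      then have "E ds * (h * (T k * Y js)) = inverse (zc c - zc d) *s (E ds * (h * p) + eps *s (E ds * (h * (zc c *s Y js - g k * Y js))))"
        by (simp only: mult_scale distrib_left)
      then show ?thesis using hp hg subspace_add[OF Gs] subspace_scale[OF Gs] by simp
    qed
    have "E ds * (h * (T k * (h' * y))) = (\<Sum>js\<in>Std k. E ds * (h * (T k * Y js)))"
      unfolding sum by (simp only: sum_distrib_left)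
    then show ?thesis using subspace_sum[OF Gs part] by simp
  qed
  have "E ds * w \<in> G" if "w \<in> dcoset k V" for w
    using that
  proof (induction rule: dcoset.induct)
    case (dc_add x y)
    then show ?case using subspace_add[OF Gs] by (simp add: distrib_left)
  qed (use one two in auto)
  then show ?case using rx by (simp add: G_def)
qed

section \<open>Complements\<close>

lemma four_nz: "(4::'a) \<noteq> 0"
proof -
  have "(4::'a) = 2 * 2" by simp
  then show ?thesis using two by (metis mult_eq_0_iff)
qed

text \<open>Averaging as in Maschke's theorem, one generator at a time, starting from any linear
  projection. Commutation with the generators already treated survives, since they anticommute with
  the new one and the two signs cancel.\<close>

lemma anticommuting_projection:
  assumes N: "subspace N" "N \<subseteq> Wa"
    and st: "\<And>s x. s \<in> set ss \<Longrightarrow> x \<in> Wa \<Longrightarrow> s * x \<in> Wa" "\<And>s x. s \<in> set ss \<Longrightarrow> x \<in> N \<Longrightarrow> s * x \<in> N"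
    and sq: "\<And>s. s \<in> set ss \<Longrightarrow> \<exists>k. k \<noteq> 0 \<and> (\<forall>x\<in>Wa. s * (s * x) = k *s x)"
    and anti: "sorted_wrt (\<lambda>s t. \<forall>x\<in>Wa. s * (t * x) = - (t * (s * x))) ss"
  shows "\<exists>p. (\<forall>x y. p (x + y) = p x + p y) \<and> (\<forall>k x. p (k *s x) = k *s p x) \<and>
    (\<forall>x\<in>Wa. p x \<in> N) \<and> (\<forall>x\<in>N. p x = x) \<and> (\<forall>s\<in>set ss. \<forall>x\<in>Wa. p (s * x) = s * p x)"
  using st sq anti
proof (induction ss)
  case Nil
  interpret vp: vector_space_pair scale scale ..
  have lid: "Vector_Spaces.linear scale scale (\<lambda>x. x)" by (rule linear_ident)
  obtain p where p: "range p \<subseteq> N" "Vector_Spaces.linear scale scale p" "\<forall>v\<in>N. p v = v"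
    using vp.linear_exists_left_inverse_on[OF lid N(1)] by (auto simp: inj_on_def)
  have "p (x + y) = p x + p y" "p (k *s x) = k *s p x" for x y k
    using vp.linear_add[OF p(2)] vp.linear_scale[OF p(2)] by auto
  then show ?case using p by (intro exI[of _ p]) auto
next
  case (Cons s ss)
  have "\<exists>p. (\<forall>x y. p (x + y) = p x + p y) \<and> (\<forall>k x. p (k *s x) = k *s p x) \<and>
    (\<forall>x\<in>Wa. p x \<in> N) \<and> (\<forall>x\<in>N. p x = x) \<and> (\<forall>s\<in>set ss. \<forall>x\<in>Wa. p (s * x) = s * p x)"
    by (rule Cons.IH) (use Cons.prems in auto)
  then obtain p where "(\<forall>x y. p (x + y) = p x + p y)" "(\<forall>k x. p (k *s x) = k *s p x)"
    "(\<forall>x\<in>Wa. p x \<in> N)" "(\<forall>x\<in>N. p x = x)" "(\<forall>s\<in>set ss. \<forall>x\<in>Wa. p (s * x) = s * p x)" by blast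
  then have p: "\<And>x y. p (x + y) = p x + p y" "\<And>k x. p (k *s x) = k *s p x"
    "\<And>x. x \<in> Wa \<Longrightarrow> p x \<in> N" "\<And>x. x \<in> N \<Longrightarrow> p x = x" "\<And>t x. t \<in> set ss \<Longrightarrow> x \<in> Wa \<Longrightarrow> p (t * x) = t * p x"
    by auto
  obtain k where k: "k \<noteq> 0" "\<And>x. x \<in> Wa \<Longrightarrow> s * (s * x) = k *s x" using Cons.prems(3)[of s] by auto
  have sW: "x \<in> Wa \<Longrightarrow> s * x \<in> Wa" "x \<in> N \<Longrightarrow> s * x \<in> N" for x using Cons.prems by auto
  have pW: "p x \<in> Wa" if "x \<in> Wa" for x using p(3)[OF that] N by auto
  have pm: "p (- x) = - p x" for x using p(2)[of "- 1" x] by simp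
  \<comment> \<open>The average of \<open>p\<close> and its conjugate by \<open>s\<close>, whose
    inverse on \<open>Wa\<close> is \<open>s\<close> divided by \<open>k\<close>.\<close>
  define p' where "p' x = inverse 2 *s (p x + inverse k *s (s * p (s * x)))" for x
  have "p' (x + y) = p' x + p' y" for x y
    by (simp add: p'_def p(1) distrib_left scale_right_distrib add_ac)
  moreover have "p' (l *s x) = l *s p' x" for l x
    by (simp add: p'_def p(2) mult_scale scale_right_distrib mult_ac)
  moreover have "p' x \<in> N" if "x \<in> Wa" for x
    unfolding p'_def by (intro subspace_scale[OF N(1)] subspace_add[OF N(1)] p(3) sW that)
  moreover have "p' x = x" if "x \<in> N" for x
  proof -
    have "x \<in> Wa" using that N by auto
    then have "p' x = inverse 2 *s (x + x)"
      using p(4)[OF that] p(4)[OF sW(2)[OF that]] k by (simp add: p'_def)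
    then show ?thesis using two by (simp only: scale2[symmetric] scale_scale) simp
  qed
  moreover have "p' (t * x) = t * p' x" if "t \<in> set (s # ss)" "x \<in> Wa" for t x
  proof (cases "t \<in> set ss")
    case True
    have at: "s * (t * y) = - (t * (s * y))" if "y \<in> Wa" for y using Cons.prems(4) True that by auto
    have "s * p (s * (t * x)) = t * (s * p (s * x))"
      using p(5)[OF True sW(1)[OF that(2)]] at[OF pW[OF sW(1)[OF that(2)]]] by (simp add: at[OF that(2)] pm)
    then show ?thesis using p(5)[OF True that(2)] by (simp add: p'_def mult_scale distrib_left)
  next
    case False
    then have t: "t = s" using that by simp
    have "p (s * (s * x)) = k *s p x" using k(2)[OF that(2)] by (simp add: p(2))
    moreover have "s * (s * p (s * x)) = k *s p (s * x)" using k(2) pW sW that by simp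
    ultimately show ?thesis using k(1) unfolding t p'_def
      by (simp add: mult_scale distrib_left add.commute)
  qed
  ultimately show ?case by (intro exI[of _ p']) auto
qed

lemma W_drop: "x \<in> W (bs @ cs) \<Longrightarrow> x \<in> W cs"
  by (induction bs) auto

lemma std_drop: "std (bs @ cs) \<Longrightarrow> std cs"
  by (induction bs) auto

lemma W_position:
  assumes cs: "std cs" "length cs \<le> n" and j: "1 \<le> j" "j \<le> length cs"
  obtains a where "\<And>x. x \<in> W cs \<Longrightarrow> z j * x = a *s x"
    "a * a \<noteq> 4 \<or> (\<forall>x\<in>W cs. D j * x = C j * x)"
proof -
  define i where "i = length cs - j"
  have i: "i < length cs" using j by (simp add: i_def)
  define c ts where "c = cs ! i" and "ts = drop (Suc i) cs"
  have dr: "cs = take i cs @ c # ts" using id_take_nth_drop[OF i] by (simp add: c_def ts_def)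
  have lt: "Suc (length ts) = j" using i j by (simp add: ts_def i_def)
  have stc: "std (c # ts)" using std_drop[of "take i cs" "c # ts"] cs dr by metis
  have Wc: "x \<in> W (c # ts)" if "x \<in> W cs" for x using W_drop[of x "take i cs" "c # ts"] that dr by metis
  have 1: "z j * x = zc c *s x" if "x \<in> W cs" for x using W_Cons_z[OF Wc[OF that]] lt by simp
  have "zc c * zc c \<noteq> 4 \<or> (\<forall>x\<in>W cs. D j * x = C j * x)"
  proof (cases "c = 0")
    case True
    have "unip ts" using spectrum[of ts] stc lt j cs by auto
    then have "D j * x = C j * x" if "x \<in> W cs" for x
      using Wc[OF that] stc True lt by (auto simp: unip_def)
    then show ?thesis by blast
  next
    case False
    have "c \<le> length ts" using addable_le_sum[OF finite_shape, of c ts] sum_shape[of ts] stc by simp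
    then show ?thesis using zc_sq[OF False] lt j cs by simp
  qed
  then show thesis using that 1 by blast
qed

lemma Clifford_complement:
  assumes cs: "std cs" "length cs \<le> n" and I: "Clifford_stable (length cs) I"
  obtains U where "Clifford_stable (length cs) U" "U \<subseteq> W cs" "U \<inter> I = {0}"
    "\<And>y. y \<in> W cs \<Longrightarrow> \<exists>a\<in>I \<inter> W cs. \<exists>u\<in>U. y = a + u"
proof -
  define m where "m = length cs"
  define N where "N = I \<inter> W cs"
  have mn: "m \<le> n" using cs by (simp add: m_def)
  have "\<forall>j. \<exists>a. 1 \<le> j \<and> j \<le> m \<longrightarrow> (\<forall>x\<in>W cs. z j * x = a *s x) \<and> (a * a \<noteq> 4 \<or> (\<forall>x\<in>W cs. D j * x = C j * x))"
    using W_position[OF cs] unfolding m_def by metis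
  then obtain a where a: "\<And>j x. 1 \<le> j \<Longrightarrow> j \<le> m \<Longrightarrow> x \<in> W cs \<Longrightarrow> z j * x = a j *s x"
    "\<And>j. 1 \<le> j \<Longrightarrow> j \<le> m \<Longrightarrow> a j * a j \<noteq> 4 \<or> (\<forall>x\<in>W cs. D j * x = C j * x)"
    by metis
  \<comment> \<open>Gram-Schmidt: \<open>B j\<close> anticommutes with \<open>C j\<close> and has
    square \<open>1 - a j * a j / 4\<close> on \<open>W cs\<close>. Where this is zero,
    \<open>D j\<close> and \<open>C j\<close> agree on \<open>W cs\<close> by
    \<open>W_position\<close>, and \<open>B j\<close> is left out of \<open>ss\<close>.\<close>
  define B where "B j = D j - (a j / 2) *s C j" for j
  have WC: "C j * x \<in> W cs" "D j * x \<in> W cs" if "1 \<le> j" "j \<le> m" "x \<in> W cs" for j x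
    using W_C[of cs j x] W_D[of cs j x] that cs by (auto simp: m_def)
  have IC: "C j * x \<in> I" "D j * x \<in> I" if "1 \<le> j" "j \<le> m" "x \<in> I" for j x
    using I that by (auto simp: Clifford_stable_def m_def)
  have Is: "subspace I" using I by (simp add: Clifford_stable_def)
  have NC: "C j * x \<in> N" "D j * x \<in> N" if "1 \<le> j" "j \<le> m" "x \<in> N" for j x
    using WC[OF that(1,2)] IC[OF that(1,2)] that(3) by (auto simp: N_def)
  have Ns: "subspace N" unfolding N_def by (intro subspace_inter Is W_subspace)
  have BX: "B j * x \<in> X" if "subspace X" "C j * x \<in> X" "D j * x \<in> X" for X j x
    unfolding B_def left_diff_distrib scale_mult by (intro subspace_diff subspace_scale that)
  have CCx: "C j * (C j * x) = x" "D j * (D j * x) = x" if "1 \<le> j" "j \<le> m" "x \<in> W cs" for j x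
    using CC[of j] D_D_eq[of j] W_e[OF that(3)] that mn by (auto simp: mult.assoc[symmetric])
  have CDx: "D j * (C j * x) = a j *s x - C j * (D j * x)" if "1 \<le> j" "j \<le> m" "x \<in> W cs" for j x
    using a(1)[OF that] by (simp add: z_def distrib_right mult.assoc algebra_simps)
  have half: "inverse 2 * b + inverse 2 * b = b" for b :: 'a
    using two by (simp add: field_simps flip: mult_2)
  have CB: "C j * (B i * x) = - (B i * (C j * x))" if "1 \<le> i" "i \<le> m" "1 \<le> j" "j \<le> m" "x \<in> W cs" for i j x
  proof (cases "i = j")
    case True
    have "C j * (B j * x) = C j * (D j * x) - (a j / 2) *s x"
      using CCx[OF that(3-5)] by (simp add: B_def left_diff_distrib right_diff_distrib scale_mult mult_scale)
    moreover have "B j * (C j * x) = (a j *s x - C j * (D j * x)) - (a j / 2) *s x"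
      using CCx[OF that(3-5)] CDx[OF that(3-5)] by (simp add: B_def left_diff_distrib scale_mult)
    moreover have "a j *s x = (a j / 2) *s x + (a j / 2) *s x"
      using half[of "a j"] by (simp add: scale_left_distrib[symmetric] field_simps)
    ultimately show ?thesis using True by simp
  next
    case False
    have "C j * D i = - (D i * C j)" "C j * C i = - (C i * C j)" using C_D[of j i] C_anti[of j i] that False mn by auto
    then have "C j * B i = - (B i * C j)" by (simp add: B_def left_diff_distrib right_diff_distrib scale_mult mult_scale)
    then show ?thesis by (simp only: assoc_vec) (simp add: mult.assoc)
  qed
  have BB: "B j * (B i * x) = - (B i * (B j * x))" if "i \<noteq> j" "1 \<le> i" "i \<le> m" "1 \<le> j" "j \<le> m" for i j x
  proof -
    have "C j * D i = - (D i * C j)" "C j * C i = - (C i * C j)" "D j * C i = - (C i * D j)" "D j * D i = - (D i * D j)"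
      using C_D[of j i] C_D[of i j] C_anti[of j i] D_anti[of j i] that mn by auto
    then have "B j * B i = - (B i * B j)"
      by (simp add: B_def left_diff_distrib right_diff_distrib scale_mult mult_scale scale_right_diff_distrib mult.commute)
    then show ?thesis by (simp only: assoc_vec) (simp add: mult.assoc)
  qed
  have B2: "B j * (B j * x) = (1 - a j * a j / 4) *s x" if "1 \<le> j" "j \<le> m" "x \<in> W cs" for j x
  proof -
    have "B j * (B j * x) = D j * (B j * x) - (a j / 2) *s (C j * (B j * x))"
      by (subst (1) B_def) (simp add: left_diff_distrib scale_mult)
    also have "D j * (B j * x) = x - (a j / 2) *s (a j *s x - C j * (D j * x))"
      using CCx[OF that] CDx[OF that] by (simp add: B_def left_diff_distrib right_diff_distrib scale_mult mult_scale)
    also have "C j * (B j * x) = C j * (D j * x) - (a j / 2) *s x"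
      using CCx[OF that] by (simp add: B_def left_diff_distrib right_diff_distrib scale_mult mult_scale)
    also have "x - (a j / 2) *s (a j *s x - C j * (D j * x)) - (a j / 2) *s (C j * (D j * x) - (a j / 2) *s x)
       = (1 - (a j / 2) * a j + (a j / 2) * (a j / 2)) *s x"
      by (simp only: scale_right_diff_distrib scale_left_diff_distrib scale_left_distrib scale_scale scale_one) simp
    also have "1 - (a j / 2) * a j + (a j / 2) * (a j / 2) = 1 - a j * a j / 4"
    proof -
      define b where "b = a j / 2"
      have b: "a j = 2 * b" using two by (simp add: b_def)
      have h: "a j / 2 = b" by (simp add: b_def)
      have f: "a j * a j / 4 = b * b" using four_nz by (simp add: b)
      show ?thesis unfolding h f unfolding b by (simp add: algebra_simps)
    qed
    finally show ?thesis .
  qed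
  define good where "good = filter (\<lambda>j. a j * a j \<noteq> 4) [1..<Suc m]"
  define ss where "ss = map C [1..<Suc m] @ map B good"
  have good: "j \<in> set good \<longleftrightarrow> 1 \<le> j \<and> j \<le> m \<and> a j * a j \<noteq> 4" for j by (auto simp: good_def)
  have range: "j \<in> set [1..<Suc m] \<longleftrightarrow> 1 \<le> j \<and> j \<le> m" for j by auto
  have "\<exists>p. (\<forall>x y. p (x + y) = p x + p y) \<and> (\<forall>k x. p (k *s x) = k *s p x) \<and>
    (\<forall>x\<in>W cs. p x \<in> N) \<and> (\<forall>x\<in>N. p x = x) \<and> (\<forall>s\<in>set ss. \<forall>x\<in>W cs. p (s * x) = s * p x)"
  proof (rule anticommuting_projection[OF Ns])
    show "N \<subseteq> W cs" by (auto simp: N_def)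
    show "s * x \<in> W cs" if "s \<in> set ss" "x \<in> W cs" for s x
      using that WC BX[OF W_subspace] unfolding ss_def set_append set_map Un_iff image_iff Bex_def range good by metis
    show "s * x \<in> N" if "s \<in> set ss" "x \<in> N" for s x
      using that NC BX[OF Ns] unfolding ss_def set_append set_map Un_iff image_iff Bex_def range good by metis
    fix s assume "s \<in> set ss"
    then consider j where "1 \<le> j" "j \<le> m" "s = C j" | j where "1 \<le> j" "j \<le> m" "a j * a j \<noteq> 4" "s = B j"
      unfolding ss_def set_append set_map Un_iff image_iff Bex_def range good by metis
    then show "\<exists>k. k \<noteq> 0 \<and> (\<forall>x\<in>W cs. s * (s * x) = k *s x)"
    proof cases
      case 1
      then show ?thesis using CCx by (intro exI[of _ 1]) simp
    next
      case 2
      then show ?thesis using B2 four_nz by (intro exI[of _ "1 - a j * a j / 4"]) (simp add: field_simps)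
    qed
  next
    have 1: "sorted_wrt (\<lambda>i j. \<forall>x\<in>W cs. C i * (C j * x) = - (C j * (C i * x))) [1..<Suc m]"
    proof (rule sorted_wrt_mono_rel[OF _ sorted_wrt_upt])
      fix i j assume ij: "i \<in> set [1..<Suc m]" "j \<in> set [1..<Suc m]" "i < j"
      have "C i * C j = - (C j * C i)" using C_anti[of i j] ij mn by auto
      then show "\<forall>x\<in>W cs. C i * (C j * x) = - (C j * (C i * x))" by (simp only: assoc_vec) (simp add: mult.assoc)
    qed
    have "sorted_wrt (<) good" unfolding good_def by (intro sorted_wrt_filter sorted_wrt_upt)
    then have 2: "sorted_wrt (\<lambda>i j. \<forall>x\<in>W cs. B i * (B j * x) = - (B j * (B i * x))) good"
    proof (rule sorted_wrt_mono_rel[rotated])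
      fix i j assume "i \<in> set good" "j \<in> set good" "i < j"
      then show "\<forall>x\<in>W cs. B i * (B j * x) = - (B j * (B i * x))" by (intro ballI BB) (auto simp: good)
    qed
    show "sorted_wrt (\<lambda>s t. \<forall>x\<in>W cs. s * (t * x) = - (t * (s * x))) ss"
      unfolding ss_def sorted_wrt_append sorted_wrt_map using 1 2 CB by (auto simp: good)
  qed
  then obtain p where p: "\<And>x y. p (x + y) = p x + p y" "\<And>k x. p (k *s x) = k *s p x"
    "\<And>x. x \<in> W cs \<Longrightarrow> p x \<in> N" "\<And>x. x \<in> N \<Longrightarrow> p x = x"
    "\<And>s x. s \<in> set ss \<Longrightarrow> x \<in> W cs \<Longrightarrow> p (s * x) = s * p x" by metis
  have pC: "p (C j * x) = C j * p x" if "1 \<le> j" "j \<le> m" "x \<in> W cs" for j x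
  proof (rule p(5)[OF _ that(3)])
    show "C j \<in> set ss" unfolding ss_def set_append set_map Un_iff using range[of j] that by blast
  qed
  have pD: "p (D j * x) = D j * p x" if j: "1 \<le> j" "j \<le> m" and x: "x \<in> W cs" for j x
  proof (cases "a j * a j = 4")
    case True
    have "p x \<in> W cs" using p(3)[OF x] by (simp add: N_def)
    then show ?thesis using a(2)[OF j] True x pC[OF j x] by simp
  next
    case False
    have "B j \<in> set ss" unfolding ss_def set_append set_map Un_iff using good[of j] j False by blast
    then have "p (B j * x) = B j * p x" by (rule p(5)[OF _ x])
    moreover have "D j * y = B j * y + (a j / 2) *s (C j * y)" for y by (simp add: B_def left_diff_distrib scale_mult)
    ultimately show ?thesis using pC[OF j x] by (simp add: p(1,2))
  qed
  have p0: "p 0 = 0" using p(2)[of 0 0] by simp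
  define U where "U = {x \<in> W cs. p x = 0}"
  show thesis
  proof
    show "Clifford_stable (length cs) U"
      unfolding Clifford_stable_def m_def[symmetric] U_def
      using W_subspace[of cs] WC pC pD by (auto simp: subspace_def p p0)
    show "U \<subseteq> W cs" by (auto simp: U_def)
    show "U \<inter> I = {0}" using p(4) p0 subspace_0[OF Is] subspace_0[OF W_subspace[of cs]] by (auto simp: U_def N_def)
    fix y assume y: "y \<in> W cs"
    have "p (y - p y) = 0"
      using p(1)[of "y - p y" "p y"] p(4)[OF p(3)[OF y]] by simp
    moreover have "p y \<in> W cs" using p(3)[OF y] by (simp add: N_def)
    ultimately have "y - p y \<in> U" using y subspace_diff[OF W_subspace] by (simp add: U_def)
    then show "\<exists>a\<in>I \<inter> W cs. \<exists>u\<in>U. y = a + u" using p(3)[OF y] unfolding N_def by (intro bexI[of _ "p y"] bexI[of _ "y - p y"]) auto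
  qed
qed

theorem left_ideal_complement:
  assumes I: "subspace I" "\<And>r x. r \<in> Hs n \<Longrightarrow> x \<in> I \<Longrightarrow> r * x \<in> I"
  obtains J where "subspace J" "J \<subseteq> W []" "\<And>r x. r \<in> Hs n \<Longrightarrow> x \<in> J \<Longrightarrow> r * x \<in> J"
    "I \<inter> J = {0}" "\<And>y. y \<in> W [] \<Longrightarrow> \<exists>a\<in>I. \<exists>b\<in>J. y = a + b"
proof -
  have Ist: "Clifford_stable n I" using I(1) by (auto simp: Clifford_stable_def intro!: I(2) Hs_C Hs_D)
  have "\<forall>cs. \<exists>U. cs \<in> Std n \<longrightarrow> Clifford_stable n U \<and> U \<subseteq> W cs \<and> U \<inter> I = {0} \<and>
      (\<forall>y\<in>W cs. \<exists>a\<in>I \<inter> W cs. \<exists>u\<in>U. y = a + u)"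
  proof
    fix cs
    show "\<exists>U. cs \<in> Std n \<longrightarrow> Clifford_stable n U \<and> U \<subseteq> W cs \<and> U \<inter> I = {0} \<and>
      (\<forall>y\<in>W cs. \<exists>a\<in>I \<inter> W cs. \<exists>u\<in>U. y = a + u)"
    proof (cases "cs \<in> Std n")
      case True
      then have l: "std cs" "length cs \<le> n" "length cs = n" by (auto simp: Std_def)
      show ?thesis using Clifford_complement[OF l(1,2), of I] Ist unfolding l(3) by metis
    qed simp
  qed
  then obtain U where U: "\<And>cs. cs \<in> Std n \<Longrightarrow> Clifford_stable n (U cs)" "\<And>cs. cs \<in> Std n \<Longrightarrow> U cs \<subseteq> W cs"
    "\<And>cs. cs \<in> Std n \<Longrightarrow> U cs \<inter> I = {0}"
    "\<And>cs y. cs \<in> Std n \<Longrightarrow> y \<in> W cs \<Longrightarrow> \<exists>a\<in>I \<inter> W cs. \<exists>u\<in>U cs. y = a + u"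
    by metis
  \<comment> \<open>The choice depends on \<open>cs\<close> through its shape only.\<close>
  define rep where "rep cs = (SOME ds. ds \<in> Std n \<and> shape ds = shape cs)" for cs
  have rep: "rep cs \<in> Std n" "shape (rep cs) = shape cs" if "cs \<in> Std n" for cs
    using someI[of "\<lambda>ds. ds \<in> Std n \<and> shape ds = shape cs" cs] that by (auto simp: rep_def)
  have rep_eq: "rep cs = rep ds" if "shape cs = shape ds" for cs ds using that by (simp add: rep_def)
  have link: "\<exists>r\<in>Hs n. \<exists>r'\<in>Hs n. \<forall>x\<in>W cs. r * x \<in> W (rep cs) \<and> r' * (r * x) = x" if cs: "cs \<in> Std n" for cs
  proof -
    have "conn cs (rep cs)" using transport[of cs "rep cs"] rep[OF cs] cs by (auto simp: Std_def)
    moreover have "length cs = n" using cs by (simp add: Std_def)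
    ultimately show ?thesis unfolding conn_def Tr_def by auto
  qed
  \<comment> \<open>The largest left ideal inside \<open>W []\<close> whose parts in the chosen
    weight spaces lie in the complements \<open>U\<close>.\<close>
  define J where "J = {y \<in> W []. \<forall>cs\<in>Std n. \<forall>r\<in>Hs n. E (rep cs) * (r * y) \<in> U (rep cs)}"
  have Us: "subspace (U (rep cs))" if "cs \<in> Std n" for cs
    using U(1)[OF rep(1)[OF that]] by (simp add: Clifford_stable_def)
  have HW: "r * x \<in> W []" if "r \<in> Hs n" for r x using Hs_unit[OF that] by (simp add: mult.assoc[symmetric])
  have Js: "subspace J"
    unfolding J_def subspace_def using W_subspace[of "[]"] Us
    by (auto simp: distrib_left mult_scale subspace_def)
  have JH: "r * x \<in> J" if r: "r \<in> Hs n" and x: "x \<in> J" for r x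
  proof -
    have "E (rep cs) * (s * (r * x)) \<in> U (rep cs)" if "cs \<in> Std n" "s \<in> Hs n" for cs s
    proof -
      have "E (rep cs) * ((s * r) * x) \<in> U (rep cs)" using x that Hs_mult[OF that(2) r] by (simp add: J_def)
      then show ?thesis by (simp add: mult.assoc)
    qed
    then show ?thesis using HW[OF r] by (simp add: J_def)
  qed
  have EH: "E cs \<in> Hs n" if "cs \<in> Std n" for cs using E_Hs[of cs] that by (simp add: Std_def)
  have disj: "y = 0" if yI: "y \<in> I" and yJ: "y \<in> J" for y
  proof -
    have yW: "y \<in> W []" using yJ by (simp add: J_def)
    have "E cs * y = 0" if cs: "cs \<in> Std n" for cs
    proof -
      obtain r r' where r: "r \<in> Hs n" "r' \<in> Hs n" "\<And>x. x \<in> W cs \<Longrightarrow> r * x \<in> W (rep cs) \<and> r' * (r * x) = x"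
        using link[OF cs] by metis
      have EW: "E cs * y \<in> W cs" by (rule E_W) (use cs yW in \<open>auto simp: Std_def\<close>)
      have "r * (E cs * y) \<in> W (rep cs)" using r EW by blast
      then have "E (rep cs) * (r * (E cs * y)) = r * (E cs * y)"
        using E_id[of "rep cs"] rep[OF cs] by (auto simp: Std_def)
      moreover have "E (rep cs) * ((r * E cs) * y) \<in> U (rep cs)"
        using yJ cs r EH[OF cs] by (simp add: J_def Hs_mult)
      ultimately have "r * (E cs * y) \<in> U (rep cs)" by (simp add: mult.assoc)
      moreover have "r * (E cs * y) \<in> I" using I(2) r EH[OF cs] yI by blast
      ultimately have "r * (E cs * y) = 0" using U(3)[OF rep(1)[OF cs]] by blast
      then show ?thesis using r(3)[OF EW] by simp
    qed
    then show ?thesis using E_separate[of n y] yW by simp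
  qed
  \<comment> \<open>By \<open>corner\<close>, the left ideal generated by \<open>U (rep cs)\<close>
    meets its own chosen weight space in \<open>U (rep cs)\<close> and projects to 0 in those of
    other shapes.\<close>
  have UJ: "r * u \<in> J" if cs: "cs \<in> Std n" and r: "r \<in> Hs n" and u: "u \<in> U (rep cs)" for cs r u
    unfolding J_def
  proof (intro CollectI conjI ballI)
    show "r * u \<in> W []" by (rule HW[OF r])
    fix cs2 r2 assume cs2: "cs2 \<in> Std n" and r2: "r2 \<in> Hs n"
    have "E (rep cs2) * ((r2 * r) * u) \<in> target (rep cs) (rep cs2) (U (rep cs))"
      by (rule corner[OF order_refl rep(1)[OF cs] rep(1)[OF cs2] U(1)[OF rep(1)[OF cs]] u])
        (use U(2)[OF rep(1)[OF cs]] u r r2 in \<open>auto intro: Hs_mult\<close>)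
    moreover have "target (rep cs) (rep cs2) (U (rep cs)) \<subseteq> U (rep cs2)"
      using rep[OF cs] rep[OF cs2] rep_eq[of cs cs2] subspace_0[OF Us[OF cs2]] by (auto simp: target_def)
    ultimately show "E (rep cs2) * (r2 * (r * u)) \<in> U (rep cs2)" by (auto simp: mult.assoc)
  qed
  have one: "\<exists>a\<in>I. \<exists>b\<in>J. y = a + b" if cs: "cs \<in> Std n" and y: "y \<in> W cs" for cs y
  proof -
    obtain r r' where r: "r \<in> Hs n" "r' \<in> Hs n" "\<And>x. x \<in> W cs \<Longrightarrow> r * x \<in> W (rep cs) \<and> r' * (r * x) = x"
      using link[OF cs] by metis
    obtain a u where au: "a \<in> I" "u \<in> U (rep cs)" "r * y = a + u"
      using U(4)[OF rep(1)[OF cs], of "r * y"] r(3)[OF y] by auto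
    have "y = r' * a + r' * u" using r(3)[OF y] au(3) by (simp add: distrib_left)
    then show ?thesis using I(2)[OF r(2) au(1)] UJ[OF cs r(2) au(2)] by blast
  qed
  have all: "\<exists>a\<in>I. \<exists>b\<in>J. y = a + b" if y: "y \<in> W []" for y
  proof -
    have "\<forall>cs. \<exists>a b. cs \<in> Std n \<longrightarrow> a \<in> I \<and> b \<in> J \<and> E cs * y = a + b"
    proof
      fix cs
      show "\<exists>a b. cs \<in> Std n \<longrightarrow> a \<in> I \<and> b \<in> J \<and> E cs * y = a + b"
      proof (cases "cs \<in> Std n")
        case True
        have "E cs * y \<in> W cs" by (rule E_W) (use True y in \<open>auto simp: Std_def\<close>)
        then show ?thesis using one[OF True] by blast
      qed simp
    qed
    then obtain a b where ab: "\<And>cs. cs \<in> Std n \<Longrightarrow> a cs \<in> I \<and> b cs \<in> J \<and> E cs * y = a cs + b cs" by metis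
    have "y = (\<Sum>cs\<in>Std n. E cs * y)" using E_sum[of n y] y by simp
    also have "\<dots> = (\<Sum>cs\<in>Std n. a cs) + (\<Sum>cs\<in>Std n. b cs)"
      unfolding sum.distrib[symmetric] by (rule sum.cong) (use ab in auto)
    finally show ?thesis using subspace_sum[OF I(1), of "Std n" a] subspace_sum[OF Js, of "Std n" b] ab by blast
  qed
  show thesis
  proof (rule that[OF Js _ JH _ all])
    show "J \<subseteq> W []" by (auto simp: J_def)
    show "I \<inter> J = {0}" using disj subspace_0[OF I(1)] subspace_0[OF Js] by auto
  qed
qed

end

section \<open>Hecke-Clifford algebras inside a ring type\<close>

abbreviation hc_free :: "nat \<Rightarrow> (hc_generator free_monoid \<Rightarrow>\<^sub>0 'a::field) ring"
  where "hc_free n \<equiv> free_algebra (hc_generators n)"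

definition hc_ideal :: "nat \<Rightarrow> 'a::field \<Rightarrow> (hc_generator free_monoid \<Rightarrow>\<^sub>0 'a) set"
  where "hc_ideal n q = genideal (hc_free n) (hc_relators n q)"

definition cls :: "nat \<Rightarrow> 'a::field \<Rightarrow> (hc_generator free_monoid \<Rightarrow>\<^sub>0 'a) \<Rightarrow> (hc_generator free_monoid \<Rightarrow>\<^sub>0 'a) set"
  where "cls n q x = hc_ideal n q +>\<^bsub>hc_free n\<^esub> x"

interpretation hcF: ring "hc_free n" for n by (rule ring_free_algebra)

interpretation hcR: ring "hecke_clifford n q" for n q by (rule ring_hecke_clifford)

lemma free_algebra_ops [simp]:
  "x \<oplus>\<^bsub>free_algebra X\<^esub> y = x + y" "x \<otimes>\<^bsub>free_algebra X\<^esub> y = x * y"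
  "\<one>\<^bsub>free_algebra X\<^esub> = 1" "\<zero>\<^bsub>free_algebra X\<^esub> = 0"
  by (simp_all add: free_algebra_def)

lemma hc_ideal: "ideal (hc_ideal n q) (hc_free n)"
  unfolding hc_ideal_def by (rule hcF.genideal_ideal[OF hc_relators_closed])

lemma hecke_clifford_quot: "hecke_clifford n q = hc_free n Quot hc_ideal n q"
  by (simp add: hecke_clifford_def hc_ideal_def)

lemma cls_hom: "cls n q \<in> ring_hom (hc_free n) (hecke_clifford n q)"
  unfolding hecke_clifford_quot cls_def[abs_def] by (rule ideal.rcos_ring_hom[OF hc_ideal])

lemma cls_closed: "x \<in> carrier (hc_free n) \<Longrightarrow> cls n q x \<in> carrier (hecke_clifford n q)"
  and cls_add: "x \<in> carrier (hc_free n) \<Longrightarrow> y \<in> carrier (hc_free n) \<Longrightarrow> cls n q (x + y) = cls n q x \<oplus>\<^bsub>hecke_clifford n q\<^esub> cls n q y"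
  and cls_mult: "x \<in> carrier (hc_free n) \<Longrightarrow> y \<in> carrier (hc_free n) \<Longrightarrow> cls n q (x * y) = cls n q x \<otimes>\<^bsub>hecke_clifford n q\<^esub> cls n q y"
  and cls_one: "cls n q 1 = \<one>\<^bsub>hecke_clifford n q\<^esub>"
  using ring_hom_closed[OF cls_hom] ring_hom_add[OF cls_hom] ring_hom_mult[OF cls_hom] ring_hom_one[OF cls_hom]
  by fastforce+

lemma cls_surj: assumes "X \<in> carrier (hecke_clifford n q)"
  obtains x where "x \<in> carrier (hc_free n)" "X = cls n q x"
proof -
  interpret I: ideal "hc_ideal n q" "hc_free n" by (rule hc_ideal)
  show thesis using assms that by (auto simp: hecke_clifford_quot FactRing_def A_RCOSETS_def' cls_def)
qed

lemma hc_gens_closed: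
  "1 \<le> i \<Longrightarrow> i < n \<Longrightarrow> hc_T i \<in> carrier (hc_free n)"
  "1 \<le> j \<Longrightarrow> j \<le> n \<Longrightarrow> hc_C j \<in> carrier (hc_free n)"
  "scalar a \<in> carrier (free_algebra X)"
  by (auto simp: free_algebra_def gen_def hc_generators_def scalar_def zero_free_monoid_def)

lemma hc_closed:
  "x \<in> carrier (free_algebra X) \<Longrightarrow> y \<in> carrier (free_algebra X) \<Longrightarrow> x + y \<in> carrier (free_algebra X)"
  "x \<in> carrier (free_algebra X) \<Longrightarrow> y \<in> carrier (free_algebra X) \<Longrightarrow> x * y \<in> carrier (free_algebra X)"
  "x \<in> carrier (free_algebra X) \<Longrightarrow> - x \<in> carrier (free_algebra X)"
  "1 \<in> carrier (free_algebra X)" "0 \<in> carrier (free_algebra X)"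
proof -
  interpret F: ring "free_algebra X" by (rule ring_free_algebra)
  show "x \<in> carrier (free_algebra X) \<Longrightarrow> y \<in> carrier (free_algebra X) \<Longrightarrow> x + y \<in> carrier (free_algebra X)"
    using F.a_closed[of x y] by simp
  show "x \<in> carrier (free_algebra X) \<Longrightarrow> y \<in> carrier (free_algebra X) \<Longrightarrow> x * y \<in> carrier (free_algebra X)"
    using F.m_closed[of x y] by simp
  show "x \<in> carrier (free_algebra X) \<Longrightarrow> - x \<in> carrier (free_algebra X)"
    by (auto simp: free_algebra_def in_keys_iff)
  show "1 \<in> carrier (free_algebra X)" "0 \<in> carrier (free_algebra X)"
    using F.one_closed F.zero_closed by simp_all
qed

lemma hc_closed_diff: "x \<in> carrier (free_algebra X) \<Longrightarrow> y \<in> carrier (free_algebra X) \<Longrightarrow> x - y \<in> carrier (free_algebra X)"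
  using hc_closed(1)[of x X "- y"] hc_closed(3)[of y X] by simp

lemma free_a_minus: assumes "x \<in> carrier (free_algebra X)" "y \<in> carrier (free_algebra X)"
  shows "x \<ominus>\<^bsub>free_algebra X\<^esub> y = x - y"
proof -
  interpret F: ring "free_algebra X" by (rule ring_free_algebra)
  have "\<ominus>\<^bsub>free_algebra X\<^esub> y = - y"
    by (rule F.minus_equality) (use assms hc_closed in auto)
  then show ?thesis by (simp add: a_minus_def)
qed

lemma cls_eq_iff: assumes "x \<in> carrier (hc_free n)" "y \<in> carrier (hc_free n)"
  shows "cls n q x = cls n q y \<longleftrightarrow> x - y \<in> hc_ideal n q"
  using hcF.quotient_eq_iff_same_a_r_cos[OF hc_ideal assms] free_a_minus[OF assms] by (simp add: cls_def)

lemma cls_relation: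
  assumes "x - y \<in> hc_relators n q" "x \<in> carrier (hc_free n)" "y \<in> carrier (hc_free n)"
  shows "cls n q x = cls n q y"
  using hcF.genideal_self[OF hc_relators_closed, of n q] assms cls_eq_iff[OF assms(2,3)] by (auto simp: hc_ideal_def)

lemma scalar_ops: "scalar (a + b) = scalar a + scalar b" "scalar (a * b) = scalar a * scalar b" "scalar 1 = 1"
  by (simp_all add: scalar_def single_add mult_single)

text \<open>Words grow by generators on the left, so \<open>P\<close> has to be followed only
  through left multiplication by single generators and scalars, and through sums.\<close>

lemma hc_induct [consumes 1, case_names one gen scalar add]:
  fixes p :: "'g free_monoid \<Rightarrow>\<^sub>0 'a::field"
  assumes "p \<in> carrier (free_algebra X)"
    and "P 1" "\<And>g x. g \<in> X \<Longrightarrow> x \<in> carrier (free_algebra X) \<Longrightarrow> P x \<Longrightarrow> P (gen g * x)"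
    and "\<And>a x. x \<in> carrier (free_algebra X) \<Longrightarrow> P x \<Longrightarrow> P (scalar a * x)"
    and "\<And>x y. x \<in> carrier (free_algebra X) \<Longrightarrow> y \<in> carrier (free_algebra X) \<Longrightarrow> P x \<Longrightarrow> P y \<Longrightarrow> P (x + y)"
  shows "P p"
proof -
  have word: "(Poly_Mapping.single (Word ws) 1 :: 'g free_monoid \<Rightarrow>\<^sub>0 'a) \<in> carrier (free_algebra X) \<and> P (Poly_Mapping.single (Word ws) 1)"
    if "set ws \<subseteq> X" for ws
    using that
  proof (induction ws)
    case Nil
    have "Poly_Mapping.single (Word []) 1 = (1 :: 'g free_monoid \<Rightarrow>\<^sub>0 'a)"
      by (simp add: zero_free_monoid_def[symmetric])
    then show ?case using assms(2) hc_closed(4)[of X] by simp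
  next
    case (Cons g ws)
    have "Poly_Mapping.single (Word (g # ws)) 1 = (gen g * Poly_Mapping.single (Word ws) 1 :: 'g free_monoid \<Rightarrow>\<^sub>0 'a)"
      by (simp add: gen_def mult_single plus_free_monoid_def)
    moreover have gX: "(gen g :: 'g free_monoid \<Rightarrow>\<^sub>0 'a) \<in> carrier (free_algebra X)"
      using Cons by (simp add: free_algebra_def gen_def)
    have IH: "(Poly_Mapping.single (Word ws) 1 :: 'g free_monoid \<Rightarrow>\<^sub>0 'a) \<in> carrier (free_algebra X)"
      "P (Poly_Mapping.single (Word ws) 1)" "g \<in> X" using Cons by auto
    ultimately show ?case using hc_closed(2)[OF gX IH(1)] assms(3)[OF IH(3,1,2)] by simp
  qed
  have "finite S \<Longrightarrow> Poly_Mapping.keys p = S \<Longrightarrow> p \<in> carrier (free_algebra X) \<Longrightarrow> P p" for S p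
  proof (induction S arbitrary: p rule: finite_induct)
    case empty
    have "P (scalar 0 * 1)" by (rule assms(4)[OF hc_closed(4) assms(2)])
    then show ?case using empty by (simp add: scalar_def)
  next
    case (insert w S)
    define c where "c = Poly_Mapping.lookup p w"
    define r where "r = p - Poly_Mapping.single w c"
    obtain ws where ws: "w = Word ws" by (cases w)
    have wX: "set ws \<subseteq> X" using insert.prems ws by (auto simp: free_algebra_def)
    have "Poly_Mapping.single w c = scalar c * Poly_Mapping.single (Word ws) 1"
      by (simp add: scalar_def mult_single ws)
    then have s: "Poly_Mapping.single w c \<in> carrier (free_algebra X)" "P (Poly_Mapping.single w c)"
      using word[OF wX] assms(4) hc_closed(2) hc_gens_closed(3) by metis+
    have keys: "Poly_Mapping.keys r = S"
    proof -
      have "v \<in> Poly_Mapping.keys r \<longleftrightarrow> v \<in> S" for v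
        using insert.hyps(2) insert.prems(1) in_keys_iff[of v p]
        by (cases "v = w") (auto simp: r_def c_def in_keys_iff lookup_minus lookup_single)
      then show ?thesis by blast
    qed
    have r: "r \<in> carrier (free_algebra X)" unfolding r_def by (rule hc_closed_diff[OF insert.prems(2) s(1)])
    have "P (r + Poly_Mapping.single w c)" by (rule assms(5)[OF r s(1) insert.IH[OF keys r] s(2)])
    then show ?case by (simp add: r_def)
  qed
  then show ?thesis using finite_keys[of p] assms(1) by metis
qed

lemma scalar_central: "x * scalar a = scalar a * (x :: 'g free_monoid \<Rightarrow>\<^sub>0 'a::field)"
proof -
  have "x \<in> carrier (free_algebra UNIV)" by (simp add: free_algebra_def)
  then show ?thesis
  proof (induction rule: hc_induct)
    case (gen g x)
    have "gen g * scalar a = scalar a * (gen g :: 'g free_monoid \<Rightarrow>\<^sub>0 'a)"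
      by (simp add: gen_def scalar_def mult_single)
    then have "gen g * x * scalar a = gen g * (scalar a * x)" by (simp only: mult.assoc gen)
    also have "\<dots> = scalar a * (gen g * x)" by (simp only: mult.assoc[symmetric] \<open>gen g * scalar a = scalar a * gen g\<close>)
    finally show ?case .
  next
    case (scalar b x)
    have "scalar b * scalar a = scalar a * (scalar b :: 'g free_monoid \<Rightarrow>\<^sub>0 'a)"
      by (simp add: scalar_def mult_single mult.commute)
    then have "scalar b * x * scalar a = scalar b * (scalar a * x)" by (simp only: mult.assoc scalar)
    also have "\<dots> = scalar a * (scalar b * x)" by (simp only: mult.assoc[symmetric] \<open>scalar b * scalar a = scalar a * scalar b\<close>)
    finally show ?case .
  qed (simp_all add: distrib_left distrib_right)
qed

text \<open>The algebras depend on \<open>n\<close> and \<open>q\<close>, a type cannot; so the ring type is the product over all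
  \<open>(n, q)\<close>, in which each algebra is a corner.\<close>
typedef (overloaded) 'a hc_prod =
  "{f :: nat \<times> 'a::field \<Rightarrow> (hc_generator free_monoid \<Rightarrow>\<^sub>0 'a) set. \<forall>n q. f (n, q) \<in> carrier (hecke_clifford n q)}"
  morphisms comp Abs_hc_prod
  by (rule exI[of _ "\<lambda>(n, q). \<zero>\<^bsub>hecke_clifford n q\<^esub>"]) simp

lemma comp_closed [simp]: "comp f (n, q) \<in> carrier (hecke_clifford n q)"
  using comp[of f] by blast

lemma comp_Abs: "(\<And>n q. f (n, q) \<in> carrier (hecke_clifford n q)) \<Longrightarrow> comp (Abs_hc_prod f) = f"
  by (rule Abs_hc_prod_inverse) blast

lemma hc_prod_eqI: "(\<And>n q. comp f (n, q) = comp g (n, q)) \<Longrightarrow> f = g"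
  by (metis comp_inject ext surj_pair)

instantiation hc_prod :: (field) ring
begin

definition zero_hc_prod :: "'a hc_prod" where "0 = Abs_hc_prod (\<lambda>(n, q). \<zero>\<^bsub>hecke_clifford n q\<^esub>)"
definition plus_hc_prod :: "'a hc_prod \<Rightarrow> 'a hc_prod \<Rightarrow> 'a hc_prod"
  where "f + g = Abs_hc_prod (\<lambda>(n, q). comp f (n, q) \<oplus>\<^bsub>hecke_clifford n q\<^esub> comp g (n, q))"
definition uminus_hc_prod :: "'a hc_prod \<Rightarrow> 'a hc_prod"
  where "- f = Abs_hc_prod (\<lambda>(n, q). \<ominus>\<^bsub>hecke_clifford n q\<^esub> comp f (n, q))"
definition minus_hc_prod :: "'a hc_prod \<Rightarrow> 'a hc_prod \<Rightarrow> 'a hc_prod" where "f - g = f + - (g :: 'a hc_prod)"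
definition times_hc_prod :: "'a hc_prod \<Rightarrow> 'a hc_prod \<Rightarrow> 'a hc_prod"
  where "f * g = Abs_hc_prod (\<lambda>(n, q). comp f (n, q) \<otimes>\<^bsub>hecke_clifford n q\<^esub> comp g (n, q))"

lemma comp_ops: "comp 0 (n, q) = \<zero>\<^bsub>hecke_clifford n q\<^esub>"
  "comp (f + g) (n, q) = comp f (n, q) \<oplus>\<^bsub>hecke_clifford n q\<^esub> comp g (n, q)"
  "comp (- f) (n, q) = \<ominus>\<^bsub>hecke_clifford n q\<^esub> comp f (n, q)"
  "comp (f * g) (n, q) = comp f (n, q) \<otimes>\<^bsub>hecke_clifford n q\<^esub> comp g (n, q)"
  by (simp_all add: zero_hc_prod_def plus_hc_prod_def uminus_hc_prod_def times_hc_prod_def comp_Abs)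

instance
proof
  fix f g h :: "'a hc_prod"
  show "f + g + h = f + (g + h)" by (rule hc_prod_eqI) (simp add: comp_ops hcR.a_assoc)
  show "f + g = g + f" by (rule hc_prod_eqI) (simp add: comp_ops hcR.a_comm)
  show "0 + f = f" by (rule hc_prod_eqI) (simp add: comp_ops)
  show "- f + f = 0" by (rule hc_prod_eqI) (simp add: comp_ops hcR.l_neg)
  show "f - g = f + - g" by (simp add: minus_hc_prod_def)
  show "f * g * h = f * (g * h)" by (rule hc_prod_eqI) (simp add: comp_ops hcR.m_assoc)
  show "(f + g) * h = f * h + g * h" by (rule hc_prod_eqI) (simp add: comp_ops hcR.l_distr)
  show "f * (g + h) = f * g + f * h" by (rule hc_prod_eqI) (simp add: comp_ops hcR.r_distr)
qed

end

definition hc_scale :: "'a::field \<Rightarrow> 'a hc_prod \<Rightarrow> 'a hc_prod"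
  where "hc_scale a f = Abs_hc_prod (\<lambda>(n, q). cls n q (scalar a) \<otimes>\<^bsub>hecke_clifford n q\<^esub> comp f (n, q))"

lemma comp_scale: "comp (hc_scale a f) (n, q) = cls n q (scalar a) \<otimes>\<^bsub>hecke_clifford n q\<^esub> comp f (n, q)"
  by (simp add: hc_scale_def comp_Abs cls_closed hc_gens_closed)

lemma cls_scalar_central: assumes "X \<in> carrier (hecke_clifford n q)"
  shows "X \<otimes>\<^bsub>hecke_clifford n q\<^esub> cls n q (scalar a) = cls n q (scalar a) \<otimes>\<^bsub>hecke_clifford n q\<^esub> X"
proof -
  obtain x where x: "x \<in> carrier (hc_free n)" "X = cls n q x" using cls_surj[OF assms] .
  show ?thesis unfolding x(2) using cls_mult[OF x(1) hc_gens_closed(3)] cls_mult[OF hc_gens_closed(3) x(1)]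
    by (metis scalar_central)
qed

interpretation hc: assoc_algebra hc_scale
proof
  fix a b :: 'a and f g :: "'a hc_prod"
  have s: "cls n q (scalar c) \<in> carrier (hecke_clifford n q)" for n q and c :: 'a
    by (simp add: cls_closed hc_gens_closed)
  show "hc_scale a (f + g) = hc_scale a f + hc_scale a g"
    by (rule hc_prod_eqI) (simp add: comp_ops comp_scale s hcR.r_distr)
  show "hc_scale (a + b) f = hc_scale a f + hc_scale b f"
    by (rule hc_prod_eqI) (simp add: comp_ops comp_scale s scalar_ops cls_add hc_gens_closed hcR.l_distr)
  show "hc_scale a (hc_scale b f) = hc_scale (a * b) f"
    by (rule hc_prod_eqI) (simp add: comp_scale s scalar_ops cls_mult hc_gens_closed hcR.m_assoc)
  show "hc_scale 1 f = f"
    by (rule hc_prod_eqI) (simp add: comp_scale scalar_ops cls_one)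
  show "hc_scale a f * g = hc_scale a (f * g)"
    by (rule hc_prod_eqI) (simp add: comp_scale comp_ops s hcR.m_assoc)
  show "f * hc_scale a g = hc_scale a (f * g)"
    by (rule hc_prod_eqI) (simp add: comp_scale comp_ops s hcR.m_assoc[symmetric] cls_scalar_central)
qed

definition emb :: "nat \<Rightarrow> 'a::field \<Rightarrow> (hc_generator free_monoid \<Rightarrow>\<^sub>0 'a) set \<Rightarrow> 'a hc_prod"
  where "emb n q X = Abs_hc_prod (\<lambda>(m, r). if m = n \<and> r = q then X else \<zero>\<^bsub>hecke_clifford m r\<^esub>)"

lemma comp_emb: "X \<in> carrier (hecke_clifford n q) \<Longrightarrow>
    comp (emb n q X) (m, r) = (if m = n \<and> r = q then X else \<zero>\<^bsub>hecke_clifford m r\<^esub>)"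
  by (simp add: emb_def comp_Abs)

lemma emb_ops:
  assumes "X \<in> carrier (hecke_clifford n q)" "Y \<in> carrier (hecke_clifford n q)"
  shows "emb n q (X \<oplus>\<^bsub>hecke_clifford n q\<^esub> Y) = emb n q X + emb n q Y"
    "emb n q (X \<otimes>\<^bsub>hecke_clifford n q\<^esub> Y) = emb n q X * emb n q Y"
    "emb n q (cls n q (scalar a) \<otimes>\<^bsub>hecke_clifford n q\<^esub> X) = hc_scale a (emb n q X)"
  using assms by (auto intro!: hc_prod_eqI simp: comp_emb comp_ops comp_scale cls_closed hc_gens_closed)

lemma emb_inject: "X \<in> carrier (hecke_clifford n q) \<Longrightarrow> Y \<in> carrier (hecke_clifford n q) \<Longrightarrow> emb n q X = emb n q Y \<longleftrightarrow> X = Y"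
proof
  assume X: "X \<in> carrier (hecke_clifford n q)" and Y: "Y \<in> carrier (hecke_clifford n q)"
  have "comp (emb n q X) (n, q) = X" "comp (emb n q Y) (n, q) = Y"
    using comp_emb[OF X, of n q] comp_emb[OF Y, of n q] by simp_all
  then show "emb n q X = emb n q Y \<Longrightarrow> X = Y" by metis
qed simp

definition el :: "nat \<Rightarrow> 'a::field \<Rightarrow> (hc_generator free_monoid \<Rightarrow>\<^sub>0 'a) \<Rightarrow> 'a hc_prod"
  where "el n q x = emb n q (cls n q x)"

lemma el_ops:
  assumes "x \<in> carrier (hc_free n)" "y \<in> carrier (hc_free n)"
  shows "el n q (x + y) = el n q x + el n q y" "el n q (x * y) = el n q x * el n q y"
    "el n q (scalar a * x) = hc_scale a (el n q x)" "el n q (- x) = - el n q x" "el n q (x - y) = el n q x - el n q y"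
proof -
  have 1: "el n q (u + v) = el n q u + el n q v" if "u \<in> carrier (hc_free n)" "v \<in> carrier (hc_free n)" for u v
    unfolding el_def using that by (simp add: cls_add emb_ops(1) cls_closed)
  then show "el n q (x + y) = el n q x + el n q y" using assms by blast
  show "el n q (x * y) = el n q x * el n q y" "el n q (scalar a * x) = hc_scale a (el n q x)"
    unfolding el_def using assms emb_ops(3)[of "cls n q x" n q "cls n q x" a]
    by (simp_all add: cls_mult emb_ops(2) cls_closed hc_gens_closed)
  have 2: "el n q (- u) = - el n q u" if "u \<in> carrier (hc_free n)" for u
  proof -
    have "el n q (u + - u) = el n q u + el n q (- u)" by (rule 1[OF that hc_closed(3)[OF that]])
    moreover have "el n q (0 + 0) = el n q 0 + el n q 0" by (rule 1[OF hc_closed(5,5)])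
    ultimately have "el n q u + el n q (- u) = 0" by simp
    then show ?thesis by (simp add: eq_neg_iff_add_eq_0 add.commute)
  qed
  show "el n q (- x) = - el n q x" by (rule 2[OF assms(1)])
  have "el n q (x - y) = el n q (x + - y)" by simp
  also have "\<dots> = el n q x + el n q (- y)" by (rule 1[OF assms(1) hc_closed(3)[OF assms(2)]])
  also have "\<dots> = el n q x - el n q y" unfolding 2[OF assms(2)] by simp
  finally show "el n q (x - y) = el n q x - el n q y" .
qed

lemma el_scale: "x \<in> carrier (hc_free n) \<Longrightarrow> el n q (scalar a * x) = hc_scale a (el n q x)"
  by (rule el_ops(3))

lemma el_neg: "x \<in> carrier (hc_free n) \<Longrightarrow> el n q (- x) = - el n q x"
  by (rule el_ops(4))

lemma el_relation:
  assumes "x - y \<in> hc_relators n q" "x \<in> carrier (hc_free n)" "y \<in> carrier (hc_free n)"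
  shows "el n q x = el n q y"
  using cls_relation[OF assms] by (simp add: el_def)

lemma hc_relators_mem:
  "1 \<le> i \<Longrightarrow> i < n \<Longrightarrow> hc_T i * hc_T i - (scalar (q - inverse q) * hc_T i + 1) \<in> hc_relators n q"
  "1 \<le> i \<Longrightarrow> i < n \<Longrightarrow> 1 \<le> j \<Longrightarrow> j < n \<Longrightarrow> i + 1 < j \<or> j + 1 < i \<Longrightarrow> hc_T i * hc_T j - hc_T j * hc_T i \<in> hc_relators n q"
  "1 \<le> i \<Longrightarrow> i + 1 < n \<Longrightarrow> hc_T i * hc_T (i + 1) * hc_T i - hc_T (i + 1) * hc_T i * hc_T (i + 1) \<in> hc_relators n q"
  "1 \<le> j \<Longrightarrow> j \<le> n \<Longrightarrow> hc_C j * hc_C j - 1 \<in> hc_relators n q"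
  "1 \<le> i \<Longrightarrow> i \<le> n \<Longrightarrow> 1 \<le> j \<Longrightarrow> j \<le> n \<Longrightarrow> i \<noteq> j \<Longrightarrow> hc_C i * hc_C j - (- (hc_C j * hc_C i)) \<in> hc_relators n q"
  "1 \<le> i \<Longrightarrow> i < n \<Longrightarrow> hc_T i * hc_C i - hc_C (i + 1) * hc_T i \<in> hc_relators n q"
  "1 \<le> i \<Longrightarrow> i < n \<Longrightarrow> hc_T i * hc_C (i + 1) - (hc_C i * hc_T i - scalar (q - inverse q) * (hc_C i - hc_C (i + 1))) \<in> hc_relators n q"
  "1 \<le> i \<Longrightarrow> i < n \<Longrightarrow> 1 \<le> j \<Longrightarrow> j \<le> n \<Longrightarrow> j \<noteq> i \<Longrightarrow> j \<noteq> i + 1 \<Longrightarrow> hc_T i * hc_C j - hc_C j * hc_T i \<in> hc_relators n q"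
  unfolding hc_relators_def Let_def Un_iff mem_Collect_eq
  by (metis atLeastLessThan_iff atLeastAtMost_iff le_add2 trans_le_add2 add.commute less_imp_le add_lessD1)+

lemma hecke_clifford_gens_el:
  assumes "q \<noteq> 0"
  shows "hecke_clifford_gens hc_scale n q (el n q 1) (\<lambda>i. el n q (hc_T i)) (\<lambda>j. el n q (hc_C j))"
proof unfold_locales
  note cl = hc_gens_closed hc_closed hc_closed_diff
  let ?T = "\<lambda>i. el n q (hc_T i)" and ?C = "\<lambda>j. el n q (hc_C j)"
  have m: "el n q x * el n q y = el n q (x * y)" if "x \<in> carrier (hc_free n)" "y \<in> carrier (hc_free n)" for x y
    using el_ops(2)[OF that] by simp
  show "q \<noteq> 0" by fact
  show "el n q 1 * el n q 1 = el n q 1" by (simp add: m cl)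
  fix i j :: nat
  have r: "x \<in> carrier (hc_free n) \<Longrightarrow> y \<in> carrier (hc_free n) \<Longrightarrow> x - y \<in> hc_relators n q \<Longrightarrow> el n q x = el n q y" for x y
    using el_relation by blast
  { assume j: "1 \<le> j" "j \<le> n"
    then show "el n q 1 * ?C j = ?C j" "?C j * el n q 1 = ?C j" by (simp_all add: m cl)
    have "el n q (hc_C j * hc_C j) = el n q 1"
      by (rule r[OF _ _ hc_relators_mem(4)]) (use j in \<open>auto intro!: cl\<close>)
    then show "?C j * ?C j = el n q 1" using j by (simp add: m cl)
    assume i: "1 \<le> i" "i \<le> n" "i \<noteq> j"
    have "el n q (hc_C i * hc_C j) = el n q (- (hc_C j * hc_C i))"
      by (rule r[OF _ _ hc_relators_mem(5)]) (use i j in \<open>auto intro!: cl\<close>)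
    then show "?C i * ?C j = - (?C j * ?C i)" using i j by (simp add: m cl el_ops(1,5) el_scale el_neg) }
  { assume i: "1 \<le> i" "i < n"
    then show "el n q 1 * ?T i = ?T i" "?T i * el n q 1 = ?T i" by (simp_all add: m cl)
    have "el n q (hc_T i * hc_T i) = el n q (scalar (q - inverse q) * hc_T i + 1)"
      by (rule r[OF _ _ hc_relators_mem(1)]) (use i in \<open>auto intro!: cl\<close>)
    then show "?T i * ?T i = hc_scale (q - inverse q) (?T i) + el n q 1"
      using i by (simp add: m cl el_ops(1,5) el_scale el_neg)
    have "el n q (hc_T i * hc_C i) = el n q (hc_C (i + 1) * hc_T i)"
      by (rule r[OF _ _ hc_relators_mem(6)]) (use i in \<open>auto intro!: cl\<close>)
    then show "?T i * ?C i = ?C (i + 1) * ?T i" using i by (simp add: m cl)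
    have "el n q (hc_T i * hc_C (i + 1)) = el n q (hc_C i * hc_T i - scalar (q - inverse q) * (hc_C i - hc_C (i + 1)))"
      by (rule r[OF _ _ hc_relators_mem(7)]) (use i in \<open>auto intro!: cl\<close>)
    then show "?T i * ?C (i + 1) = ?C i * ?T i - hc_scale (q - inverse q) (?C i - ?C (i + 1))"
      using i by (simp add: m cl el_ops(1,5) el_scale el_neg)
    { assume j: "1 \<le> j" "j \<le> n" "j \<noteq> i" "j \<noteq> Suc i"
      have "el n q (hc_T i * hc_C j) = el n q (hc_C j * hc_T i)"
        by (rule r[OF _ _ hc_relators_mem(8)]) (use i j in \<open>auto intro!: cl\<close>)
      then show "?T i * ?C j = ?C j * ?T i" using i j by (simp add: m cl) }
    { assume j: "1 \<le> j" "j < n" "i + 1 < j \<or> j + 1 < i"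
      have "el n q (hc_T i * hc_T j) = el n q (hc_T j * hc_T i)"
        by (rule r[OF _ _ hc_relators_mem(2)]) (use i j in \<open>auto intro!: cl\<close>)
      then show "?T i * ?T j = ?T j * ?T i" using i j by (simp add: m cl) } }
  assume i: "1 \<le> i" "i + 1 < n"
  have "el n q (hc_T i * hc_T (i + 1) * hc_T i) = el n q (hc_T (i + 1) * hc_T i * hc_T (i + 1))"
    by (rule r[OF _ _ hc_relators_mem(3)]) (use i in \<open>auto intro!: cl\<close>)
  then show "?T i * ?T (i + 1) * ?T i = ?T (i + 1) * ?T i * ?T (i + 1)" using i by (simp add: m cl)
qed

text \<open>\<open>emb\<close> identifies the algebra with the corner \<open>W []\<close> of the
  ring type; a left ideal is carried there and its complement is carried back.\<close>

theorem semisimple_if_generic: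
  assumes "generic_parameter q n"
  shows "semisimple_ring (hecke_clifford n q)"
proof -
  let ?R = "hecke_clifford n q"
  interpret G: generic_parameter q n by fact
  interpret gens: hecke_clifford_gens hc_scale n q "el n q 1" "\<lambda>i. el n q (hc_T i)" "\<lambda>j. el n q (hc_C j)"
    by (rule hecke_clifford_gens_el[OF G.q0])
  interpret H: hecke_clifford_generic hc_scale n q "el n q 1" "\<lambda>i. el n q (hc_T i)" "\<lambda>j. el n q (hc_C j)" ..
  have el_Hs: "el n q p \<in> H.Hs n" if "p \<in> carrier (hc_free n)" for p
    using that
  proof (induction rule: hc_induct)
    case one
    then show ?case by (rule H.Hs_e)
  next
    case (gen g x)
    have gc: "gen g \<in> carrier (hc_free n)" using gen(1) by (simp add: free_algebra_def gen_def)
    have "el n q (gen g) \<in> H.Hs n" using gen(1) by (auto simp: hc_generators_def intro: H.Hs_T H.Hs_C)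
    then show ?case using gen by (simp add: el_ops(2)[OF gc] H.Hs_mult)
  next
    case (scalar a x)
    then show ?case using el_scale[OF scalar(1)] by (simp add: H.Hs_scale)
  next
    case (add x y)
    then show ?case by (simp add: el_ops(1) H.Hs_add)
  qed
  have emb_Hs: "emb n q X \<in> H.Hs n" if "X \<in> carrier ?R" for X
    using cls_surj[OF that] el_Hs unfolding el_def by metis
  have e: "el n q 1 = emb n q \<one>\<^bsub>?R\<^esub>" by (simp add: el_def cls_one)
  have W_emb: "x \<in> H.W [] \<longleftrightarrow> x = emb n q (comp x (n, q))" for x
  proof -
    have "el n q 1 * x = emb n q (comp x (n, q))"
      unfolding e by (rule hc_prod_eqI) (simp add: comp_ops comp_emb)
    then show ?thesis by auto
  qed
  have emb_W: "emb n q X \<in> H.W []" if "X \<in> carrier ?R" for X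
    using that by (simp add: W_emb[of "emb n q X"] comp_emb del: H.W.simps)
  have Hs_W: "r \<in> H.W []" if "r \<in> H.Hs n" for r using H.Hs_unit[OF that] by simp
  show ?thesis
    unfolding semisimple_ring_def
  proof (intro conjI allI impI hcR.ring_axioms)
    fix I assume I: "left_ideal I ?R"
    then have "additive_subgroup I ?R" and abs: "\<And>a x. a \<in> carrier ?R \<Longrightarrow> x \<in> I \<Longrightarrow> a \<otimes>\<^bsub>?R\<^esub> x \<in> I"
      by (auto simp: left_ideal_def)
    interpret I: additive_subgroup I ?R by fact
    have Ic: "x \<in> carrier ?R" if "x \<in> I" for x using I.a_subset that by blast
    let ?I = "emb n q ` I"
    have Isub: "hc.subspace ?I"
      unfolding hc.subspace_def
    proof (intro conjI ballI allI)
      have "0 = emb n q \<zero>\<^bsub>?R\<^esub>" by (rule hc_prod_eqI) (simp add: comp_ops comp_emb)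
      then show "0 \<in> ?I" using I.zero_closed by blast
      show "x + y \<in> ?I" if "x \<in> ?I" "y \<in> ?I" for x y
        using that I.a_closed Ic by (auto simp: emb_ops(1)[symmetric])
      show "hc_scale c x \<in> ?I" if x: "x \<in> ?I" for c x
      proof -
        obtain X where X: "X \<in> I" "x = emb n q X" using x by blast
        have "hc_scale c x = emb n q (cls n q (scalar c) \<otimes>\<^bsub>?R\<^esub> X)"
          unfolding X(2) using emb_ops(3)[OF Ic[OF X(1)] Ic[OF X(1)]] by simp
        then show ?thesis using abs[OF cls_closed[OF hc_gens_closed(3)] X(1)] by blast
      qed
    qed
    have IH: "r * x \<in> ?I" if r: "r \<in> H.Hs n" and x: "x \<in> ?I" for r x
    proof -
      obtain X where X: "X \<in> I" "x = emb n q X" using x by blast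
      have "r = emb n q (comp r (n, q))" using Hs_W[OF r] W_emb by blast
      then have "r * x = emb n q (comp r (n, q) \<otimes>\<^bsub>?R\<^esub> X)" using X Ic[OF X(1)] emb_ops(2)[of "comp r (n, q)" n q X] by simp
      then show ?thesis using abs[OF _ X(1)] by simp
    qed
    obtain J where J: "hc.subspace J" "J \<subseteq> H.W []" "\<And>r x. r \<in> H.Hs n \<Longrightarrow> x \<in> J \<Longrightarrow> r * x \<in> J"
      "?I \<inter> J = {0}" "\<And>y. y \<in> H.W [] \<Longrightarrow> \<exists>a\<in>?I. \<exists>b\<in>J. y = a + b"
      using H.left_ideal_complement[OF Isub IH] by blast
    define J' where "J' = {X \<in> carrier ?R. emb n q X \<in> J}"
    have "left_ideal J' ?R"
      unfolding left_ideal_def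
    proof (intro conjI ballI)
      show "additive_subgroup J' ?R"
      proof (rule additive_subgroup.intro, rule hcR.add.subgroupI)
        show "J' \<subseteq> carrier ?R" by (auto simp: J'_def)
        have "emb n q \<zero>\<^bsub>?R\<^esub> = 0" by (rule hc_prod_eqI) (simp add: comp_ops comp_emb)
        then show "J' \<noteq> {}" using hc.subspace_0[OF J(1)] by (auto simp: J'_def intro!: exI[of _ "\<zero>\<^bsub>?R\<^esub>"])
        fix X Y assume X: "X \<in> J'" and Y: "Y \<in> J'"
        show "X \<oplus>\<^bsub>?R\<^esub> Y \<in> J'" using X Y hc.subspace_add[OF J(1)] by (auto simp: J'_def emb_ops)
        have Xc: "X \<in> carrier ?R" using X by (simp add: J'_def)
        have "emb n q (\<ominus>\<^bsub>?R\<^esub> X) = - emb n q X"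
          by (rule hc_prod_eqI) (use Xc in \<open>simp add: comp_ops comp_emb\<close>)
        then show "\<ominus>\<^bsub>?R\<^esub> X \<in> J'" using X hc.subspace_neg[OF J(1)] by (simp add: J'_def)
      qed
      show "a \<otimes>\<^bsub>?R\<^esub> X \<in> J'" if "a \<in> carrier ?R" "X \<in> J'" for a X
        using that J(3)[OF emb_Hs[OF that(1)]] by (simp add: J'_def emb_ops)
    qed
    moreover have "I \<inter> J' = {\<zero>\<^bsub>?R\<^esub>}"
    proof -
      have z: "emb n q \<zero>\<^bsub>?R\<^esub> = 0" by (rule hc_prod_eqI) (simp add: comp_ops comp_emb)
      have "X = \<zero>\<^bsub>?R\<^esub>" if "X \<in> I" "X \<in> J'" for X
      proof -
        have "emb n q X = emb n q \<zero>\<^bsub>?R\<^esub>" using that J(4) unfolding z by (auto simp: J'_def)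
        then show ?thesis using emb_inject[of X n q "\<zero>\<^bsub>?R\<^esub>"] Ic[OF that(1)] by simp
      qed
      moreover have "\<zero>\<^bsub>?R\<^esub> \<in> J'" using z hc.subspace_0[OF J(1)] by (simp add: J'_def)
      ultimately show ?thesis using I.zero_closed by blast
    qed
    moreover have "I <+>\<^bsub>?R\<^esub> J' = carrier ?R"
    proof
      show "I <+>\<^bsub>?R\<^esub> J' \<subseteq> carrier ?R" using Ic by (auto simp: set_add_def' J'_def)
      show "carrier ?R \<subseteq> I <+>\<^bsub>?R\<^esub> J'"
      proof
        fix X assume X: "X \<in> carrier ?R"
        obtain A b where A: "A \<in> I" "b \<in> J" "emb n q X = emb n q A + b" using J(5)[OF emb_W[OF X]] by blast
        define B where "B = comp b (n, q)"
        have b: "b = emb n q B" using A(2) J(2) W_emb unfolding B_def by blast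
        have Bc: "B \<in> carrier ?R" by (simp add: B_def)
        have "emb n q B \<in> J" using A(2) b by metis
        then have B: "B \<in> J'" using Bc by (simp add: J'_def)
        have "emb n q X = emb n q A + emb n q B" using A(3) b by metis
        then have "emb n q X = emb n q (A \<oplus>\<^bsub>?R\<^esub> B)" unfolding emb_ops(1)[OF Ic[OF A(1)] Bc] .
        then have "X = A \<oplus>\<^bsub>?R\<^esub> B" using emb_inject[of X n q "A \<oplus>\<^bsub>?R\<^esub> B"] X Ic[OF A(1)] Bc by simp
        then show "X \<in> I <+>\<^bsub>?R\<^esub> J'" using A(1) B by (auto simp: set_add_def')
      qed
    qed
    ultimately show "\<exists>J. left_ideal J ?R \<and> I \<inter> J = {\<zero>\<^bsub>?R\<^esub>} \<and> I <+>\<^bsub>?R\<^esub> J = carrier ?R" by blast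
  qed
qed

section \<open>A module over the non-semisimple algebra\<close>

text \<open>\<open>l\<close> is the component in \<open>I\<close> of the unit. For \<open>r\<close>
  in \<open>I\<close>, the product of \<open>r\<close> with the other component lies in both
  ideals.\<close>

lemma semisimple_left_ideal_unit:
  assumes ss: "semisimple_ring R" and I: "left_ideal I R"
  obtains l where "l \<in> I" "\<And>r. r \<in> I \<Longrightarrow> r \<otimes>\<^bsub>R\<^esub> l = r"
proof -
  interpret ring R using ss by (simp add: semisimple_ring_def)
  obtain J where J: "left_ideal J R" and IJ: "I \<inter> J = {\<zero>\<^bsub>R\<^esub>}" "I <+>\<^bsub>R\<^esub> J = carrier R"
    using ss I unfolding semisimple_ring_def by blast
  interpret I: additive_subgroup I R using I by (simp add: left_ideal_def)
  interpret J: additive_subgroup J R using J by (simp add: left_ideal_def)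
  have "\<one>\<^bsub>R\<^esub> \<in> I <+>\<^bsub>R\<^esub> J" using IJ by simp
  then obtain l j where l: "l \<in> I" and j: "j \<in> J" and lj: "\<one>\<^bsub>R\<^esub> = l \<oplus>\<^bsub>R\<^esub> j"
    by (auto simp: set_add_def')
  have "r \<otimes>\<^bsub>R\<^esub> l = r" if r: "r \<in> I" for r
  proof -
    have c: "r \<in> carrier R" "l \<in> carrier R" "j \<in> carrier R"
      using r l j I.a_subset J.a_subset by auto
    have rl: "r \<otimes>\<^bsub>R\<^esub> l \<in> I" "r \<otimes>\<^bsub>R\<^esub> j \<in> J" using I J c l j by (auto simp: left_ideal_def)
    have "r = r \<otimes>\<^bsub>R\<^esub> l \<oplus>\<^bsub>R\<^esub> r \<otimes>\<^bsub>R\<^esub> j" using c lj by (metis r_distr r_one)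
    then have "r \<otimes>\<^bsub>R\<^esub> j = \<ominus>\<^bsub>R\<^esub> (r \<otimes>\<^bsub>R\<^esub> l) \<oplus>\<^bsub>R\<^esub> r" using c
      by (metis r_neg1 m_closed)
    also have "\<dots> \<in> I" using rl r by (simp add: I.a_closed I.a_inv_closed)
    finally have "r \<otimes>\<^bsub>R\<^esub> j = \<zero>\<^bsub>R\<^esub>" using rl IJ by blast
    then show ?thesis using \<open>r = _\<close> c by simp
  qed
  then show thesis using that l by blast
qed

section \<open>The action on two adjacent letters\<close>

definition bit_sign :: "bool \<Rightarrow> 'a::field"
  where "bit_sign s = (if s then -1 else 1)"

text \<open>The Hecke algebra on the tensor square of a plane, in coordinates: equal letters are
  multiplied by \<open>q\<close>, the word (True, False) is sent to (False, True), and (False, True)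
  to (True, False) plus \<open>q - inverse q\<close> times itself.\<close>

definition swap_act :: "'a::field \<Rightarrow> (bool \<Rightarrow> bool \<Rightarrow> 'a) \<Rightarrow> bool \<Rightarrow> bool \<Rightarrow> 'a"
  where "swap_act q g b1 b2 =
    (if b1 = b2 then q * g b1 b2 else g b2 b1 + (if b1 then 0 else (q - inverse q) * g b1 b2))"

text \<open>Coordinates of \<open>T\<close> applied to a Clifford monomial times a word: the
  relations move \<open>T\<close> to the right past \<open>C 1\<close> and \<open>C 2\<close>, and
  it then acts on the word.\<close>

definition local_act :: "'a::field \<Rightarrow> (bool \<Rightarrow> bool \<Rightarrow> bool \<Rightarrow> bool \<Rightarrow> 'a) \<Rightarrow> bool \<Rightarrow> bool \<Rightarrow> bool \<Rightarrow> bool \<Rightarrow> 'a"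
  where "local_act q F s1 s2 b1 b2 =
    (if s1 then
       if s2 then (q - inverse q) * F True True b1 b2 - swap_act q (F True True) b1 b2
       else swap_act q (F False True) b1 b2 - (q - inverse q) * F False True b1 b2
     else
       if s2 then swap_act q (F True False) b1 b2 + (q - inverse q) * F False True b1 b2
       else swap_act q (F False False) b1 b2 + (q - inverse q) * F True True b1 b2)"

lemmas local_act_defs = local_act_def swap_act_def bit_sign_def

lemma local_act_quadratic:
  assumes "q \<noteq> 0"
  shows "local_act q (local_act q F) s1 s2 b1 b2 = (q - inverse q) * local_act q F s1 s2 b1 b2 + F s1 s2 b1 b2"
proof -
  \<comment> \<open>With the inverse named, each of the finitely many cases is a polynomial identity
    modulo \<open>q * p = 1\<close>.\<close>
  define p where "p = inverse q"
  have q: "q * p = 1" "p * q = 1" "q * (p * x) = x" "p * (q * x) = x" for x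
    using assms by (simp_all add: p_def field_simps)
  show ?thesis unfolding local_act_defs p_def[symmetric]
    by (cases s1; cases s2; cases b1; cases b2; simp add: algebra_simps q power2_eq_square)
qed

lemma local_act_braid:
  fixes F :: "bool \<Rightarrow> bool \<Rightarrow> bool \<Rightarrow> bool \<Rightarrow> bool \<Rightarrow> bool \<Rightarrow> 'a::field"
  assumes "q \<noteq> 0"
  defines "A \<equiv> \<lambda>F s1 s2 s3 b1 b2 b3. local_act q (\<lambda>s1 s2 b1 b2. F s1 s2 s3 b1 b2 b3) s1 s2 b1 b2"
    and "B \<equiv> \<lambda>F s1 s2 s3 b1 b2 b3. local_act q (\<lambda>s2 s3 b2 b3. F s1 s2 s3 b1 b2 b3) s2 s3 b2 b3"
  shows "A (B (A F)) s1 s2 s3 b1 b2 b3 = B (A (B F)) s1 s2 s3 b1 b2 b3"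
proof -
  define p where "p = inverse q"
  have q: "q * p = 1" "p * q = 1" "q * (p * x) = x" "p * (q * x) = x" for x
    using assms by (simp_all add: p_def field_simps)
  show ?thesis unfolding A_def B_def local_act_defs p_def[symmetric]
    by (cases s1; cases s2; cases s3; cases b1; cases b2; cases b3; simp add: algebra_simps q power2_eq_square)
qed

lemma local_act_linear:
  "local_act q (\<lambda>s1 s2 b1 b2. F s1 s2 b1 b2 + G s1 s2 b1 b2) s1 s2 b1 b2 = local_act q F s1 s2 b1 b2 + local_act q G s1 s2 b1 b2"
  "local_act q (\<lambda>s1 s2 b1 b2. F s1 s2 b1 b2 - G s1 s2 b1 b2) s1 s2 b1 b2 = local_act q F s1 s2 b1 b2 - local_act q G s1 s2 b1 b2"
  "local_act q (\<lambda>s1 s2 b1 b2. a * F s1 s2 b1 b2) s1 s2 b1 b2 = a * local_act q F s1 s2 b1 b2"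
  "local_act q (\<lambda>s1 s2 b1 b2. - F s1 s2 b1 b2) s1 s2 b1 b2 = - local_act q F s1 s2 b1 b2"
  "local_act q (\<lambda>s1 s2 b1 b2. 0) s1 s2 b1 b2 = 0"
  by (auto simp: local_act_def swap_act_def algebra_simps)

lemma local_act_sum:
  "local_act q (\<lambda>s1 s2 b1 b2. \<Sum>j\<in>J. F j s1 s2 b1 b2) s1 s2 b1 b2 = (\<Sum>j\<in>J. local_act q (F j) s1 s2 b1 b2)"
  by (induction J rule: infinite_finite_induct) (simp_all add: local_act_linear)

lemma local_act_commute:
  "local_act q (\<lambda>s1 s2 b1 b2. local_act q (F s1 s2 b1 b2) t1 t2 c1 c2) s1 s2 b1 b2 =
   local_act q (\<lambda>t1 t2 c1 c2. local_act q (\<lambda>s1 s2 b1 b2. F s1 s2 b1 b2 t1 t2 c1 c2) s1 s2 b1 b2) t1 t2 c1 c2"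
  unfolding local_act_def[of q _ s1 s2] swap_act_def[of q _ b1 b2]
  by (cases s1; cases s2; cases b1; cases b2; simp add: local_act_linear)

lemma local_act_sign:
  "local_act q (\<lambda>s1 s2 b1 b2. bit_sign s1 * bit_sign s2 * F s1 s2 b1 b2) s1 s2 b1 b2 =
   bit_sign s1 * bit_sign s2 * local_act q F s1 s2 b1 b2"
  by (cases s1; cases s2; cases b1; cases b2; simp add: local_act_defs algebra_simps)

lemma local_act_clifford:
  assumes "q \<noteq> 0"
  shows "local_act q (\<lambda>s1 s2 b1 b2. F (\<not> s1) s2 b1 b2) s1 s2 b1 b2 = bit_sign s1 * local_act q F s1 (\<not> s2) b1 b2"
    "local_act q (\<lambda>s1 s2 b1 b2. bit_sign s1 * F s1 (\<not> s2) b1 b2) s1 s2 b1 b2 =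
      local_act q F (\<not> s1) s2 b1 b2 - (q - inverse q) * (F (\<not> s1) s2 b1 b2 - bit_sign s1 * F s1 (\<not> s2) b1 b2)"
proof -
  define p where "p = inverse q"
  have q: "q * p = 1" "p * q = 1" "q * (p * x) = x" "p * (q * x) = x" for x
    using assms by (simp_all add: p_def field_simps)
  show "local_act q (\<lambda>s1 s2 b1 b2. F (\<not> s1) s2 b1 b2) s1 s2 b1 b2 = bit_sign s1 * local_act q F s1 (\<not> s2) b1 b2"
    "local_act q (\<lambda>s1 s2 b1 b2. bit_sign s1 * F s1 (\<not> s2) b1 b2) s1 s2 b1 b2 =
      local_act q F (\<not> s1) s2 b1 b2 - (q - inverse q) * (F (\<not> s1) s2 b1 b2 - bit_sign s1 * F s1 (\<not> s2) b1 b2)"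
    unfolding local_act_defs p_def[symmetric]
    by (cases s1; cases s2; cases b1; cases b2; simp add: algebra_simps q power2_eq_square)+
qed

lemma local_act_weight:
  "local_act q (\<lambda>s1 s2 b1 b2. h b1 * h b2 * F s1 s2 b1 b2) s1 s2 b1 b2 = h b1 * h b2 * local_act q F s1 s2 b1 b2"
  by (cases s1; cases s2; cases b1; cases b2; simp add: local_act_defs algebra_simps)

text \<open>Right multiplication by \<open>C 1\<close> and \<open>C 2\<close> at marked letters. The
  weight is forced: if \<open>T v = q v\<close>, then
  \<open>T (C 1 + w C 2) v = q (C 1 + w C 2) v\<close> requires
  \<open>w = q\<^sup>2\<close>.\<close>

definition local_theta :: "'a::field \<Rightarrow> (bool \<Rightarrow> bool \<Rightarrow> bool \<Rightarrow> bool \<Rightarrow> 'a) \<Rightarrow> bool \<Rightarrow> bool \<Rightarrow> bool \<Rightarrow> bool \<Rightarrow> 'a"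
  where "local_theta q F s1 s2 b1 b2 = (if b1 then bit_sign s2 * F (\<not> s1) s2 b1 b2 else 0) +
    (if b2 then (if b1 then q\<^sup>2 else 1) * F s1 (\<not> s2) b1 b2 else 0)"

lemma local_act_theta:
  assumes "q \<noteq> 0"
  shows "local_act q (local_theta q F) s1 s2 b1 b2 = local_theta q (local_act q F) s1 s2 b1 b2"
proof -
  define p where "p = inverse q"
  have q: "q * p = 1" "p * q = 1" "q * (p * x) = x" "p * (q * x) = x" for x
    using assms by (simp_all add: p_def field_simps)
  show ?thesis
    unfolding local_act_defs local_theta_def p_def[symmetric]
    by (cases s1; cases s2; cases b1; cases b2; simp add: algebra_simps q power2_eq_square)
qed

definition upd2 :: "nat \<Rightarrow> (nat \<Rightarrow> 'b) \<Rightarrow> 'b \<Rightarrow> 'b \<Rightarrow> nat \<Rightarrow> 'b"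
  where "upd2 i S x y = S(i := x, Suc i := y)"

lemma upd2 [simp]:
  "upd2 i (upd2 i S x y) x' y' = upd2 i S x' y'" "upd2 i S x y i = x" "upd2 i S x y (Suc i) = y"
  "upd2 i S (S i) (S (Suc i)) = S" "(upd2 i S x y)(i := v) = upd2 i S v y" "(upd2 i S x y)(Suc i := v) = upd2 i S x v"
  "upd2 i (S(i := v)) x y = upd2 i S x y" "upd2 i (S(Suc i := v)) x y = upd2 i S x y"
  by (auto simp: upd2_def)

lemma upd2_other:
  assumes "j \<noteq> i" "j \<noteq> Suc i"
  shows "upd2 i S x y j = S j" "(upd2 i S x y)(j := v) = upd2 i (S(j := v)) x y"
  using assms by (auto simp: upd2_def)

lemma upd2_far: "i + 1 < j \<or> j + 1 < i \<Longrightarrow> upd2 i (upd2 j S x y) x' y' = upd2 j (upd2 i S x' y') x y"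
  by (auto simp: upd2_def fun_eq_iff)

lemma prod_upd2:
  assumes "finite J"
  shows "i \<in> J \<Longrightarrow> Suc i \<in> J \<Longrightarrow> (\<Prod>k\<in>J. h (upd2 i S x y k)) = h x * h y * (\<Prod>k\<in>J - {i, Suc i}. h (S k))"
    "i \<notin> J \<Longrightarrow> Suc i \<notin> J \<Longrightarrow> (\<Prod>k\<in>J. h (upd2 i S x y k)) = (\<Prod>k\<in>J. h (S k))"
proof -
  assume i: "i \<in> J" "Suc i \<in> J"
  have "(\<Prod>k\<in>J. h (upd2 i S x y k)) = h (upd2 i S x y i) * (h (upd2 i S x y (Suc i)) * (\<Prod>k\<in>J - {i} - {Suc i}. h (upd2 i S x y k)))"
    using assms i by (subst prod.remove[of J i], simp, simp, subst prod.remove[of _ "Suc i"]) simp_all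
  also have "(\<Prod>k\<in>J - {i} - {Suc i}. h (upd2 i S x y k)) = (\<Prod>k\<in>J - {i, Suc i}. h (S k))"
    by (rule prod.cong) (auto simp: upd2_other)
  finally show "(\<Prod>k\<in>J. h (upd2 i S x y k)) = h x * h y * (\<Prod>k\<in>J - {i, Suc i}. h (S k))"
    by (simp add: mult.assoc)
next
  assume "i \<notin> J" "Suc i \<notin> J"
  then have "upd2 i S x y k = S k" if "k \<in> J" for k using that by (metis upd2_other(1))
  then show "(\<Prod>k\<in>J. h (upd2 i S x y k)) = (\<Prod>k\<in>J. h (S k))" by (intro prod.cong) simp_all
qed

lemma sign_flip:
  assumes "finite J"
  shows "(\<Prod>k\<in>J. bit_sign ((S(j := \<not> S j)) k)) = (if j \<in> J then -1 else 1) * (\<Prod>k\<in>J. bit_sign (S k) :: 'a::field)"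
proof (cases "j \<in> J")
  case True
  have "(\<Prod>k\<in>J - {j}. bit_sign ((S(j := \<not> S j)) k)) = (\<Prod>k\<in>J - {j}. bit_sign (S k) :: 'a)"
    by (rule prod.cong) auto
  then show ?thesis using assms True
    by (simp add: prod.remove[of J j] bit_sign_def)
next
  case False
  then show ?thesis by (auto intro!: prod.cong)
qed

lemma sign_square: "(\<Prod>k\<in>J. bit_sign (S k)) * (\<Prod>k\<in>J. bit_sign (S k)) = (1 :: 'a::field)"
  unfolding prod.distrib[symmetric] by (rule prod.neutral) (simp add: bit_sign_def)

text \<open>Coordinates of the induced module: the first argument is the support of a Clifford monomial,
  the second one marks the positions of one of the two letters in a word.\<close>
type_synonym 'a hc_module = "(nat \<Rightarrow> bool) \<Rightarrow> (nat \<Rightarrow> bool) \<Rightarrow> 'a"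

fun gact :: "'a::field \<Rightarrow> hc_generator \<Rightarrow> 'a hc_module \<Rightarrow> 'a hc_module" where
  "gact q (T_gen i) f S B = local_act q (\<lambda>s1 s2 b1 b2. f (upd2 i S s1 s2) (upd2 i B b1 b2)) (S i) (S (Suc i)) (B i) (B (Suc i))"
| "gact q (C_gen i) f S B = (\<Prod>k<i. bit_sign (S k)) * f (S(i := \<not> S i)) B"

lemma gact_linear:
  "gact q g (\<lambda>S B. f S B + f' S B) = (\<lambda>S B. gact q g f S B + gact q g f' S B)"
  "gact q g (\<lambda>S B. a * f S B) = (\<lambda>S B. a * gact q g f S B)"
  "gact q g (\<lambda>S B. 0) = (\<lambda>S B. 0)"
  by (cases g; simp add: fun_eq_iff local_act_linear algebra_simps)+

lemma gact_T_quadratic: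
  assumes "q \<noteq> 0"
  shows "gact q (T_gen i) (gact q (T_gen i) f) S B = (q - inverse q) * gact q (T_gen i) f S B + f S B"
  by (simp add: local_act_quadratic[OF assms])

lemma gact_T_far:
  assumes "i + 1 < j \<or> j + 1 < i"
  shows "gact q (T_gen i) (gact q (T_gen j) f) S B = gact q (T_gen j) (gact q (T_gen i) f) S B"
proof -
  have ne: "i \<noteq> j" "i \<noteq> Suc j" "Suc i \<noteq> j" "j \<noteq> i" "j \<noteq> Suc i" "Suc j \<noteq> i" using assms by auto
  show ?thesis by (simp add: upd2_other ne upd2_far[OF assms]) (rule local_act_commute)
qed

lemma gact_T_braid:
  assumes "q \<noteq> 0"
  shows "gact q (T_gen i) (gact q (T_gen (Suc i)) (gact q (T_gen i) f)) S B =
    gact q (T_gen (Suc i)) (gact q (T_gen i) (gact q (T_gen (Suc i)) f)) S B"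
proof -
  \<comment> \<open>All letters except \<open>i\<close>, \<open>i + 1\<close>, \<open>i + 2\<close>
    are frozen, which reduces the claim to the finite check in
    \<open>local_act_braid\<close>.\<close>
  define u where "u = (\<lambda>S :: nat \<Rightarrow> bool. \<lambda>x y z. S(i := x, Suc i := y, Suc (Suc i) := z))"
  define F where "F f s1 s2 s3 b1 b2 b3 = f (u S s1 s2 s3) (u B b1 b2 b3)"
    for f :: "'a hc_module" and s1 s2 s3 b1 b2 b3
  have u: "u S x y z i = x" "u S x y z (Suc i) = y" "u S x y z (Suc (Suc i)) = z"
    "upd2 i (u S x y z) x' y' = u S x' y' z" "upd2 (Suc i) (u S x y z) y' z' = u S x y' z'" for S x y z x' y' z'
    by (auto simp: u_def upd2_def fun_eq_iff)
  have A: "F (gact q (T_gen i) f) = (\<lambda>s1 s2 s3 b1 b2 b3. local_act q (\<lambda>s1 s2 b1 b2. F f s1 s2 s3 b1 b2 b3) s1 s2 b1 b2)" for f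
    by (simp add: fun_eq_iff F_def u)
  have B: "F (gact q (T_gen (Suc i)) f) = (\<lambda>s1 s2 s3 b1 b2 b3. local_act q (\<lambda>s2 s3 b2 b3. F f s1 s2 s3 b1 b2 b3) s2 s3 b2 b3)" for f
    by (simp add: fun_eq_iff F_def u)
  have "F (gact q (T_gen i) (gact q (T_gen (Suc i)) (gact q (T_gen i) f))) =
    F (gact q (T_gen (Suc i)) (gact q (T_gen i) (gact q (T_gen (Suc i)) f)))"
    unfolding fun_eq_iff A B by (intro allI local_act_braid[OF assms])
  from this[THEN fun_cong, THEN fun_cong, THEN fun_cong, THEN fun_cong, THEN fun_cong, THEN fun_cong,
      of "S i" "S (Suc i)" "S (Suc (Suc i))" "B i" "B (Suc i)" "B (Suc (Suc i))"]
  show ?thesis by (simp add: F_def u_def del: gact.simps)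
qed

lemma gact_C_square: "gact q (C_gen i) (gact q (C_gen i) f) S B = f S B"
proof -
  have "(\<Prod>k<i. bit_sign ((S(i := \<not> S i)) k)) = (\<Prod>k<i. bit_sign (S k) :: 'a)"
    by (rule prod.cong) auto
  then show ?thesis by (simp add: mult.assoc[symmetric] sign_square)
qed

lemma gact_C_anticommute:
  assumes "i \<noteq> j"
  shows "gact q (C_gen i) (gact q (C_gen j) f) S B = - gact q (C_gen j) (gact q (C_gen i) f) S B"
proof -
  have f: "finite {..<i}" "finite {..<j}" by simp_all
  have "(S(i := \<not> S i))(j := \<not> (S(i := \<not> S i)) j) = (S(j := \<not> S j))(i := \<not> (S(j := \<not> S j)) i)"
    using assms by (auto simp: fun_eq_iff)
  then show ?thesis using assms
    by (auto simp: sign_flip[OF f(1), of S j] sign_flip[OF f(2), of S i] linorder_not_less simp del: fun_upd_apply)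
qed

lemma gact_TC:
  assumes "q \<noteq> 0"
  shows "gact q (T_gen i) (gact q (C_gen i) f) S B = gact q (C_gen (Suc i)) (gact q (T_gen i) f) S B"
    "gact q (T_gen i) (gact q (C_gen (Suc i)) f) S B =
      gact q (C_gen i) (gact q (T_gen i) f) S B - (q - inverse q) * (gact q (C_gen i) f S B - gact q (C_gen (Suc i)) f S B)"
proof -
  define K :: 'a where "K = (\<Prod>k<i. bit_sign (S k))"
  define F where "F s1 s2 b1 b2 = f (upd2 i S s1 s2) (upd2 i B b1 b2)" for s1 s2 b1 b2
  have K: "(\<Prod>k<i. bit_sign (upd2 i S x y k)) = K" for x y unfolding K_def by (rule prod_upd2) simp_all
  have "gact q (T_gen i) (gact q (C_gen i) f) S B =
      local_act q (\<lambda>s1 s2 b1 b2. K * F (\<not> s1) s2 b1 b2) (S i) (S (Suc i)) (B i) (B (Suc i))"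
    by (simp add: K F_def)
  also have "\<dots> = K * (bit_sign (S i) * local_act q F (S i) (\<not> S (Suc i)) (B i) (B (Suc i)))"
    unfolding local_act_linear local_act_clifford[OF assms] ..
  also have "\<dots> = gact q (C_gen (Suc i)) (gact q (T_gen i) f) S B"
    by (simp add: K_def F_def[abs_def] mult.assoc)
  finally show "gact q (T_gen i) (gact q (C_gen i) f) S B = gact q (C_gen (Suc i)) (gact q (T_gen i) f) S B" .
  have "gact q (T_gen i) (gact q (C_gen (Suc i)) f) S B =
      local_act q (\<lambda>s1 s2 b1 b2. K * (bit_sign s1 * F s1 (\<not> s2) b1 b2)) (S i) (S (Suc i)) (B i) (B (Suc i))"
    by (simp add: K F_def mult.assoc)
  also have "\<dots> = K * (local_act q F (\<not> S i) (S (Suc i)) (B i) (B (Suc i)) - (q - inverse q) *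
      (F (\<not> S i) (S (Suc i)) (B i) (B (Suc i)) - bit_sign (S i) * F (S i) (\<not> S (Suc i)) (B i) (B (Suc i))))"
    unfolding local_act_linear local_act_clifford[OF assms] ..
  also have "\<dots> = gact q (C_gen i) (gact q (T_gen i) f) S B - (q - inverse q) * (gact q (C_gen i) f S B - gact q (C_gen (Suc i)) f S B)"
  proof -
    have "upd2 i S (\<not> S i) (S (Suc i)) = S(i := \<not> S i)" "upd2 i S (S i) (\<not> S (Suc i)) = S(Suc i := \<not> S (Suc i))"
      by (auto simp: upd2_def fun_eq_iff)
    then show ?thesis by (simp add: K_def F_def[abs_def] algebra_simps)
  qed
  finally show "gact q (T_gen i) (gact q (C_gen (Suc i)) f) S B =
      gact q (C_gen i) (gact q (T_gen i) f) S B - (q - inverse q) * (gact q (C_gen i) f S B - gact q (C_gen (Suc i)) f S B)" .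
qed

lemma gact_TC_far:
  assumes "j \<noteq> i" "j \<noteq> Suc i"
  shows "gact q (T_gen i) (gact q (C_gen j) f) S B = gact q (C_gen j) (gact q (T_gen i) f) S B"
proof (cases "j < i")
  case True
  then have "(\<Prod>k<j. bit_sign (upd2 i S x y k)) = (\<Prod>k<j. bit_sign (S k) :: 'a)" for x y
    by (intro prod_upd2) auto
  then show ?thesis using assms by (simp add: upd2_other local_act_linear)
next
  case False
  define K :: 'a where "K = (\<Prod>k\<in>{..<j} - {i, Suc i}. bit_sign (S k))"
  have K: "(\<Prod>k<j. bit_sign (upd2 i S x y k)) = bit_sign x * bit_sign y * K" for x y
    unfolding K_def using False assms by (intro prod_upd2) auto
  have "gact q (T_gen i) (gact q (C_gen j) f) S B = local_act q (\<lambda>s1 s2 b1 b2. bit_sign s1 * bit_sign s2 *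
      (K * f (upd2 i (S(j := \<not> S j)) s1 s2) (upd2 i B b1 b2))) (S i) (S (Suc i)) (B i) (B (Suc i))"
    using assms by (simp add: upd2_other K mult.assoc)
  also have "\<dots> = bit_sign (S i) * bit_sign (S (Suc i)) * K * gact q (T_gen i) f (S(j := \<not> S j)) B"
    unfolding local_act_sign local_act_linear using assms by simp
  also have "bit_sign (S i) * bit_sign (S (Suc i)) * K = (\<Prod>k<j. bit_sign (S k))"
    using K[of "S i" "S (Suc i)"] by simp
  finally show ?thesis unfolding gact.simps(2)[of q j "gact q (T_gen i) f"] .
qed

text \<open>The right multiplication by \<open>C j\<close>, weighted by the number of marked positions before \<open>j\<close>.\<close>
definition theta_term :: "'a::field \<Rightarrow> nat \<Rightarrow> nat \<Rightarrow> 'a hc_module \<Rightarrow> 'a hc_module"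
  where "theta_term q n j f S B = (if B j then (\<Prod>k\<in>{0<..<j}. if B k then q\<^sup>2 else 1) *
    (\<Prod>k\<in>{j<..n}. bit_sign (S k)) * f (S(j := \<not> S j)) B else 0)"

definition theta :: "'a::field \<Rightarrow> nat \<Rightarrow> 'a hc_module \<Rightarrow> 'a hc_module"
  where "theta q n f S B = (\<Sum>j\<in>{1..n}. theta_term q n j f S B)"

text \<open>A left and a right multiplication commute. For \<open>j < i\<close> each of the two
  signs is changed by the flip of the other, and for \<open>i < j\<close> neither is; the former
  uses \<open>i \<le> n\<close>.\<close>

lemma theta_C:
  assumes "i \<le> n"
  shows "theta q n (gact q (C_gen i) f) S B = gact q (C_gen i) (theta q n f) S B"
proof -
  have "theta_term q n j (gact q (C_gen i) f) S B = (\<Prod>k<i. bit_sign (S k)) * theta_term q n j f (S(i := \<not> S i)) B" for j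
  proof (cases "i = j")
    case True
    have "(\<Prod>k<j. bit_sign ((S(j := \<not> S j)) k)) = (\<Prod>k<j. bit_sign (S k) :: 'a)"
      "(\<Prod>k\<in>{j<..n}. bit_sign ((S(j := \<not> S j)) k)) = (\<Prod>k\<in>{j<..n}. bit_sign (S k) :: 'a)"
      by (auto intro!: prod.cong)
    then show ?thesis by (simp add: theta_term_def True algebra_simps del: fun_upd_apply)
  next
    case False
    have f: "finite {..<i}" "finite {j<..n}" by simp_all
    have "(S(i := \<not> S i))(j := \<not> (S(i := \<not> S i)) j) = (S(j := \<not> S j))(i := \<not> (S(j := \<not> S j)) i)"
      using False by (auto simp: fun_eq_iff)
    then show ?thesis using False assms
      by (auto simp: theta_term_def sign_flip[OF f(1), of S j] sign_flip[OF f(2), of S i] simp del: fun_upd_apply)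
  qed
  then show ?thesis by (simp add: theta_def sum_distrib_left)
qed

text \<open>The factors for \<open>i\<close> and \<open>Suc i\<close> occur together or not at all,
  and \<open>T i\<close> preserves the parity of the Clifford monomial on these letters and the
  number of marks.\<close>

lemma theta_term_far:
  assumes "j \<noteq> i" "j \<noteq> Suc i" "i < n" "1 \<le> i"
  shows "theta_term q n j (gact q (T_gen i) f) S B = gact q (T_gen i) (theta_term q n j f) S B"
proof (cases "B j")
  case False
  then show ?thesis using assms by (simp add: theta_term_def upd2_other local_act_linear)
next
  case B: True
  show ?thesis
  proof (cases "j < i")
    case True
    define K :: 'a where "K = (\<Prod>k\<in>{j<..n} - {i, Suc i}. bit_sign (S k))"
    have K: "(\<Prod>k\<in>{j<..n}. bit_sign (upd2 i S x y k)) = bit_sign x * bit_sign y * K" for x y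
      unfolding K_def using True assms by (intro prod_upd2) auto
    define L :: 'a where "L = (\<Prod>k\<in>{0<..<j}. if B k then q\<^sup>2 else 1)"
    have L: "(\<Prod>k\<in>{0<..<j}. if upd2 i B x y k then q\<^sup>2 else 1) = L" for x y
      unfolding L_def using True by (intro prod_upd2(2)[where h = "\<lambda>b. if b then q\<^sup>2 else 1"]) auto
    have "gact q (T_gen i) (theta_term q n j f) S B = local_act q (\<lambda>s1 s2 b1 b2. bit_sign s1 * bit_sign s2 *
        ((L * K) * f (upd2 i (S(j := \<not> S j)) s1 s2) (upd2 i B b1 b2))) (S i) (S (Suc i)) (B i) (B (Suc i))"
      using assms B by (simp add: theta_term_def upd2_other K L ac_simps)
    also have "\<dots> = L * (bit_sign (S i) * bit_sign (S (Suc i)) * K) * gact q (T_gen i) f (S(j := \<not> S j)) B"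
      unfolding local_act_sign local_act_linear using assms by (simp add: ac_simps)
    also have "bit_sign (S i) * bit_sign (S (Suc i)) * K = (\<Prod>k\<in>{j<..n}. bit_sign (S k))"
      using K[of "S i" "S (Suc i)"] by simp
    finally show ?thesis using B by (simp add: theta_term_def[of q n j "gact q (T_gen i) f" S B] L_def del: gact.simps fun_upd_apply)
  next
    case False
    define h :: "bool \<Rightarrow> 'a" where "h = (\<lambda>b. if b then q\<^sup>2 else 1)"
    define K :: 'a where "K = (\<Prod>k\<in>{0<..<j} - {i, Suc i}. h (B k))"
    have K: "(\<Prod>k\<in>{0<..<j}. h (upd2 i B x y k)) = h x * h y * K" for x y
      unfolding K_def using False assms by (intro prod_upd2) auto
    define L :: 'a where "L = (\<Prod>k\<in>{j<..n}. bit_sign (S k))"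
    have L: "(\<Prod>k\<in>{j<..n}. bit_sign (upd2 i S x y k)) = L" for x y
      unfolding L_def using False assms by (intro prod_upd2) auto
    have th: "theta_term q n j f S B = (if B j then (\<Prod>k\<in>{0<..<j}. h (B k)) * (\<Prod>k\<in>{j<..n}. bit_sign (S k)) * f (S(j := \<not> S j)) B else 0)"
      for f S B by (simp add: theta_term_def h_def)
    have "gact q (T_gen i) (theta_term q n j f) S B = local_act q (\<lambda>s1 s2 b1 b2. h b1 * h b2 *
        ((L * K) * f (upd2 i (S(j := \<not> S j)) s1 s2) (upd2 i B b1 b2))) (S i) (S (Suc i)) (B i) (B (Suc i))"
      using assms B by (simp add: th upd2_other K L ac_simps)
    also have "\<dots> = L * (h (B i) * h (B (Suc i)) * K) * gact q (T_gen i) f (S(j := \<not> S j)) B"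
      unfolding local_act_weight local_act_linear using assms by (simp add: ac_simps)
    also have "h (B i) * h (B (Suc i)) * K = (\<Prod>k\<in>{0<..<j}. h (B k))"
      using K[of "B i" "B (Suc i)"] by simp
    finally show ?thesis using B by (simp add: th[of "gact q (T_gen i) f" S B] L_def ac_simps del: gact.simps fun_upd_apply)
  qed
qed

text \<open>The terms at \<open>i\<close> and \<open>Suc i\<close> do not commute with
  \<open>T i\<close> separately; their sum does, by \<open>local_act_theta\<close>.\<close>

lemma theta_T:
  assumes "q \<noteq> 0" "1 \<le> i" "i < n"
  shows "theta q n (gact q (T_gen i) f) S B = gact q (T_gen i) (theta q n f) S B"
proof -
  define K L :: 'a where "K = (\<Prod>k\<in>{0<..<i}. if B k then q\<^sup>2 else 1)" and "L = (\<Prod>k\<in>{Suc i<..n}. bit_sign (S k))"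
  have K: "(\<Prod>k\<in>{0<..<i}. if upd2 i B x y k then q\<^sup>2 else 1) = K" for x y
    unfolding K_def by (intro prod_upd2(2)[where h = "\<lambda>b. if b then q\<^sup>2 else 1"]) auto
  have L: "(\<Prod>k\<in>{Suc i<..n}. bit_sign (upd2 i S x y k)) = L" for x y
    unfolding L_def by (intro prod_upd2(2)) auto
  have split: "{i<..n} = insert (Suc i) {Suc i<..n}" "{0<..<Suc i} = insert i {0<..<i}" using assms by auto
  define F where "F f s1 s2 b1 b2 = f (upd2 i S s1 s2) (upd2 i B b1 b2)" for f :: "'a hc_module" and s1 s2 b1 b2
  have F: "theta_term q n i f (upd2 i S s1 s2) (upd2 i B b1 b2) + theta_term q n (Suc i) f (upd2 i S s1 s2) (upd2 i B b1 b2) =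
      K * L * local_theta q (F f) s1 s2 b1 b2" for f s1 s2 b1 b2
    unfolding theta_term_def split by (simp add: K L local_theta_def F_def algebra_simps)
  have loc: "theta_term q n i (gact q (T_gen i) f) S B + theta_term q n (Suc i) (gact q (T_gen i) f) S B =
    gact q (T_gen i) (\<lambda>S B. theta_term q n i f S B + theta_term q n (Suc i) f S B) S B"
  proof -
    have "F (gact q (T_gen i) f) = local_act q (F f)" by (simp add: F_def[abs_def])
    then have "K * L * local_theta q (F (gact q (T_gen i) f)) s1 s2 b1 b2 = local_act q (\<lambda>s1 s2 b1 b2. K * L * local_theta q (F f) s1 s2 b1 b2) s1 s2 b1 b2"
      for s1 s2 b1 b2 by (simp add: local_act_linear local_act_theta[OF assms(1)])
    from this[of "S i" "S (Suc i)" "B i" "B (Suc i)"] show ?thesis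
      unfolding F[symmetric] by (simp del: gact.simps(1) add: gact.simps(1)[of q i "\<lambda>S B. theta_term q n i f S B + theta_term q n (Suc i) f S B"])
  qed
  have J: "{1..n} = insert i (insert (Suc i) ({1..n} - {i, Suc i}))" using assms by auto
  have th: "theta q n f S B = (theta_term q n i f S B + theta_term q n (Suc i) f S B) + (\<Sum>j\<in>{1..n} - {i, Suc i}. theta_term q n j f S B)"
    for f S B unfolding theta_def by (subst J) (simp add: add.assoc)
  have far: "(\<Sum>j\<in>{1..n} - {i, Suc i}. theta_term q n j (gact q (T_gen i) f) S B) =
      (\<Sum>j\<in>{1..n} - {i, Suc i}. gact q (T_gen i) (theta_term q n j f) S B)"
    by (rule sum.cong[OF refl], rule theta_term_far) (use assms in auto)
  have "theta q n (gact q (T_gen i) f) S B =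
    gact q (T_gen i) (\<lambda>S B. theta_term q n i f S B + theta_term q n (Suc i) f S B) S B +
    (\<Sum>j\<in>{1..n} - {i, Suc i}. gact q (T_gen i) (theta_term q n j f) S B)"
    unfolding th loc far ..
  also have "(\<Sum>j\<in>{1..n} - {i, Suc i}. gact q (T_gen i) (theta_term q n j f) S B) =
      gact q (T_gen i) (\<lambda>S B. \<Sum>j\<in>{1..n} - {i, Suc i}. theta_term q n j f S B) S B"
    by (simp add: local_act_sum)
  finally show ?thesis unfolding fun_cong[OF fun_cong[OF gact_linear(1)], symmetric] th[abs_def] .
qed

section \<open>The module structure over the free algebra and over its quotient\<close>

definition ev :: "'a::field \<Rightarrow> (hc_generator free_monoid \<Rightarrow>\<^sub>0 'a) \<Rightarrow> 'a hc_module \<Rightarrow> 'a hc_module"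
  where "ev q p f S B = (\<Sum>w\<in>Poly_Mapping.keys p. Poly_Mapping.lookup p w * foldr (gact q) (letters w) f S B)"

lemma ev_superset: "finite A \<Longrightarrow> Poly_Mapping.keys p \<subseteq> A \<Longrightarrow>
    ev q p f S B = (\<Sum>w\<in>A. Poly_Mapping.lookup p w * foldr (gact q) (letters w) f S B)"
  unfolding ev_def by (rule sum.mono_neutral_left) (auto simp: in_keys_iff)

lemma ev_single: "ev q (Poly_Mapping.single w c) f = (\<lambda>S B. c * foldr (gact q) (letters w) f S B)"
  by (simp add: fun_eq_iff ev_superset[of "{w}"])

lemma ev_add: "ev q (p + r) f = (\<lambda>S B. ev q p f S B + ev q r f S B)"
proof -
  have k: "finite (Poly_Mapping.keys p \<union> Poly_Mapping.keys r)" by simp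
  show ?thesis
    by (simp add: fun_eq_iff ev_superset[OF k] keys_add lookup_add distrib_right sum.distrib)
qed

lemma ev_zero: "ev q 0 f = (\<lambda>S B. 0)"
  by (simp add: fun_eq_iff ev_def)

lemma ev_diff: "ev q (p - r) f = (\<lambda>S B. ev q p f S B - ev q r f S B)"
  using ev_add[of q "p - r" r f] by (simp add: fun_eq_iff)

lemma ev_uminus: "ev q (- r) f = (\<lambda>S B. - ev q r f S B)"
  using ev_diff[of q 0 r f] by (simp add: ev_zero)

lemma ev_sum: "ev q (\<Sum>j\<in>J. p j) f = (\<lambda>S B. \<Sum>j\<in>J. ev q (p j) f S B)"
  by (induction J rule: infinite_finite_induct) (simp_all add: ev_zero ev_add)

lemma poly_mapping_single_induct [case_names zero single add]:
  fixes p :: "'b \<Rightarrow>\<^sub>0 'c::comm_monoid_add"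
  assumes "P 0" "\<And>w c. P (Poly_Mapping.single w c)" "\<And>x y. P x \<Longrightarrow> P y \<Longrightarrow> P (x + y)"
  shows "P p"
proof (induction p rule: update_induct)
  case (update x a b)
  then have "Poly_Mapping.update a b x = x + Poly_Mapping.single a b"
    by (intro poly_mapping_eqI) (auto simp: update.rep_eq lookup_add lookup_single in_keys_iff when_def)
  then show ?case using assms(2,3) update by metis
qed (rule assms(1))

lemma ev_gen_mult: "ev q (gen g * p) f = gact q g (ev q p f)"
proof (induction p rule: poly_mapping_single_induct)
  case (single w c)
  have "gen g * Poly_Mapping.single w c = Poly_Mapping.single (Word (g # letters w)) c"
    by (simp add: gen_def mult_single plus_free_monoid_def)
  then show ?case by (simp add: ev_single gact_linear)
qed (simp_all add: ev_zero gact_linear distrib_left ev_add)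

lemma ev_scalar_mult: "ev q (scalar a * p) f = (\<lambda>S B. a * ev q p f S B)"
proof (induction p rule: poly_mapping_single_induct)
  case (single w c)
  have "scalar a * Poly_Mapping.single w c = Poly_Mapping.single w (a * c)"
    by (simp add: scalar_def mult_single)
  then show ?case by (simp add: ev_single mult.assoc)
qed (simp_all add: ev_zero distrib_left ev_add)

lemma ev_one: "ev q 1 f = f"
  unfolding single_one[symmetric] ev_single by (simp add: zero_free_monoid_def)

lemma ev_gen: "ev q (gen g) f = gact q g f" and ev_scalar: "ev q (scalar a) f = (\<lambda>S B. a * f S B)"
  using ev_gen_mult[of q g 1] ev_scalar_mult[of q a 1] by (simp_all add: ev_one)

lemma ev_mult: "ev q (p * r) f = ev q p (ev q r f)"
proof -
  have "p \<in> carrier (free_algebra UNIV)" by (simp add: free_algebra_def)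
  then show ?thesis
    by (induction rule: hc_induct) (simp_all add: ev_one ev_gen_mult ev_scalar_mult ev_add mult.assoc distrib_right)
qed

lemma ev_linear_zero: "ev q p (\<lambda>S B. 0) = (\<lambda>S B. 0)"
proof -
  have "p \<in> carrier (free_algebra UNIV)" by (simp add: free_algebra_def)
  then show ?thesis
    by (induction rule: hc_induct) (simp_all add: ev_one ev_gen_mult ev_scalar_mult ev_add gact_linear)
qed

lemma ev_relator: assumes "q \<noteq> 0" "p \<in> hc_relators n q" shows "ev q p f S B = 0"
proof -
  note [simp del] = gact.simps
  have braid: "gact q (T_gen i) (gact q (T_gen (i + 1)) (gact q (T_gen i) f)) S B =
    gact q (T_gen (i + 1)) (gact q (T_gen i) (gact q (T_gen (i + 1)) f)) S B" for i
    using gact_T_braid[OF assms(1)] by simp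
  have TC: "gact q (T_gen i) (gact q (C_gen i) f) S B = gact q (C_gen (i + 1)) (gact q (T_gen i) f) S B"
    "gact q (T_gen i) (gact q (C_gen (i + 1)) f) S B =
      gact q (C_gen i) (gact q (T_gen i) f) S B - (q - inverse q) * (gact q (C_gen i) f S B - gact q (C_gen (i + 1)) f S B)" for i
    using gact_TC[OF assms(1)] by simp_all
  note ev = ev_diff ev_add ev_uminus ev_mult ev_gen ev_scalar_mult ev_scalar ev_one
  show ?thesis using assms(2) unfolding hc_relators_def Let_def Un_iff mem_Collect_eq
    apply (elim disjE exE conjE)
    subgoal by (simp add: ev gact_T_quadratic[OF assms(1)])
    subgoal for i j using gact_T_far[of i j q f S B] by (simp add: ev)
    subgoal for i j using gact_T_far[of i j q f S B] by (simp add: ev)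
    subgoal by (simp only: ev braid) simp
    subgoal by (simp add: ev gact_C_square)
    subgoal for i j using gact_C_anticommute[of i j q f S B] by (simp add: ev)
    subgoal by (simp only: ev TC) simp
    subgoal by (simp only: ev TC) simp
    subgoal for i j by (simp add: ev gact_TC_far)
    done
qed

lemma free_a_inv: assumes "x \<in> carrier (free_algebra X)" shows "\<ominus>\<^bsub>free_algebra X\<^esub> x = - x"
proof -
  interpret F: ring "free_algebra X" by (rule ring_free_algebra)
  show ?thesis by (rule F.minus_equality) (use assms hc_closed in auto)
qed

text \<open>The elements acting as zero form an ideal that contains the relators, so the action
  descends to the quotient.\<close>

lemma ev_ideal:
  assumes "q \<noteq> 0" "p \<in> hc_ideal n q"
  shows "ev q p f S B = 0"
proof -
  define K where "K = {p \<in> carrier (hc_free n). \<forall>f. ev q p f = (\<lambda>S B. 0)}"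
  have "additive_subgroup K (hc_free n)"
  proof (rule additive_subgroupI, rule subgroup.intro)
    show "inv\<^bsub>add_monoid (hc_free n)\<^esub> x \<in> K" if "x \<in> K" for x
      unfolding a_inv_def[symmetric] using that by (auto simp: K_def free_a_inv ev_uminus hc_closed)
  qed (auto simp: K_def ev_add ev_zero hc_closed)
  then have "ideal K (hc_free n)"
    by (intro idealI ring_free_algebra)
      (auto simp: K_def ev_mult ev_linear_zero hc_closed additive_subgroup_def)
  moreover have "hc_relators n q \<subseteq> K"
    using hc_relators_closed[of n q] ev_relator[OF assms(1)] by (auto simp: K_def fun_eq_iff)
  ultimately have "hc_ideal n q \<subseteq> K"
    unfolding hc_ideal_def by (rule hcF.genideal_minimal)
  then show ?thesis using assms(2) by (auto simp: K_def)
qed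

lemma theta_linear:
  "theta q n (\<lambda>S B. f S B + f' S B) = (\<lambda>S B. theta q n f S B + theta q n f' S B)"
  "theta q n (\<lambda>S B. a * f S B) = (\<lambda>S B. a * theta q n f S B)"
proof -
  have "theta_term q n j (\<lambda>S B. f S B + f' S B) S B = theta_term q n j f S B + theta_term q n j f' S B"
    "theta_term q n j (\<lambda>S B. a * f S B) S B = a * theta_term q n j f S B" for j S B
    by (simp_all add: theta_term_def algebra_simps)
  then show "theta q n (\<lambda>S B. f S B + f' S B) = (\<lambda>S B. theta q n f S B + theta q n f' S B)"
    "theta q n (\<lambda>S B. a * f S B) = (\<lambda>S B. a * theta q n f S B)"
    by (simp_all add: fun_eq_iff theta_def sum.distrib sum_distrib_left)
qed

lemma theta_ev:
  assumes "q \<noteq> 0" "p \<in> carrier (hc_free n)"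
  shows "theta q n (ev q p f) = ev q p (theta q n f)"
  using assms(2)
proof (induction rule: hc_induct)
  case (gen g x)
  have "theta q n (gact q g (ev q x f)) = gact q g (theta q n (ev q x f))"
    using gen(1) theta_T[OF assms(1)] theta_C by (fastforce simp: fun_eq_iff hc_generators_def simp del: gact.simps)
  then show ?case by (simp add: ev_gen_mult gen)
qed (simp_all add: ev_one ev_scalar_mult ev_add theta_linear)

text \<open>The vector \<open>v\<close> of the overview, with empty Clifford monomial.\<close>

definition vac :: "nat \<Rightarrow> 'a::field hc_module"
  where "vac m S B = (if (\<forall>j. \<not> S j) \<and> (\<forall>j. B j \<longleftrightarrow> 1 \<le> j \<and> j \<le> m) then 1 else 0)"

lemma vac_T:
  assumes "1 \<le> i" "i < m"
  shows "gact q (T_gen i) (vac m) S B = q * vac m S B"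
proof -
  define K :: 'a where "K = (if \<forall>j. j \<noteq> i \<and> j \<noteq> Suc i \<longrightarrow> \<not> S j \<and> (B j \<longleftrightarrow> 1 \<le> j \<and> j \<le> m) then 1 else 0)"
  have v: "vac m (upd2 i S s1 s2) (upd2 i B b1 b2) = K * (if \<not> s1 \<and> \<not> s2 \<and> b1 \<and> b2 then 1 else 0)" for s1 s2 b1 b2
  proof -
    have all: "(\<forall>j. P j) \<longleftrightarrow> P i \<and> P (Suc i) \<and> (\<forall>j. j \<noteq> i \<and> j \<noteq> Suc i \<longrightarrow> P j)" for P by metis
    show ?thesis unfolding vac_def K_def
      by (subst (1 2) all) (use assms in \<open>auto simp: upd2_other\<close>)
  qed
  have "local_act q (\<lambda>s1 s2 b1 b2. K * (if \<not> s1 \<and> \<not> s2 \<and> b1 \<and> b2 then 1 else 0)) s1 s2 b1 b2 =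
    q * (K * (if \<not> s1 \<and> \<not> s2 \<and> b1 \<and> b2 then 1 else 0))" for s1 s2 b1 b2
    by (cases s1; cases s2; cases b1; cases b2; simp add: local_act_defs)
  then show ?thesis using v[of "S i" "S (Suc i)" "B i" "B (Suc i)"] by (simp add: v)
qed

definition Theta :: "'a::field \<Rightarrow> nat \<Rightarrow> hc_generator free_monoid \<Rightarrow>\<^sub>0 'a"
  where "Theta q m = (\<Sum>j\<in>{1..m}. scalar (q ^ (2 * (j - 1))) * hc_C j)"

lemma ev_Theta: "ev q (Theta q m) f = (\<lambda>S B. \<Sum>j\<in>{1..m}. q ^ (2 * (j - 1)) * gact q (C_gen j) f S B)"
  by (simp add: Theta_def ev_sum ev_scalar_mult ev_gen del: gact.simps)

lemma Theta_closed: fixes q :: "'a::field" shows "m \<le> n \<Longrightarrow> Theta q m \<in> carrier (hc_free n)"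
proof (induction m)
  case 0
  then show ?case using hc_closed(5) by (simp add: Theta_def)
next
  case (Suc m)
  have "Theta q (Suc m) = Theta q m + scalar (q ^ (2 * m)) * hc_C (Suc m)" by (simp add: Theta_def)
  moreover have "Theta q m \<in> carrier (hc_free n)" using Suc by simp
  moreover have "hc_C (Suc m) \<in> carrier (hc_free n :: (_ \<Rightarrow>\<^sub>0 'a) ring)" using Suc by (intro hc_gens_closed) auto
  ultimately show ?case by (metis hc_closed(1,2) hc_gens_closed(3))
qed

lemma sum_antisymmetric:
  fixes a :: "nat \<Rightarrow> nat \<Rightarrow> 'a::ab_group_add"
  assumes "\<And>j k. j \<noteq> k \<Longrightarrow> a j k = - a k j" "finite J"
  shows "(\<Sum>j\<in>J. \<Sum>k\<in>J. a j k) = (\<Sum>j\<in>J. a j j)"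
  using assms(2)
proof (induction J rule: finite_induct)
  case (insert x J)
  have "(\<Sum>j\<in>J. a j x) = (\<Sum>j\<in>J. - a x j)"
    using insert(2) by (intro sum.cong refl assms(1)) auto
  then show ?case using insert by (simp add: sum.distrib sum_negf)
qed simp

lemma gact_sum: "gact q g (\<lambda>S B. \<Sum>j\<in>J. F j S B) = (\<lambda>S B. \<Sum>j\<in>J. gact q g (F j) S B)"
  by (induction J rule: infinite_finite_induct) (simp_all add: gact_linear)

text \<open>The mixed terms cancel in pairs because the \<open>C j\<close> anticommute.\<close>

lemma Theta_square: "ev q (Theta q m) (ev q (Theta q m) f) S B = (\<Sum>j<m. (q ^ 4) ^ j) * f S B"
proof -
  define a where "a j k = q ^ (2 * (j - 1)) * (q ^ (2 * (k - 1)) * gact q (C_gen j) (gact q (C_gen k) f) S B)" for j k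
  have "ev q (Theta q m) (ev q (Theta q m) f) S B = (\<Sum>j\<in>{1..m}. \<Sum>k\<in>{1..m}. a j k)"
    by (simp add: ev_Theta gact_sum gact_linear sum_distrib_left a_def del: gact.simps)
  also have "\<dots> = (\<Sum>j\<in>{1..m}. a j j)"
  proof (rule sum_antisymmetric)
    show "a j k = - a k j" if "j \<noteq> k" for j k
      unfolding a_def gact_C_anticommute[OF that] by simp
  qed simp
  also have "\<dots> = (\<Sum>j\<in>{1..m}. (q ^ 4) ^ (j - 1) * f S B)"
    by (rule sum.cong) (simp_all add: a_def gact_C_square power_mult[symmetric] power_add[symmetric] mult.assoc[symmetric] del: gact.simps)
  also have "\<dots> = (\<Sum>j<m. (q ^ 4) ^ j * f S B)"
    by (rule sum.reindex_bij_witness[of _ Suc "\<lambda>j. j - 1"]) auto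
  finally show ?thesis by (simp add: sum_distrib_right)
qed

text \<open>On an empty Clifford monomial left and right multiplication by \<open>C j\<close> agree,
  and the weight at a marked \<open>j\<close> counts the \<open>j - 1\<close> marks before
  it.\<close>

lemma theta_vac:
  fixes q :: "'a::field"
  assumes "m \<le> n"
  shows "theta q n (vac m) = ev q (Theta q m) (vac m)"
proof (intro ext)
  fix S B
  show "theta q n (vac m) S B = ev q (Theta q m) (vac m) S B"
  proof (cases "\<forall>j. B j \<longleftrightarrow> 1 \<le> j \<and> j \<le> m")
    case False
    then have "vac m S' B = (0 :: 'a)" for S' by (simp add: vac_def)
    moreover from this have "theta_term q n j (vac m) S B = 0" for j by (simp add: theta_term_def)
    ultimately show ?thesis by (simp add: theta_def ev_Theta)
  next
    case B: True
    have "theta_term q n j (vac m) S B = q ^ (2 * (j - 1)) * gact q (C_gen j) (vac m) S B" if j: "j \<in> {1..m}" for j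
    proof (cases "vac m (S(j := \<not> S j)) B = (0 :: 'a)")
      case False
      then have S: "\<not> S k" if "k \<noteq> j" for k using that by (auto simp: vac_def split: if_splits)
      have "(\<Prod>k\<in>{0<..<j}. if B k then q\<^sup>2 else 1) = (\<Prod>k\<in>{0<..<j}. q\<^sup>2)"
        using j by (intro prod.cong) (auto simp: B)
      moreover have "(\<Prod>k\<in>{j<..n}. bit_sign (S k)) = (1 :: 'a)" "(\<Prod>k<j. bit_sign (S k)) = (1 :: 'a)"
        by (auto intro!: prod.neutral simp: bit_sign_def S)
      ultimately show ?thesis using j B by (simp add: theta_term_def power_mult)
    qed (simp add: theta_term_def)
    moreover have "theta_term q n j (vac m) S B = 0" if "j \<in> {1..n} - {1..m}" for j
      using that by (simp add: theta_term_def B)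
    ultimately show ?thesis
      unfolding theta_def ev_Theta using assms
      by (subst sum.mono_neutral_right[of "{1..n}" "{1..m}"]) (auto intro!: sum.cong simp del: gact.simps)
  qed
qed

text \<open>Comparison of coefficients in \<open>T i u = q u\<close> where both letters are marked,
  so that the word contributes just a factor \<open>q\<close>. In \<open>not_semisimple\<close>, the
  second equation extends the vanishing given by the first from the monomial on 1 and 2 to all those
  on 1 and \<open>j\<close>.\<close>

lemma eigenvector_condition:
  assumes u: "gact q (T_gen i) u S B = q * u S B" and B: "B i" "B (Suc i)" and q: "q \<noteq> 0" "q\<^sup>2 \<noteq> 1"
  shows "\<not> S i \<Longrightarrow> \<not> S (Suc i) \<Longrightarrow> u (S(i := True, Suc i := True)) B = 0"
    "\<not> S i \<Longrightarrow> S (Suc i) \<Longrightarrow> u S B = q\<^sup>2 * u (S(i := True, Suc i := False)) B"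
proof -
  have e: "q - inverse q \<noteq> 0" using q by (simp add: field_simps power2_eq_square)
  have upB: "upd2 i B True True = B" using B by (auto simp: upd2_def fun_eq_iff)
  assume S: "\<not> S i"
  {
    assume S': "\<not> S (Suc i)"
    have "upd2 i S False False = S" using S S' by (auto simp: upd2_def fun_eq_iff)
    then have "(q - inverse q) * u (upd2 i S True True) B = 0"
      using u S S' B upB by (simp add: local_act_defs)
    then show "u (S(i := True, Suc i := True)) B = 0" using e by (simp add: upd2_def)
  next
    assume S': "S (Suc i)"
    have "upd2 i S False True = S" using S S' by (auto simp: upd2_def fun_eq_iff)
    then have "q * u (upd2 i S True False) B + (q - inverse q) * u S B = q * u S B"
      using u S S' B upB by (simp add: local_act_defs)
    then have "q * u (upd2 i S True False) B = inverse q * u S B" by (simp add: algebra_simps)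
    then show "u S B = q\<^sup>2 * u (S(i := True, Suc i := False)) B"
      using q(1) by (simp add: upd2_def field_simps power2_eq_square)
  }
qed

theorem not_semisimple:
  fixes q :: "'a::field"
  assumes q: "q \<noteq> 0" "q ^ 4 \<noteq> 1" and m: "1 \<le> m" "m \<le> n" "q ^ (4 * m) = 1"
  shows "\<not> semisimple_ring (hecke_clifford n q)"
proof
  let ?R = "hecke_clifford n q"
  assume ss: "semisimple_ring ?R"
  have q2: "q\<^sup>2 \<noteq> 1" using q(2) by (metis power2_eq_square power4_eq_xxxx mult.assoc mult_1)
  define w where "w = ev q (Theta q m) (vac m)"
  define L where "L = {r \<in> carrier (hc_free n). ev q r w = (\<lambda>S B. 0)}"
  have w: "w = theta q n (vac m)" unfolding w_def using theta_vac[OF m(2)] by metis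
  have Lc: "r \<in> carrier (hc_free n)" if "r \<in> L" for r using that by (simp add: L_def)
  have TL: "hc_T i - scalar q \<in> L" if i: "1 \<le> i" "i < m" for i
  proof -
    have c: "hc_T i \<in> carrier (hc_free n :: (_ \<Rightarrow>\<^sub>0 'a) ring)" using i m by (intro hc_gens_closed) auto
    have "gact q (T_gen i) w S B = q * w S B" for S B
    proof -
      have "gact q (T_gen i) w = theta q n (gact q (T_gen i) (vac m))"
        unfolding w using theta_T[OF q(1) i(1)] i m by (simp add: fun_eq_iff del: gact.simps)
      also have "gact q (T_gen i) (vac m) = (\<lambda>S B. q * vac m S B)" using vac_T[OF i, of q] by (simp add: fun_eq_iff del: gact.simps)
      finally show ?thesis unfolding w by (simp add: theta_linear del: gact.simps)
    qed
    then show ?thesis using hc_closed_diff[OF c hc_gens_closed(3)] by (simp add: L_def ev_diff ev_gen ev_scalar del: gact.simps)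
  qed
  have "(q ^ 4 - 1) * (\<Sum>j<m. (q ^ 4) ^ j) = 0"
    using m(3) by (simp add: power_diff_1_eq[symmetric] power_mult)
  then have "ev q (Theta q m) w = (\<lambda>S B. 0)" using q(2) by (simp add: w_def fun_eq_iff Theta_square)
  then have ThL: "Theta q m \<in> L" using Theta_closed[OF m(2)] by (simp add: L_def)
  have Lop: "0 \<in> L" "r \<in> L \<Longrightarrow> s \<in> L \<Longrightarrow> r + s \<in> L" "r \<in> L \<Longrightarrow> - r \<in> L" "a \<in> carrier (hc_free n) \<Longrightarrow> r \<in> L \<Longrightarrow> a * r \<in> L" for r s a
    by (auto simp: L_def hc_closed ev_zero ev_add ev_uminus ev_mult ev_linear_zero)
  have "left_ideal (cls n q ` L) ?R"
    unfolding left_ideal_def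
  proof (intro conjI ballI)
    have zero: "cls n q 0 = \<zero>\<^bsub>?R\<^esub>"
      using ring_hom_zero[OF cls_hom hcF.ring_axioms hcR.ring_axioms] by simp
    have inv: "\<ominus>\<^bsub>?R\<^esub> cls n q r = cls n q (- r)" if "r \<in> L" for r
    proof (rule hcR.minus_equality)
      have "cls n q (- r) \<oplus>\<^bsub>?R\<^esub> cls n q r = cls n q 0" using cls_add[of "- r" n r q] Lc Lop(3) that by simp
      also note zero
      finally show "cls n q (- r) \<oplus>\<^bsub>?R\<^esub> cls n q r = \<zero>\<^bsub>?R\<^esub>" .
    qed (use cls_closed[OF Lc[OF that]] cls_closed[OF Lc[OF Lop(3)[OF that]]] in auto)
    show "additive_subgroup (cls n q ` L) ?R"
    proof (rule additive_subgroupI, rule subgroup.intro)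
      show "cls n q ` L \<subseteq> carrier (add_monoid ?R)" using Lc cls_closed by auto
      show "\<one>\<^bsub>add_monoid ?R\<^esub> \<in> cls n q ` L"
        using zero[symmetric] Lop(1) by auto
      show "x \<otimes>\<^bsub>add_monoid ?R\<^esub> y \<in> cls n q ` L" if xy: "x \<in> cls n q ` L" "y \<in> cls n q ` L" for x y
      proof -
        obtain r s where rs: "r \<in> L" "s \<in> L" "x = cls n q r" "y = cls n q s" using xy by blast
        have "x \<oplus>\<^bsub>?R\<^esub> y = cls n q (r + s)" using cls_add[OF Lc Lc, OF rs(1,2)] rs by simp
        then show ?thesis using Lop(2)[OF rs(1,2)] by simp
      qed
      show "inv\<^bsub>add_monoid ?R\<^esub> x \<in> cls n q ` L" if "x \<in> cls n q ` L" for x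
        unfolding a_inv_def[symmetric] using that inv Lop(3) by auto
    qed
    fix a x assume "a \<in> carrier ?R" "x \<in> cls n q ` L"
    then obtain a' r where "a' \<in> carrier (hc_free n)" "a = cls n q a'" "r \<in> L" "x = cls n q r"
      by (metis cls_surj imageE)
    then show "a \<otimes>\<^bsub>?R\<^esub> x \<in> cls n q ` L" using cls_mult[of a' n r q] Lc Lop(4) by auto
  qed
  from semisimple_left_ideal_unit[OF ss this] obtain l' where
    l': "l' \<in> cls n q ` L" "\<And>r. r \<in> cls n q ` L \<Longrightarrow> r \<otimes>\<^bsub>?R\<^esub> l' = r" by metis
  then obtain l where l: "l \<in> L" "l' = cls n q l" by blast
  define u where "u = ev q l (vac m)"
  have ru: "ev q r u = ev q r (vac m)" if r: "r \<in> L" for r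
  proof -
    have "cls n q (r * l) = cls n q r" using l'(2)[of "cls n q r"] r l cls_mult[OF Lc Lc] by auto
    then have "r * l - r \<in> hc_ideal n q" using cls_eq_iff[of "r * l" n r q] r l Lc hc_closed(2) by metis
    from ev_ideal[OF q(1) this] show ?thesis by (simp add: fun_eq_iff u_def ev_diff ev_mult)
  qed
  have Tu: "gact q (T_gen i) u S B = q * u S B" if i: "1 \<le> i" "i < m" for i S B
  proof -
    have "ev q (hc_T i - scalar q) u S B = ev q (hc_T i - scalar q) (vac m) S B" using ru[OF TL[OF i]] by metis
    then show ?thesis using vac_T[OF i, of q S B] by (simp add: ev_diff ev_gen ev_scalar del: gact.simps)
  qed
  define M where "M j \<longleftrightarrow> 1 \<le> j \<and> j \<le> m" for j
  have M: "M j" if "1 \<le> j" "j \<le> m" for j using that by (simp add: M_def)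
  have u0: "u (\<lambda>k. k = 1 \<or> k = j) M = 0" if "2 \<le> j" "j \<le> m" for j
    using that
  proof (induction j rule: nat_induct_at_least)
    case base
    have "(\<lambda>_. False)(1 := True, Suc 1 := True) = (\<lambda>k. k = 1 \<or> k = 2)" by (auto simp: fun_eq_iff)
    then show ?case
      using eigenvector_condition(1)[OF Tu[of 1], of M "\<lambda>_. False"] base q2 q(1) M[of 1] M[of 2]
      by (simp add: numeral_2_eq_2)
  next
    case (Suc j)
    let ?S = "\<lambda>k. k = 1 \<or> k = Suc j"
    have "?S(j := True, Suc j := False) = (\<lambda>k. k = 1 \<or> k = j)" using Suc(1) by (auto simp: fun_eq_iff)
    then show ?case
      using eigenvector_condition(2)[OF Tu[of j], of M ?S] Suc q2 q(1) M[of j] M[of "Suc j"] by simp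
  qed
  \<comment> \<open>The coefficient to compare is the one at \<open>C 1\<close>. In both
    \<open>theta u\<close> and \<open>Theta u\<close> the terms with \<open>j \<ge> 2\<close> vanish
    by \<open>u0\<close>, and the term \<open>j = 1\<close> is the value of \<open>u\<close> at the
    empty monomial. This value is thus 0, but it is also 1, the coefficient of
    \<open>Theta v\<close>.\<close>
  define S1 :: "nat \<Rightarrow> bool" where "S1 k \<longleftrightarrow> k = 1" for k
  have flip: "S1(1 := \<not> S1 1) = (\<lambda>_. False)" "2 \<le> j \<Longrightarrow> S1(j := \<not> S1 j) = (\<lambda>k. k = 1 \<or> k = j)" for j
    by (auto simp: S1_def fun_eq_iff)
  have split: "{1..k} = insert 1 {2..k}" if "1 \<le> k" for k :: nat using that by auto
  have "theta q n u S1 M = 0"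
  proof -
    have "theta q n u = ev q l w" unfolding u_def w by (rule theta_ev[OF q(1) Lc[OF l(1)]])
    then show ?thesis using l(1) by (simp add: L_def)
  qed
  moreover have "theta q n u S1 M = u (\<lambda>_. False) M"
  proof -
    have "theta_term q n 1 u S1 M = u (\<lambda>_. False) M"
    proof -
      have "(\<Prod>k\<in>{1<..n}. bit_sign (S1 k)) = (1 :: 'a)" by (auto intro!: prod.neutral simp: bit_sign_def S1_def)
      moreover have "{0<..<Suc 0} = {}" by auto
      ultimately show ?thesis using m flip(1) by (simp add: theta_term_def M_def)
    qed
    moreover have "theta_term q n j u S1 M = 0" if "2 \<le> j" for j
      using that u0[of j] flip(2)[of j] by (simp add: theta_term_def M_def)
    ultimately show ?thesis unfolding theta_def split[OF order_trans[OF m(1,2)]] by simp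
  qed
  moreover have eqTh: "ev q (Theta q m) f S1 M = f (\<lambda>_. False) M"
    if "\<And>j. 2 \<le> j \<Longrightarrow> j \<le> m \<Longrightarrow> f (\<lambda>k. k = 1 \<or> k = j) M = 0" for f
  proof -
    have "gact q (C_gen 1) f S1 M = f (\<lambda>_. False) M"
      using flip(1) by (simp add: S1_def bit_sign_def)
    moreover have "gact q (C_gen j) f S1 M = 0" if "2 \<le> j" "j \<le> m" for j
      using flip(2)[of j] that \<open>\<And>j. 2 \<le> j \<Longrightarrow> j \<le> m \<Longrightarrow> f (\<lambda>k. k = 1 \<or> k = j) M = 0\<close>[of j] by simp
    ultimately show ?thesis unfolding ev_Theta split[OF m(1)] by (simp del: gact.simps)
  qed
  moreover have "ev q (Theta q m) u S1 M = u (\<lambda>_. False) M" using eqTh u0 by blast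
  moreover have "ev q (Theta q m) (vac m) S1 M = vac m (\<lambda>_. False) M"
    by (rule eqTh) (auto simp: vac_def)
  moreover have "vac m (\<lambda>_. False) M = (1 :: 'a)" by (simp add: vac_def M_def)
  ultimately show False using ru[OF ThL] by simp
qed

theorem theorem6p11:
  fixes q :: "'a::alg_closed_field" and n h k :: nat
  assumes char: "CHAR('a) \<noteq> 2"
    and q: "q \<noteq> 0" "q \<noteq> 1" "q \<noteq> -1"
    and root: "primitive_root_of_unity k q"
    and h: "(odd k \<and> h = k) \<or> (\<exists>l. k = 4 * l \<and> h = 2 * l)"
    and h3: "h \<ge> 3"
    and n: "n \<ge> 1"
  shows "(odd h \<longrightarrow> (semisimple_ring (hecke_clifford n q) \<longleftrightarrow> h > n)) \<and>
         (even h \<longrightarrow> (semisimple_ring (hecke_clifford n q) \<longleftrightarrow> h > 2 * n))"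
proof -
  have dvd: "q ^ j = 1 \<longleftrightarrow> k dvd j" for j
  proof
    assume j: "q ^ j = 1"
    have "q ^ j = q ^ (k * (j div k) + j mod k)" by simp
    also have "\<dots> = q ^ (j mod k)" unfolding power_add power_mult using root by (simp add: primitive_root_of_unity_def)
    finally show "k dvd j" using j root unfolding primitive_root_of_unity_def
      by (metis mod_less_divisor mod_0_imp_dvd gr0I)
  next
    assume "k dvd j"
    then show "q ^ j = 1" using root by (auto simp: primitive_root_of_unity_def power_mult)
  qed
  have "(2 :: 'a) \<noteq> 0"
  proof
    assume "(2 :: 'a) = 0"
    then have "of_nat 2 = (0 :: 'a)" by simp
    then have "CHAR('a) dvd 2" by (simp only: of_nat_eq_0_iff_char_dvd)
    moreover have "CHAR('a) \<noteq> 1" using of_nat_CHAR[where 'a = 'a] by (metis of_nat_1 one_neq_zero)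
    ultimately show False using char using two_is_prime_nat unfolding prime_nat_iff by blast
  qed
  \<comment> \<open>The order of \<open>q ^ 4\<close>: for odd \<open>k\<close> the factor 4 is
    invertible modulo \<open>k\<close>, and for \<open>k = 4 * l\<close> what is left is
    \<open>l = h div 2\<close>.\<close>
  define d where "d = (if odd h then h else h div 2)"
  have d: "q ^ (4 * j) = 1 \<longleftrightarrow> d dvd j" for j
    using h
  proof
    assume o: "odd k \<and> h = k"
    then have "coprime k 2" by simp
    then have "coprime k (2 ^ 2)" by (simp only: coprime_power_right_iff simp_thms)
    then have "k dvd 4 * j \<longleftrightarrow> k dvd j" using coprime_dvd_mult_right_iff[of k 4 j] by simp
    then show ?thesis using o by (simp add: d_def dvd)
  next
    assume "\<exists>l. k = 4 * l \<and> h = 2 * l"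
    then show ?thesis by (auto simp: d_def dvd)
  qed
  \<comment> \<open>That is, \<open>q ^ 4 \<noteq> 1\<close>, as \<open>not_semisimple\<close>
    requires.\<close>
  have d1: "1 < d" using h3 h by (auto simp: d_def)
  have "semisimple_ring (hecke_clifford n q) \<longleftrightarrow> n < d"
  proof
    show "n < d" if "semisimple_ring (hecke_clifford n q)"
    proof (rule ccontr)
      assume "\<not> n < d"
      moreover have "q ^ 4 \<noteq> 1" using d[of 1] d1 by auto
      ultimately show False using that not_semisimple[of q d n] q(1) d d1 by auto
    qed
    assume "n < d"
    then have "generic_parameter q n"
      using q \<open>2 \<noteq> 0\<close> n d by unfold_locales (auto dest: dvd_imp_le)
    then show "semisimple_ring (hecke_clifford n q)" by (rule semisimple_if_generic)
  qed
  then show ?thesis by (auto simp: d_def elim!: evenE)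
qed

end
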